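(* For every connected graph $G$ and every $x\in V(G)$, the pair $(G,h_x)$ is not choosable if and only if $(G,h_x)$ is not AT. Moreover, $(G,h_x)$ is not paintable if and only if $(G,h_x)$ is not AT.
   Context: For an orientation $D$ of a graph, a spanning Eulerian subgraph is a spanning subgraph in which every vertex has indegree equal to outdegree; $EE(D)$ (resp. $EO(D)$) is the number of spanning Eulerian subgraphs with an even (resp. odd) number of edges. $D$ is AT if $EE(D)\ne EO(D)$. $h_x(x)=1$ and $h_x(v)=0$ for $v\ne x$; $(G,h_x)$ is AT if $G$ has an AT orientation in which every vertex $v$ has outdegree at most $d_G(v)-h_x(v)-1$. The pair $(G,h_x)$ is choosable if $G$ has a proper coloring $\varphi$ with $\varphi(v)\in L(v)$ for all $v$ whenever $L$ is a list assignment with $|L(x)|=d(x)-1$ and $|L(v)|=d(v)$ for all $v\ne x$. For $f:V(G)\to\mathbb{Z}$, $G$ is $f$-paintable if either $G$ is empty, or $f(v)\ge1$ for all $v$ and for every $S\subseteq V(G)$ there is an independent set $I\subseteq S$ such that $G-I$ is $f'$-paintable, where $f'(v)=f(v)$ for $v\in V(G)\setminus S$ and $f'(v)=f(v)-1$ for $v\in S\setminus I$. The pair $(G,h_x)$ is paintable if $G$ is $(d_G-h_x)$-paintable.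
   Formalization: In the definition of choosable, the list size d(x)−1 is read as 0 when x is isolated (only G=K1); read literally, |L(x)|=−1 would make K1 vacuously choosable although it is not AT, so the statement would fail there. *)

theory Defs
  imports "Graph_Theory.Graph_Theory"
begin

text \<open>
  Finite simple graphs are \<^locale>\<open>pair_graph\<close>s: an edge \<open>uv\<close> is the pair of opposite arcs
  \<open>(u,v)\<close>, \<open>(v,u)\<close>, so the degree of a vertex is its out-degree in the symmetric digraph.
\<close>

abbreviation deg :: "'a pair_pre_digraph \<Rightarrow> 'a \<Rightarrow> nat" where
  "deg G v \<equiv> out_degree (with_proj G) v"

definition orientation :: "'a pair_pre_digraph \<Rightarrow> 'a pair_pre_digraph \<Rightarrow> bool" where
  "orientation D G \<longleftrightarrow>
     pverts D = pverts G \<and>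
     parcs D \<union> (parcs D)\<inverse> = parcs G \<and>
     parcs D \<inter> (parcs D)\<inverse> = {}"

definition spanning_eulerian :: "'a pair_pre_digraph \<Rightarrow> 'a pair_pre_digraph \<Rightarrow> bool" where
  "spanning_eulerian H D \<longleftrightarrow>
     spanning (with_proj H) (with_proj D) \<and>
     (\<forall>v \<in> pverts H. in_degree (with_proj H) v = out_degree (with_proj H) v)"

definition EE :: "'a pair_pre_digraph \<Rightarrow> nat" where
  "EE D = card {H :: 'a pair_pre_digraph. spanning_eulerian H D \<and> even (card (parcs H))}"

definition EO :: "'a pair_pre_digraph \<Rightarrow> nat" where
  "EO D = card {H :: 'a pair_pre_digraph. spanning_eulerian H D \<and> odd (card (parcs H))}"

definition AT_digraph :: "'a pair_pre_digraph \<Rightarrow> bool" where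
  "AT_digraph D \<longleftrightarrow> EE D \<noteq> EO D"

definition h :: "'a \<Rightarrow> 'a \<Rightarrow> int" where
  "h x v = (if v = x then 1 else 0)"

definition AT :: "'a pair_pre_digraph \<Rightarrow> ('a \<Rightarrow> int) \<Rightarrow> bool" where
  "AT G g \<longleftrightarrow>
     (\<exists>D. orientation D G \<and> AT_digraph D \<and>
       (\<forall>v \<in> pverts G. int (out_degree (with_proj D) v) \<le> int (deg G v) - g v - 1))"

definition proper_coloring :: "'a pair_pre_digraph \<Rightarrow> ('a \<Rightarrow> 'c) \<Rightarrow> bool" where
  "proper_coloring G \<phi> \<longleftrightarrow> (\<forall>u v. (u, v) \<in> parcs G \<longrightarrow> \<phi> u \<noteq> \<phi> v)"

text \<open>
  The list size \<open>d(x) - 1\<close> is a truncated difference: at an isolated vertex \<open>x\<close>, where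
  \<open>d(x) - 1 = -1\<close>, the list is empty (and hence no colouring exists), rather than there being
  no admissible list assignment at all.
\<close>

definition h_choosable :: "'a pair_pre_digraph \<Rightarrow> 'a \<Rightarrow> bool" where
  "h_choosable G x \<longleftrightarrow>
     (\<forall>L :: 'a \<Rightarrow> nat set.
       (\<forall>v \<in> pverts G. finite (L v)) \<and>
       card (L x) = deg G x - 1 \<and>
       (\<forall>v \<in> pverts G. v \<noteq> x \<longrightarrow> card (L v) = deg G v) \<longrightarrow>
       (\<exists>\<phi>. proper_coloring G \<phi> \<and> (\<forall>v \<in> pverts G. \<phi> v \<in> L v)))"

definition independent_set :: "'a pair_pre_digraph \<Rightarrow> 'a set \<Rightarrow> bool" where
  "independent_set G I \<longleftrightarrow> I \<subseteq> pverts G \<and> (\<forall>u \<in> I. \<forall>v \<in> I. (u, v) \<notin> parcs G)"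

definition delete_verts :: "'a pair_pre_digraph \<Rightarrow> 'a set \<Rightarrow> 'a pair_pre_digraph" where
  "delete_verts G I =
     \<lparr> pverts = pverts G - I,
       parcs = {(u, v) \<in> parcs G. u \<notin> I \<and> v \<notin> I} \<rparr>"

text \<open>
  For \<open>S = {}\<close> the recursive condition only says that \<open>G\<close> is \<open>f\<close>-paintable if \<open>G\<close> is
  \<open>f\<close>-paintable; this circular instance must be left out of an inductive definition.
  Lemma \<open>paintable_iff\<close> shows that the recursion over all \<open>S\<close> holds nevertheless.
\<close>

inductive paintable :: "'a pair_pre_digraph \<Rightarrow> ('a \<Rightarrow> int) \<Rightarrow> bool" where
  empty: "pverts G = {} \<Longrightarrow> paintable G f"
| step: "\<lbrakk>\<And>v. v \<in> pverts G \<Longrightarrow> f v \<ge> 1;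
         \<And>S. S \<subseteq> pverts G \<Longrightarrow> S \<noteq> {} \<Longrightarrow>
           \<exists>I. I \<subseteq> S \<and> independent_set G I \<and>
               paintable (delete_verts G I) (\<lambda>v. if v \<in> S then f v - 1 else f v)\<rbrakk>
         \<Longrightarrow> paintable G f"

lemma delete_verts_empty [simp]: "delete_verts G {} = G"
  by (simp add: delete_verts_def)

lemma paintable_iff:
  "paintable G f \<longleftrightarrow>
     pverts G = {} \<or>
     (\<forall>v \<in> pverts G. f v \<ge> 1) \<and>
     (\<forall>S \<subseteq> pverts G. \<exists>I \<subseteq> S. independent_set G I \<and>
        paintable (delete_verts G I) (\<lambda>v. if v \<in> S then f v - 1 else f v))"
  (is "?L \<longleftrightarrow> ?R")
proof
  assume L: ?L
  have 0: "\<exists>I \<subseteq> {}. independent_set G I \<and>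
      paintable (delete_verts G I) (\<lambda>v. if v \<in> {} then f v - 1 else f v)"
    using L by (simp add: independent_set_def)
  from L show ?R
  proof cases
    case empty
    then show ?thesis by simp
  next
    case step
    then show ?thesis using 0 by metis
  qed
next
  assume ?R
  then show ?L
    by (auto intro: paintable.empty paintable.step)
qed

end

theory Submission
  imports Defs
begin

text \<open>
  Alon--Tarsi orientations give paintability (signed counts of sub-digraphs with prescribed
  balance, and inclusion--exclusion over the set \<open>S\<close> offered by the opponent), and paintability
  gives choosability. For the remaining implication, a pair that is not AT must have a bad list
  assignment. Cut vertices reduce this to a 2-connected graph \<open>U\<close>, where the only difficult case is
  \<open>d(x) \<ge> 3\<close>. Three induced paths joining \<open>x\<close> to another vertex always yield an AT orientation,
  because it has exactly three spanning Eulerian subgraphs and so an odd number of them. Hence \<open>U\<close>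
  contains an induced subdivision of \<open>K\<^sub>4\<close> consisting of a triangle and three legs from the triangle to
  \<open>x\<close>, whose lengths all have the same parity. Every way of attaching a further vertex or path to it
  produces an AT orientation again, except for complete graphs and the Moser spindle; and all three
  exceptional families carry bad lists.
\<close>

section \<open>Signed counts of sub-digraphs\<close>

text \<open>The search for orientations rests on one monotonicity: a vertex added with all its edges
  directed into it lies on no directed cycle, so an AT orientation of an induced subgraph extends
  over a connected graph one neighbour at a time. Demands are therefore stated as lower bounds on
  indegrees (at least 1, and at least 2 at \<open>x\<close>), which do not mention the surrounding
  graph. A pair that is not AT then contains no good configuration anywhere, and if \<open>x\<close>
  has degree at least 2, \<open>U - {x}\<close> is free even of those that only reach indegree 1.
  The obstacle is that the lengths of subdivided edges are unknown, and with them the signs of the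
  Eulerian subgraphs. Counting modulo 2 removes the lengths; signs have to be followed only for even
  cycles and for the comparison of leg parities, where the number of Eulerian subgraphs is even. The
  version without \<open>x\<close>, where every list has the size of the degree, has to be settled
  as well, since it governs \<open>U - {x}\<close> and the lobes at cut vertices.\<close>

definition bal :: "('a \<times> 'a) set \<Rightarrow> 'a \<Rightarrow> int" where
  "bal F v = (\<Sum>e\<in>F. of_bool (fst e = v) - of_bool (snd e = v))"

text \<open>The coefficient of the monomial with exponents \<open>b\<close> in the product of
  \<open>1 - x_u / x_w\<close> over the arcs \<open>(u, w)\<close> of \<open>A\<close>, so up to
  normalisation a coefficient of the graph polynomial. For \<open>b = 0\<close> it is the difference
  of the even and the odd Eulerian count; other \<open>b\<close> arise as soon as an arc is
  removed.\<close>

definition signed_count :: "('a \<times> 'a) set \<Rightarrow> ('a \<Rightarrow> int) \<Rightarrow> int" where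
  "signed_count A b = (\<Sum>F | F \<subseteq> A \<and> bal F = b. (-1) ^ card F)"

definition shift :: "'a \<Rightarrow> 'a \<Rightarrow> ('a \<Rightarrow> int) \<Rightarrow> 'a \<Rightarrow> int" where
  "shift u w b = (\<lambda>v. b v - of_bool (u = v) + of_bool (w = v))"

lemma bal_insert: "finite F \<Longrightarrow> e \<notin> F \<Longrightarrow>
    bal (insert e F) v = of_bool (fst e = v) - of_bool (snd e = v) + bal F v"
  by (simp add: bal_def)

lemma bal_empty [simp]: "bal {} = (\<lambda>_. 0)"
  by (simp add: bal_def fun_eq_iff)

lemma bal_union: "finite F \<Longrightarrow> finite H \<Longrightarrow> F \<inter> H = {} \<Longrightarrow> bal (F \<union> H) v = bal F v + bal H v"
  by (simp add: bal_def sum.union_disjoint)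

text \<open>The same coefficient after the variables of \<open>J\<close> have been set to 1. The
  vertices of \<open>J\<close> will be those painted in one round; their balance is forgotten before
  they are deleted.\<close>

definition free_count :: "('a \<times> 'a) set \<Rightarrow> 'a set \<Rightarrow> ('a \<Rightarrow> int) \<Rightarrow> int" where
  "free_count A J b = (\<Sum>F | F \<subseteq> A \<and> (\<forall>v. v \<notin> J \<longrightarrow> bal F v = b v). (-1) ^ card F)"

lemma signed_count_free: "signed_count A b = free_count A {} b"
  by (simp add: signed_count_def free_count_def fun_eq_iff)

lemma free_count_alt: "finite A \<Longrightarrow>
    free_count A J b = (\<Sum>F\<in>Pow A. if \<forall>v. v \<notin> J \<longrightarrow> bal F v = b v then (-1) ^ card F else 0)"
  unfolding free_count_def by (rule sum.mono_neutral_cong_left) auto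

lemma signed_count_empty: "signed_count {} b = of_bool (b = (\<lambda>_. 0))"
proof -
  have "{F. F \<subseteq> {} \<and> bal F = b} = (if b = (\<lambda>_. 0) then {{}} else {})" by auto
  then show ?thesis unfolding signed_count_def by simp
qed

text \<open>One more factor of the product: subsets with \<open>e\<close> have one more element,
  hence the minus sign, and their other arcs must realise the balance that \<open>e\<close> leaves
  over.\<close>

lemma free_count_insert:
  assumes "finite A" "e \<notin> A"
  shows "free_count (insert e A) J b = free_count A J b - free_count A J (shift (fst e) (snd e) b)"
proof -
  have inj: "inj_on (insert e) (Pow A)" using assms by (auto simp: inj_on_def)
  let ?f = "\<lambda>c F. if \<forall>v. v \<notin> J \<longrightarrow> bal F v = c v then (-1) ^ card F else (0::int)"
  have "free_count (insert e A) J b = sum (?f b) (Pow A) + sum (?f b) (insert e ` Pow A)"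
    unfolding free_count_alt[OF finite.insertI[OF assms(1)]] Pow_insert
    by (rule sum.union_disjoint) (use assms in auto)
  also have "sum (?f b) (insert e ` Pow A) = (\<Sum>F\<in>Pow A. - ?f (shift (fst e) (snd e) b) F)"
    unfolding sum.reindex[OF inj]
  proof (rule sum.cong)
    fix F assume "F \<in> Pow A"
    then have F: "finite F" "e \<notin> F" using assms by (auto intro: finite_subset)
    have "bal (insert e F) v = b v \<longleftrightarrow> bal F v = shift (fst e) (snd e) b v" for v
      using F by (auto simp: bal_insert shift_def algebra_simps)
    then show "(?f b \<circ> insert e) F = - ?f (shift (fst e) (snd e) b) F" using F by auto
  qed simp
  finally show ?thesis using assms by (simp add: free_count_alt sum_negf)
qed

lemma signed_count_insert: "finite A \<Longrightarrow> e \<notin> A \<Longrightarrow>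
    signed_count (insert e A) b = signed_count A b - signed_count A (shift (fst e) (snd e) b)"
  by (simp add: signed_count_free free_count_insert)

definition untouched :: "('a \<times> 'a) set \<Rightarrow> 'a \<Rightarrow> bool" where
  "untouched A z \<longleftrightarrow> (\<forall>e\<in>A. fst e \<noteq> z \<and> snd e \<noteq> z)"

lemma signed_count_untouched: "untouched A z \<Longrightarrow> b z \<noteq> 0 \<Longrightarrow> signed_count A b = 0"
proof -
  assume A: "untouched A z" "b z \<noteq> 0"
  have "bal F z = 0" if "F \<subseteq> A" for F
    unfolding bal_def by (rule sum.neutral) (use that A in \<open>auto simp: untouched_def\<close>)
  then have "{F. F \<subseteq> A \<and> bal F = b} = {}" using A(2) by auto
  then show ?thesis unfolding signed_count_def by (simp only: sum.empty)
qed

section \<open>Contracting directed paths to weighted arcs\<close>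

fun path_arcs :: "'a list \<Rightarrow> ('a \<times> 'a) set" where
  "path_arcs (u # v # p) = insert (u, v) (path_arcs (v # p))"
| "path_arcs _ = {}"

lemma finite_arcs [simp]: "finite (path_arcs p)"
  by (induction p rule: path_arcs.induct) auto

lemma arcs_Cons: "q \<noteq> [] \<Longrightarrow> path_arcs (u # q) = insert (u, hd q) (path_arcs q)"
  by (cases q) auto

lemma arcs_subset: "path_arcs p \<subseteq> set p \<times> set (tl p)"
  by (induction p rule: path_arcs.induct) auto

text \<open>An inner vertex meets only its two path arcs and must have balance zero, so a counted
  subset contains the whole path or none of it. The path acts like one arc from \<open>u\<close> to
  \<open>last q\<close> of weight \<open>(-1) ^ length q\<close>, where \<open>length q\<close> is
  the number of its arcs.\<close>

lemma signed_count_path: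
  assumes "finite A" "q \<noteq> []" "distinct q" "u \<notin> set (butlast q)"
    and "\<forall>z\<in>set (butlast q). untouched A z \<and> b z = 0" "path_arcs (u # q) \<inter> A = {}"
  shows "signed_count (path_arcs (u # q) \<union> A) b =
    signed_count A b + (-1) ^ length q * signed_count A (shift u (last q) b)"
  using assms
proof (induction q arbitrary: u b)
  case Nil
  then show ?case by simp
next
  case (Cons z q)
  show ?case
  proof (cases "q = []")
    case True
    then show ?thesis using Cons.prems by (simp add: signed_count_insert)
  next
    case False
    let ?B = "path_arcs (z # q) \<union> A"
    have z: "untouched A z" "b z = 0" "z \<notin> set q" "z \<noteq> u" using Cons.prems False by auto
    have "distinct (butlast q @ [last q])" using Cons.prems(3) False by simp
    then have lq: "last q \<noteq> z" using z(3) False last_in_set[OF False] by auto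
    have nB: "(u, z) \<notin> ?B" using z(1,3) arcs_subset[of "z # q"] by (auto simp: untouched_def)
    have d: "path_arcs (z # q) \<inter> A = {}" using Cons.prems(6) False by (auto simp: arcs_Cons)
    have IH: "signed_count ?B c = signed_count A c + (-1) ^ length q * signed_count A (shift z (last q) c)"
      if "\<forall>y\<in>set (butlast q). c y = 0" for c
      by (rule Cons.IH) (use Cons.prems False z that d in \<open>auto dest: in_set_butlastD\<close>)
    \<comment> \<open>Without the arc \<open>(u, z)\<close> nothing may leave \<open>z\<close>; with
      it, in fact 2, the rest of the path is forced.\<close>
    have 1: "signed_count ?B b = signed_count A b"
    proof -
      have "signed_count A (shift z (last q) b) = 0"
        by (rule signed_count_untouched[OF z(1)]) (use z lq in \<open>simp add: shift_def\<close>)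
      then show ?thesis using IH[of b] Cons.prems False by simp
    qed
    have 2: "signed_count ?B (shift u z b) = (-1) ^ length q * signed_count A (shift u (last q) b)"
    proof -
      have "signed_count A (shift u z b) = 0"
        by (rule signed_count_untouched[OF z(1)]) (use z in \<open>simp add: shift_def\<close>)
      moreover have "shift z (last q) (shift u z b) = shift u (last q) b"
        by (auto simp: shift_def)
      moreover have "\<forall>y\<in>set (butlast q). shift u z b y = 0"
        using Cons.prems False z by (auto simp: shift_def dest: in_set_butlastD)
      ultimately show ?thesis using IH[of "shift u z b"] by simp
    qed
    have "path_arcs (u # z # q) \<union> A = insert (u, z) ?B" by auto
    then show ?thesis using signed_count_insert[of ?B "(u, z)" b] nB Cons.prems(1) 1 2 False by simp
  qed
qed

definition inner :: "'a list \<Rightarrow> 'a set" where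
  "inner p = set (butlast (tl p))"

text \<open>Internally disjoint paths, which may share ends. The clause about lists of length 2
  excludes parallel and opposite arcs; on a longer path every arc has an inner vertex, so it cannot
  recur elsewhere.\<close>

fun path_system :: "'a list list \<Rightarrow> bool" where
  "path_system [] \<longleftrightarrow> True"
| "path_system (p # ps) \<longleftrightarrow> distinct p \<and> 2 \<le> length p \<and>
     (\<forall>q\<in>set ps. inner p \<inter> set q = {} \<and> inner q \<inter> set p = {} \<and>
       (length p = 2 \<and> length q = 2 \<longrightarrow> set p \<noteq> set q)) \<and> path_system ps"

text \<open>\<open>signed_count\<close> for the multigraph in which each path has become an arc of
  weight \<open>s\<close>. Parallel arcs are now possible, so the recursion runs over a list and not
  over a set.\<close>

fun path_count :: "('a \<times> 'a \<times> int) list \<Rightarrow> ('a \<Rightarrow> int) \<Rightarrow> int" where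
  "path_count [] b = of_bool (b = (\<lambda>_. 0))"
| "path_count ((u, w, s) # ts) b = path_count ts b + s * path_count ts (shift u w b)"

definition path_type :: "'a list \<Rightarrow> 'a \<times> 'a \<times> int" where
  "path_type p = (hd p, last p, (-1) ^ (length p - 1))"

definition all_arcs :: "'a list list \<Rightarrow> ('a \<times> 'a) set" where
  "all_arcs ps = (\<Union>p\<in>set ps. path_arcs p)"

lemma arcs_inner: "(u, v) \<in> path_arcs p \<Longrightarrow> length p \<noteq> 2 \<Longrightarrow> u \<in> inner p \<or> v \<in> inner p"
proof (induction p rule: path_arcs.induct)
  case (1 a c p)
  show ?case
  proof (cases "p = []")
    case True then show ?thesis using 1 by simp
  next
    case False
    note ne = False
    show ?thesis
    proof (cases "length (c # p) = 2")
      case True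
      then obtain d where "p = [d]" by (cases p) auto
      then show ?thesis using 1 by (auto simp: inner_def)
    next
      case False
      have "inner (c # p) \<subseteq> inner (a # c # p)" using ne by (auto simp: inner_def)
      then show ?thesis using 1 ne False by (auto simp: inner_def)
    qed
  qed
qed auto

lemma arcs_length_2: "length p = 2 \<Longrightarrow> path_arcs p = {(hd p, last p)} \<and> set p = {hd p, last p}"
  by (cases p; cases "tl p") auto

lemma arcs_sets: "(u, v) \<in> path_arcs p \<Longrightarrow> u \<in> set p \<and> v \<in> set p"
  by (induction p rule: path_arcs.induct) auto

lemma arcs_no_common:
  assumes "inner p \<inter> set q = {}" "inner q \<inter> set p = {}"
    "length p = 2 \<and> length q = 2 \<longrightarrow> set p \<noteq> set q"
    and "(u, v) \<in> path_arcs p" "(u, v) \<in> path_arcs q \<or> (v, u) \<in> path_arcs q"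
  shows False
proof -
  have s: "u \<in> set p" "v \<in> set p" "u \<in> set q" "v \<in> set q"
    using assms(4,5) arcs_sets by fast+
  have "length p = 2" using arcs_inner[OF assms(4)] s assms(1) by blast
  moreover have "length q = 2" using arcs_inner[of u v q] arcs_inner[of v u q] assms(2,5) s by blast
  ultimately show False using assms(3-5) arcs_length_2[of p] arcs_length_2[of q] by auto
qed

lemma arcs_touch: "(\<forall>q\<in>set ps. z \<notin> set q) \<Longrightarrow> untouched (all_arcs ps) z"
  by (auto simp: untouched_def all_arcs_def dest: arcs_sets)

lemma arcs_antisym: "distinct p \<Longrightarrow> (u, v) \<in> path_arcs p \<Longrightarrow> (v, u) \<notin> path_arcs p"
  by (induction p rule: path_arcs.induct) (auto dest: arcs_sets)

lemma all_arcs_antisym: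
  "path_system ps \<Longrightarrow> (u, v) \<in> all_arcs ps \<Longrightarrow> (v, u) \<notin> all_arcs ps"
proof (induction ps)
  case (Cons p ps)
  have n: "\<not> ((a, b) \<in> path_arcs p \<and> ((a, b) \<in> all_arcs ps \<or> (b, a) \<in> all_arcs ps))" for a b
  proof
    assume "(a, b) \<in> path_arcs p \<and> ((a, b) \<in> all_arcs ps \<or> (b, a) \<in> all_arcs ps)"
    then obtain q where q: "q \<in> set ps" "(a, b) \<in> path_arcs p" "(a, b) \<in> path_arcs q \<or> (b, a) \<in> path_arcs q"
      by (auto simp: all_arcs_def)
    then show False using Cons.prems(1) arcs_no_common[of p q a b] by simp
  qed
  have c: "all_arcs (p # ps) = path_arcs p \<union> all_arcs ps" by (simp add: all_arcs_def)
  show ?case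
    using Cons.IH Cons.prems(1) Cons.prems(2)[unfolded c] n[of u v] n[of v u] arcs_antisym[of p u v]
    unfolding c by auto
qed (simp add: all_arcs_def)

lemma signed_count_path_system:
  assumes "path_system ps" "\<forall>p\<in>set ps. \<forall>z\<in>inner p. b z = 0"
  shows "signed_count (all_arcs ps) b = path_count (map path_type ps) b"
  using assms
proof (induction ps arbitrary: b)
  case Nil
  then show ?case by (simp add: all_arcs_def signed_count_empty)
next
  case (Cons p ps)
  let ?A = "all_arcs ps"
  obtain u q where p: "p = u # q" "q \<noteq> []" using Cons.prems(1) by (cases p) (auto simp: Suc_le_length_iff)
  have d: "distinct q" "u \<notin> set q" using Cons.prems(1) p by auto
  have inn: "inner p = set (butlast q)" by (simp add: p inner_def)
  have 1: "signed_count (path_arcs (u # q) \<union> ?A) b =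
      signed_count ?A b + (-1) ^ length q * signed_count ?A (shift u (last q) b)"
  proof (rule signed_count_path)
    show "finite ?A" by (simp add: all_arcs_def)
    show "u \<notin> set (butlast q)" using d by (auto dest: in_set_butlastD)
    show "\<forall>z\<in>set (butlast q). untouched ?A z \<and> b z = 0"
      using Cons.prems inn by (auto intro!: arcs_touch)
    show "path_arcs (u # q) \<inter> ?A = {}"
    proof -
      have False if e: "e \<in> path_arcs p" "e \<in> ?A" for e
      proof -
        obtain q where "q \<in> set ps" "e \<in> path_arcs q" using e by (auto simp: all_arcs_def)
        then show False using Cons.prems(1) arcs_no_common[of p q "fst e" "snd e"] e by simp
      qed
      then show ?thesis unfolding p(1)[symmetric] by blast
    qed
  qed (use p d in auto)
  have 2: "signed_count ?A (shift u (last q) b) = path_count (map path_type ps) (shift u (last q) b)"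
  proof (rule Cons.IH)
    show "\<forall>p\<in>set ps. \<forall>z\<in>inner p. shift u (last q) b z = 0"
    proof (intro ballI)
      fix p' z assume "p' \<in> set ps" "z \<in> inner p'"
      moreover from this have "z \<notin> set p" using Cons.prems(1) by auto
      ultimately show "shift u (last q) b z = 0"
        using p Cons.prems(2) by (auto simp: shift_def)
    qed
  qed (use Cons.prems in auto)
  have "all_arcs (p # ps) = path_arcs (u # q) \<union> ?A" by (simp add: all_arcs_def p)
  then show ?case using 1 2 Cons.IH[of b] Cons.prems p by (simp add: path_type_def[of "u # q"])
qed

text \<open>Numbering the branch vertices turns \<open>path_count\<close> into an executable function.\<close>

fun index_count :: "(nat \<times> nat \<times> int) list \<Rightarrow> int list \<Rightarrow> int" where
  "index_count [] b = of_bool (\<forall>z\<in>set b. z = 0)"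
| "index_count ((i, j, s) # ts) b = index_count ts b +
     s * index_count ts ((b[i := b ! i - 1])[j := (b[i := b ! i - 1]) ! j + 1])"

definition spread :: "'a list \<Rightarrow> int list \<Rightarrow> 'a \<Rightarrow> int" where
  "spread vs b v = (\<Sum>i<length vs. if vs ! i = v then b ! i else 0)"

lemma spread_nth: "distinct vs \<Longrightarrow> i < length vs \<Longrightarrow> spread vs b (vs ! i) = b ! i"
proof -
  assume a: "distinct vs" "i < length vs"
  have "spread vs b (vs ! i) = (\<Sum>j<length vs. if j = i then b ! j else 0)"
    unfolding spread_def by (rule sum.cong) (use a in \<open>auto simp: nth_eq_iff_index_eq\<close>)
  then show ?thesis using a by simp
qed

lemma spread_out: "v \<notin> set vs \<Longrightarrow> spread vs b v = 0"
  unfolding spread_def by (rule sum.neutral) (auto simp: in_set_conv_nth)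

lemma path_count_index:
  assumes "distinct vs" "length b = length vs"
    "\<forall>(i, j, s)\<in>set ts. i < length vs \<and> j < length vs"
  shows "path_count (map (\<lambda>(i, j, s). (vs ! i, vs ! j, s)) ts) (spread vs b) = index_count ts b"
  using assms(2,3)
proof (induction ts arbitrary: b)
  case Nil
  have "spread vs b = (\<lambda>_. 0) \<longleftrightarrow> (\<forall>i<length vs. b ! i = 0)"
  proof
    assume "\<forall>i<length vs. b ! i = 0"
    then show "spread vs b = (\<lambda>_. 0)" by (auto simp: spread_def fun_eq_iff intro!: sum.neutral)
  qed (metis spread_nth[OF assms(1)])
  moreover have "(\<forall>i<length vs. b ! i = 0) \<longleftrightarrow> (\<forall>z\<in>set b. z = 0)"
    using Nil by (metis in_set_conv_nth)
  ultimately show ?case by simp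
next
  case (Cons t ts)
  obtain i j s where t: "t = (i, j, s)" by (cases t)
  have ij: "i < length vs" "j < length vs" using Cons.prems t by auto
  let ?b = "(b[i := b ! i - 1])[j := (b[i := b ! i - 1]) ! j + 1]"
  have "shift (vs ! i) (vs ! j) (spread vs b) v = spread vs ?b v" for v
  proof (cases "v \<in> set vs")
    case True
    then obtain k where k: "k < length vs" "v = vs ! k" by (auto simp: in_set_conv_nth)
    then show ?thesis using ij assms(1) Cons.prems(1)
      by (auto simp: shift_def spread_nth nth_eq_iff_index_eq nth_list_update)
  next
    case False
    then have "vs ! i \<noteq> v" "vs ! j \<noteq> v" using ij by auto
    then show ?thesis using False by (simp add: shift_def spread_out)
  qed
  then have "shift (vs ! i) (vs ! j) (spread vs b) = spread vs ?b" by blast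
  then show ?case using Cons t by auto
qed

lemma path_count_zero:
  assumes "distinct vs" "\<forall>(i, j, s)\<in>set ts. i < length vs \<and> j < length vs"
  shows "path_count (map (\<lambda>(i, j, s). (vs ! i, vs ! j, s)) ts) (\<lambda>_. 0)
    = index_count ts (replicate (length vs) 0)"
proof -
  have "spread vs (replicate (length vs) 0) = (\<lambda>_. 0)"
    by (auto simp: spread_def fun_eq_iff intro!: sum.neutral)
  then show ?thesis using path_count_index[OF assms(1) _ assms(2), of "replicate (length vs) 0"] by simp
qed

text \<open>Modulo 2 all odd weights agree. The parity of the count is therefore independent of the
  lengths of the contracted paths, and one small table settles all subdivisions of a graph.\<close>

lemma index_count_parity:
  "\<forall>(i, j, s)\<in>set ts. odd s \<Longrightarrow> even (index_count ts b) = even (index_count (map (\<lambda>(i, j, s). (i, j, 1)) ts) b)"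
proof (induction ts arbitrary: b)
  case (Cons t ts)
  then show ?case by (cases t) auto
qed simp

section \<open>From orientations to paintability\<close>

definition outd :: "('a \<times> 'a) set \<Rightarrow> 'a \<Rightarrow> int" where
  "outd A v = (\<Sum>e\<in>A. of_bool (fst e = v))"

lemma bal_le_outd: "finite A \<Longrightarrow> F \<subseteq> A \<Longrightarrow> bal F v \<le> outd A v"
proof -
  assume A: "finite A" "F \<subseteq> A"
  have "bal F v \<le> outd F v" unfolding bal_def outd_def by (rule sum_mono) auto
  also have "\<dots> \<le> outd A v" unfolding outd_def by (rule sum_mono2) (use A in auto)
  finally show ?thesis .
qed

lemma outd_card: "finite A \<Longrightarrow> outd A v = int (card {e \<in> A. fst e = v})"
  unfolding outd_def by (simp add: sum.If_cases[symmetric] of_bool_def sum.inter_filter[symmetric])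

lemma sum_bal: "finite F \<Longrightarrow> finite U \<Longrightarrow> F \<subseteq> U \<times> U \<Longrightarrow> (\<Sum>v\<in>U. bal F v) = 0"
proof (induction F rule: finite_induct)
  case (insert e F)
  have "(\<Sum>v\<in>U. bal (insert e F) v) =
      (\<Sum>v\<in>U. of_bool (fst e = v) - of_bool (snd e = v)) + (\<Sum>v\<in>U. bal F v)"
    unfolding sum.distrib[symmetric] by (rule sum.cong) (use insert in \<open>auto simp: bal_insert\<close>)
  also have "\<dots> = 0" using insert by (auto simp: sum_subtractf of_bool_def)
  finally show ?case .
qed simp

lemma bal_outside: "F \<subseteq> U \<times> U \<Longrightarrow> v \<notin> U \<Longrightarrow> bal F v = 0"
  unfolding bal_def by (rule sum.neutral) auto

text \<open>Inclusion--exclusion, replacing each condition \<open>bal F v \<le> b v\<close> by its negation or by nothing.\<close>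

lemma drop_or_negate:
  fixes b :: "'a \<Rightarrow> int"
  assumes "finite X" "finite A" "(\<Sum>F | F \<subseteq> A \<and> Q F \<and> (\<forall>v\<in>X. bal F v \<le> b v). (-1) ^ card F) \<noteq> (0::int)"
  shows "\<exists>J\<subseteq>X. (\<Sum>F | F \<subseteq> A \<and> Q F \<and> (\<forall>v\<in>X - J. b v < bal F v). (-1) ^ card F) \<noteq> (0::int)"
  using assms(1,3)
proof (induction X arbitrary: Q rule: finite_induct)
  case empty
  then show ?case by auto
next
  case (insert v X)
  let ?s = "\<lambda>R. (\<Sum>F | F \<subseteq> A \<and> R F \<and> (\<forall>v\<in>X. bal F v \<le> b v). (-1) ^ card F) :: int"
  have fin: "finite {F. F \<subseteq> A \<and> R F}" for R using assms(2) by simp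
  have "?s Q = ?s (\<lambda>F. Q F \<and> bal F v \<le> b v) + ?s (\<lambda>F. Q F \<and> b v < bal F v)"
    by (subst sum.union_disjoint[symmetric]) (use fin in \<open>auto intro!: sum.cong\<close>)
  moreover have "?s (\<lambda>F. Q F \<and> bal F v \<le> b v) \<noteq> 0"
    using insert.prems by (simp add: conj_ac)
  ultimately consider "?s Q \<noteq> 0" | "?s (\<lambda>F. Q F \<and> b v < bal F v) \<noteq> 0" by linarith
  then show ?case
  proof cases
    case 1
    from insert.IH[OF this] obtain J where J: "J \<subseteq> X"
      "(\<Sum>F | F \<subseteq> A \<and> Q F \<and> (\<forall>v\<in>X - J. b v < bal F v). (-1) ^ card F) \<noteq> (0::int)" by auto
    have "insert v X - insert v J = X - J" using insert.hyps by auto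
    then show ?thesis using J by (intro exI[of _ "insert v J"]) auto
  next
    case 2
    from insert.IH[OF this] obtain J where J: "J \<subseteq> X"
      "(\<Sum>F | F \<subseteq> A \<and> (Q F \<and> b v < bal F v) \<and> (\<forall>v\<in>X - J. b v < bal F v). (-1) ^ card F) \<noteq> (0::int)"
      by auto
    have "insert v X - J = insert v (X - J)" using J insert.hyps by auto
    then show ?thesis using J by (intro exI[of _ J]) (auto simp: conj_ac)
  qed
qed

text \<open>Balances sum to zero over \<open>U\<close>, so among the subsets with the prescribed
  balance off \<open>S\<close> the bounds \<open>bal F v \<le> b v\<close> on \<open>S\<close>
  already force \<open>bal F = b\<close>. Writing the count with these bounds opens it to
  inclusion-exclusion: \<open>J\<close> collects the vertices whose condition was dropped, and on
  the rest of \<open>S\<close> the balance exceeds \<open>b\<close>.\<close>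

lemma free_count_exists:
  assumes A: "finite A" "A \<subseteq> U \<times> U" and U: "finite U" "S \<subseteq> U" and nz: "signed_count A b \<noteq> 0"
  shows "\<exists>J\<subseteq>S. \<exists>c. free_count A J c \<noteq> 0 \<and> (\<forall>v. v \<notin> S \<longrightarrow> c v = b v) \<and> (\<forall>v\<in>S - J. b v < c v)"
proof -
  define Q where "Q F \<longleftrightarrow> (\<forall>v. v \<notin> S \<longrightarrow> bal F v = b v)" for F :: "('a \<times> 'a) set"
  have "{F. F \<subseteq> A \<and> bal F = b} \<noteq> {}" using nz unfolding signed_count_def by (metis sum.empty)
  then obtain F0 where F0: "F0 \<subseteq> A" "bal F0 = b" by auto
  have sumb: "(\<Sum>v\<in>U. b v) = 0" using sum_bal[of F0 U] F0 A U by (auto intro: finite_subset)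
  have eq: "bal F = b" if F: "F \<subseteq> A" "Q F" "\<forall>v\<in>S. bal F v \<le> b v" for F
  proof -
    have le: "bal F v \<le> b v" for v using F by (cases "v \<in> S") (auto simp: Q_def)
    have "(\<Sum>v\<in>U. b v - bal F v) = 0"
      using sum_bal[of F U] F A U sumb by (auto simp: sum_subtractf intro: finite_subset)
    then have "\<forall>v\<in>U. b v - bal F v = 0"
      using sum_nonneg_eq_0_iff[of U "\<lambda>v. b v - bal F v"] le U by auto
    moreover have "bal F v = b v" if "v \<notin> U" for v using that F U by (auto simp: Q_def)
    ultimately show ?thesis by (metis eq_iff_diff_eq_0 ext)
  qed
  have "{F. F \<subseteq> A \<and> Q F \<and> (\<forall>v\<in>S. bal F v \<le> b v)} = {F. F \<subseteq> A \<and> bal F = b}"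
    using eq by (auto simp: Q_def)
  then have "(\<Sum>F | F \<subseteq> A \<and> Q F \<and> (\<forall>v\<in>S. bal F v \<le> b v). (-1) ^ card F) \<noteq> (0::int)"
    using nz by (simp add: signed_count_def)
  from drop_or_negate[OF finite_subset[OF U(2,1)] A(1) this] obtain J where J: "J \<subseteq> S"
    "(\<Sum>F | F \<subseteq> A \<and> Q F \<and> (\<forall>v\<in>S - J. b v < bal F v). (-1) ^ card F) \<noteq> (0::int)" by blast
  \<comment> \<open>The nonzero sum still mixes several balances on \<open>S - J\<close>. Splitting
    it by the exact balance off \<open>J\<close> leaves a class with nonzero sum, and
    \<open>c\<close> is the balance of a member of that class.\<close>
  define X where "X = {F. F \<subseteq> A \<and> Q F \<and> (\<forall>v\<in>S - J. b v < bal F v)}"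
  define g where "g F = (\<lambda>v. if v \<in> J then 0 else bal F v)" for F :: "('a \<times> 'a) set"
  have finX: "finite X" using A by (simp add: X_def)
  have "(\<Sum>F\<in>X. (-1) ^ card F) = (\<Sum>c\<in>g ` X. \<Sum>F | F \<in> X \<and> g F = c. (-1::int) ^ card F)"
    by (rule sum.image_gen[OF finX])
  then have "\<exists>c\<in>g ` X. (\<Sum>F | F \<in> X \<and> g F = c. (-1::int) ^ card F) \<noteq> 0"
    using J(2) unfolding X_def[symmetric] by (metis (no_types, lifting) sum.neutral)
  then obtain F1 where F1: "F1 \<in> X" "(\<Sum>F | F \<in> X \<and> g F = g F1. (-1::int) ^ card F) \<noteq> 0"
    by blast
  have "F \<in> X \<and> g F = g F1 \<longleftrightarrow> F \<subseteq> A \<and> (\<forall>v. v \<notin> J \<longrightarrow> bal F v = bal F1 v)" for F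
  proof
    assume F: "F \<in> X \<and> g F = g F1"
    have "bal F v = bal F1 v" if "v \<notin> J" for v
      using fun_cong[OF conjunct2[OF F], of v] that by (simp add: g_def)
    then show "F \<subseteq> A \<and> (\<forall>v. v \<notin> J \<longrightarrow> bal F v = bal F1 v)" using F by (simp add: X_def)
  next
    assume F: "F \<subseteq> A \<and> (\<forall>v. v \<notin> J \<longrightarrow> bal F v = bal F1 v)"
    moreover from this have "g F = g F1" by (auto simp: g_def)
    moreover have "bal F v = b v" if "v \<notin> S" for v
      using F F1(1) that J(1) by (auto simp: X_def Q_def)
    moreover have "b v < bal F v" if "v \<in> S - J" for v
      using F F1(1) that by (auto simp: X_def)
    ultimately show "F \<in> X \<and> g F = g F1" by (simp add: X_def Q_def)
  qed
  then have "free_count A J (bal F1) \<noteq> 0" using F1(2) by (simp only: free_count_def not_False_eq_True)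
  moreover have "\<forall>v. v \<notin> S \<longrightarrow> bal F1 v = b v" "\<forall>v\<in>S - J. b v < bal F1 v"
    using F1(1) by (auto simp: X_def Q_def)
  ultimately show ?thesis using J(1) by blast
qed

text \<open>Toggling an arc inside \<open>J\<close> is a sign-reversing involution.\<close>

lemma free_count_independent:
  assumes "finite A" "free_count A J b \<noteq> 0" "(u, v) \<in> A" "u \<in> J"
  shows "v \<notin> J"
proof
  assume v: "v \<in> J"
  let ?A = "A - {(u, v)}"
  have "free_count (insert (u, v) ?A) J b = free_count ?A J b - free_count ?A J (shift u v b)"
    using free_count_insert[of ?A "(u, v)" J b] assms by simp
  moreover have "free_count ?A J (shift u v b) = free_count ?A J b"
    unfolding free_count_def by (rule sum.cong) (use v assms(4) in \<open>auto simp: shift_def\<close>)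
  ultimately show False using assms by (simp add: insert_absorb)
qed

lemma free_count_peel:
  assumes "finite B" "finite A" "A \<inter> B = {}" "free_count (B \<union> A) J b \<noteq> 0"
  shows "\<exists>c. free_count A J c \<noteq> 0 \<and> (\<forall>v. outd A v - c v \<le> outd (B \<union> A) v - b v)"
  using assms(1,3,4)
proof (induction B arbitrary: b rule: finite_induct)
  case empty
  then show ?case by auto
next
  case (insert e B)
  have e: "e \<notin> B \<union> A" "finite (B \<union> A)" using insert assms(2) by auto
  have o: "outd (insert e (B \<union> A)) v = of_bool (fst e = v) + outd (B \<union> A) v" for v
    using e by (simp add: outd_def)
  from insert.prems consider "free_count (B \<union> A) J b \<noteq> 0" |
    "free_count (B \<union> A) J (shift (fst e) (snd e) b) \<noteq> 0"
    using free_count_insert[of "B \<union> A" e J b] e by (cases "free_count (B \<union> A) J b = 0") auto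
  then show ?case
  proof cases
    case 1
    from insert.IH[OF _ this] insert.prems obtain c where
      c: "free_count A J c \<noteq> 0" "\<forall>v. outd A v - c v \<le> outd (B \<union> A) v - b v" by auto
    have "outd A v - c v \<le> outd (insert e B \<union> A) v - b v" for v
      using c(2)[rule_format, of v] o[of v] by simp
    then show ?thesis using c(1) by blast
  next
    case 2
    from insert.IH[OF _ this] insert.prems obtain c where
      c: "free_count A J c \<noteq> 0"
         "\<forall>v. outd A v - c v \<le> outd (B \<union> A) v - shift (fst e) (snd e) b v" by auto
    have "outd A v - c v \<le> outd (insert e B \<union> A) v - b v" for v
      using c(2)[rule_format, of v] o[of v] by (auto simp: shift_def of_bool_def split: if_splits)
    then show ?thesis using c(1) by blast
  qed
qed

text \<open>One round of painting: \<open>J\<close> is the answer to the offered set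
  \<open>S\<close>. It is independent because an arc inside \<open>J\<close> would cancel the free
  count. An unpainted vertex of \<open>S\<close> loses a token, and the strict inequality gained by
  inclusion-exclusion lowers \<open>outd - b\<close> there by the same amount.\<close>

lemma independent_reduction:
  assumes A: "finite A" "A \<subseteq> U \<times> U" and U: "finite U" "S \<subseteq> U" and nz: "signed_count A b \<noteq> 0"
  shows "\<exists>J\<subseteq>S. (\<forall>u\<in>J. \<forall>v\<in>J. (u, v) \<notin> A) \<and> (\<exists>c. signed_count {e \<in> A. fst e \<notin> J \<and> snd e \<notin> J} c \<noteq> 0 \<and>
     (\<forall>v\<in>U - J. outd {e \<in> A. fst e \<notin> J \<and> snd e \<notin> J} v - c v \<le> outd A v - b v - of_bool (v \<in> S)))"
proof -
  from free_count_exists[OF assms] obtain J c where J: "J \<subseteq> S" "free_count A J c \<noteq> 0"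
    "\<forall>v. v \<notin> S \<longrightarrow> c v = b v" "\<forall>v\<in>S - J. b v < c v" by blast
  define A2 where "A2 = {e \<in> A. fst e \<notin> J \<and> snd e \<notin> J}"
  have un: "(A - A2) \<union> A2 = A" by (auto simp: A2_def)
  have "finite A2" "A2 \<inter> (A - A2) = {}" using A by (auto simp: A2_def)
  then have "\<exists>c'. free_count A2 J c' \<noteq> 0 \<and> (\<forall>v. outd A2 v - c' v \<le> outd ((A - A2) \<union> A2) v - c v)"
    using free_count_peel[of "A - A2" A2 J c] A(1) J(2) un by simp
  then obtain c' where c': "free_count A2 J c' \<noteq> 0" "\<forall>v. outd A2 v - c' v \<le> outd A v - c v"
    unfolding un by blast
  \<comment> \<open>After the peeling no arc meets \<open>J\<close>, so zero is the only balance
    that can be prescribed there.\<close>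
  define d where "d = (\<lambda>v. if v \<in> J then 0 else c' v)"
  have "bal F v = 0" if "F \<subseteq> A2" "v \<in> J" for F v
    unfolding bal_def by (rule sum.neutral) (use that in \<open>auto simp: A2_def\<close>)
  then have "free_count A2 J c' = signed_count A2 d"
    unfolding free_count_def signed_count_def
    by (intro sum.cong) (auto simp: d_def fun_eq_iff)
  moreover have "outd A2 v - d v \<le> outd A v - b v - of_bool (v \<in> S)" if "v \<in> U - J" for v
    using c'(2)[rule_format, of v] J(3)[rule_format, of v] J(4)[rule_format, of v] that
    by (cases "v \<in> S") (auto simp: d_def)
  moreover have "\<forall>u\<in>J. \<forall>v\<in>J. (u, v) \<notin> A" using free_count_independent[OF A(1) J(2)] by blast
  ultimately show ?thesis using J(1) c'(1) 
    by (intro exI[of _ J] conjI exI[of _ d]) (auto simp: A2_def)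
qed

text \<open>The lists play the opponent: offer the set \<open>S\<close> of all vertices whose list
  contains a fixed colour, give that colour to the independent answer \<open>I\<close>, and delete
  it from the remaining lists.\<close>

lemma paintable_colorable:
  fixes L :: "'a \<Rightarrow> nat set"
  assumes "paintable G f" "\<forall>v\<in>pverts G. finite (L v) \<and> f v \<le> int (card (L v))"
    "parcs G \<subseteq> pverts G \<times> pverts G"
  shows "\<exists>\<phi>. proper_coloring G \<phi> \<and> (\<forall>v\<in>pverts G. \<phi> v \<in> L v)"
  using assms
proof (induction G f arbitrary: L rule: paintable.induct)
  case (empty G f)
  then show ?case by (auto simp: proper_coloring_def)
next
  case (step G f)
  show ?case
  proof (cases "pverts G = {}")
    case True
    then show ?thesis using step.prems by (auto simp: proper_coloring_def)
  next
    case False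
    then obtain v where v: "v \<in> pverts G" by auto
    then have "L v \<noteq> {}" using step.hyps(1)[of v] step.prems(1) by fastforce
    then obtain c where c: "c \<in> L v" by auto
    define S where "S = {v \<in> pverts G. c \<in> L v}"
    have S: "S \<subseteq> pverts G" "S \<noteq> {}" using v c by (auto simp: S_def)
    from step.IH[OF S] obtain I where I: "I \<subseteq> S" "independent_set G I"
      and IH: "\<And>L :: 'a \<Rightarrow> nat set. \<forall>u\<in>pverts (delete_verts G I). finite (L u) \<and>
            (if u \<in> S then f u - 1 else f u) \<le> int (card (L u)) \<Longrightarrow>
          parcs (delete_verts G I) \<subseteq> pverts (delete_verts G I) \<times> pverts (delete_verts G I) \<Longrightarrow>
          \<exists>\<phi>. proper_coloring (delete_verts G I) \<phi> \<and> (\<forall>u\<in>pverts (delete_verts G I). \<phi> u \<in> L u)"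
      by blast
    have "\<exists>\<phi>. proper_coloring (delete_verts G I) \<phi> \<and>
        (\<forall>u\<in>pverts (delete_verts G I). \<phi> u \<in> L u - {c})"
    proof (rule IH)
      show "\<forall>u\<in>pverts (delete_verts G I). finite (L u - {c}) \<and>
          (if u \<in> S then f u - 1 else f u) \<le> int (card (L u - {c}))"
      proof
        fix u assume "u \<in> pverts (delete_verts G I)"
        then have u: "u \<in> pverts G" by (auto simp: delete_verts_def)
        show "finite (L u - {c}) \<and> (if u \<in> S then f u - 1 else f u) \<le> int (card (L u - {c}))"
          using step.prems(1) u by (auto simp: S_def card_Diff_singleton_if)
      qed
    qed (use step.prems(2) in \<open>auto simp: delete_verts_def\<close>)
    then obtain \<phi> where \<phi>: "proper_coloring (delete_verts G I) \<phi>"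
      "\<forall>u\<in>pverts G - I. \<phi> u \<in> L u - {c}" by (auto simp: delete_verts_def)
    define \<psi> where "\<psi> u = (if u \<in> I then c else \<phi> u)" for u
    have "proper_coloring G \<psi>"
      unfolding proper_coloring_def
    proof (intro allI impI)
      fix a b assume ab: "(a, b) \<in> parcs G"
      then have ab': "a \<in> pverts G" "b \<in> pverts G" using step.prems(2) by auto
      show "\<psi> a \<noteq> \<psi> b"
        using I(2) \<phi> ab ab' unfolding \<psi>_def independent_set_def proper_coloring_def delete_verts_def
        by (cases "a \<in> I"; cases "b \<in> I") auto
    qed
    moreover have "\<forall>u\<in>pverts G. \<psi> u \<in> L u" using I(1) \<phi>(2) by (auto simp: \<psi>_def S_def)
    ultimately show ?thesis by blast
  qed
qed

text \<open>The target \<open>b\<close> is arbitrary because a round changes the balance; for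
  \<open>b = 0\<close> the bound on \<open>outd - b\<close> is the usual outdegree condition. A
  round with nonempty \<open>S\<close> uses up at least one token, hence the induction on the sum of
  \<open>f\<close>.\<close>

lemma orientation_paintable:
  assumes "finite (pverts G)" "parcs G \<subseteq> pverts G \<times> pverts G"
    and "A \<union> A\<inverse> = parcs G" "signed_count A b \<noteq> 0" "\<forall>v\<in>pverts G. outd A v - b v < f v"
  shows "paintable G f"
  using assms
proof (induction "nat (\<Sum>v\<in>pverts G. f v)" arbitrary: G f A b rule: less_induct)
  case less
  have A: "finite A" "A \<subseteq> pverts G \<times> pverts G"
    using less.prems(1-3) by (auto intro: finite_subset[of A "pverts G \<times> pverts G"])
  have "{F. F \<subseteq> A \<and> bal F = b} \<noteq> {}"
    using less.prems(4) unfolding signed_count_def by (metis sum.empty)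
  then obtain F0 where F0: "F0 \<subseteq> A" "bal F0 = b" by auto
  \<comment> \<open>Some subset realises \<open>b\<close>, and its balance at \<open>v\<close> is at
    most the outdegree. So \<open>outd - b\<close> is nonnegative and \<open>f\<close> is
    positive.\<close>
  have f1: "1 \<le> f v" if "v \<in> pverts G" for v
    using bal_le_outd[OF A(1) F0(1), of v] F0(2) less.prems(5) that by force
  show ?case
  proof (rule paintable.step)
    fix S assume S: "S \<subseteq> pverts G" "S \<noteq> {}"
    from independent_reduction[OF A less.prems(1) S(1) less.prems(4)] obtain J c where J: "J \<subseteq> S"
      "\<forall>u\<in>J. \<forall>v\<in>J. (u, v) \<notin> A" "signed_count {e \<in> A. fst e \<notin> J \<and> snd e \<notin> J} c \<noteq> 0"
      "\<forall>v\<in>pverts G - J. outd {e \<in> A. fst e \<notin> J \<and> snd e \<notin> J} v - c v \<le> outd A v - b v - of_bool (v \<in> S)"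
      by blast
    let ?A = "{e \<in> A. fst e \<notin> J \<and> snd e \<notin> J}" and ?G = "delete_verts G J"
    let ?f = "\<lambda>v. if v \<in> S then f v - 1 else f v"
    have ind: "independent_set G J"
      unfolding independent_set_def less.prems(3)[symmetric] using J(1,2) S by auto
    have "paintable ?G ?f"
    proof (rule less.hyps)
      have fin: "finite J" "finite (pverts G - J)"
        using finite_subset[OF subset_trans[OF J(1) S(1)]] less.prems(1) by auto
      have "(\<Sum>v\<in>pverts G. f v) = (\<Sum>v\<in>pverts G - J. f v) + (\<Sum>v\<in>J. f v)"
        by (rule sum.subset_diff) (use J S less.prems(1) in auto)
      moreover have "int (card J) \<le> (\<Sum>v\<in>J. f v)"
        using sum_mono[of J "\<lambda>_. 1" f] f1 J(1) S by auto
      moreover have "(\<Sum>v\<in>pverts G - J. ?f v) = (\<Sum>v\<in>pverts G - J. f v) - int (card (S - J))"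
      proof -
        have "(\<Sum>v\<in>pverts G - J. ?f v) = (\<Sum>v\<in>pverts G - J. f v - of_bool (v \<in> S))"
          by (rule sum.cong) auto
        also have "\<dots> = (\<Sum>v\<in>pverts G - J. f v) - (\<Sum>v\<in>pverts G - J. of_bool (v \<in> S))"
          by (simp add: sum_subtractf)
        also have "(\<Sum>v\<in>pverts G - J. of_bool (v \<in> S)) = int (card ((pverts G - J) \<inter> S))"
          using fin by (simp add: Int_def)
        also have "(pverts G - J) \<inter> S = S - J" using S by auto
        finally show ?thesis .
      qed
      moreover have "int (card J) + int (card (S - J)) > 0"
      proof -
        have "finite S" using S less.prems(1) by (auto intro: finite_subset)
        then have "card S > 0" "card J + card (S - J) = card S"
          using S(2) J(1) fin by (auto simp: card_gt_0_iff card_Diff_subset card_mono)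
        then show ?thesis by simp
      qed
      moreover have "(\<Sum>v\<in>pverts G. f v) \<ge> int (card (pverts G))"
        using sum_mono[of "pverts G" "\<lambda>_. 1" f] f1 by auto
      moreover have "card (pverts G) > 0" using S less.prems(1) by (auto simp: card_gt_0_iff)
      ultimately have "(\<Sum>v\<in>pverts G - J. ?f v) < (\<Sum>v\<in>pverts G. f v)" "0 < (\<Sum>v\<in>pverts G. f v)"
        by linarith+
      then show "nat (\<Sum>v\<in>pverts ?G. ?f v) < nat (\<Sum>v\<in>pverts G. f v)"
        by (simp add: delete_verts_def)
      show "finite (pverts ?G)" "parcs ?G \<subseteq> pverts ?G \<times> pverts ?G"
        using less.prems(1,2) by (auto simp: delete_verts_def)
      show "?A \<union> ?A\<inverse> = parcs ?G" unfolding delete_verts_def using less.prems(3) by auto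
      show "signed_count ?A c \<noteq> 0" by (rule J)
      show "\<forall>v\<in>pverts ?G. outd ?A v - c v < ?f v"
      proof
        fix v assume "v \<in> pverts ?G"
        then have v: "v \<in> pverts G - J" by (simp add: delete_verts_def)
        show "outd ?A v - c v < ?f v"
          using J(4)[rule_format, OF v] less.prems(5) v by (cases "v \<in> S") fastforce+
      qed
    qed
    then show "\<exists>I\<subseteq>S. independent_set G I \<and> paintable (delete_verts G I) ?f"
      using J(1) ind by blast
  qed (use f1 in auto)
qed

section \<open>Induced subgraphs of a fixed graph\<close>

text \<open>No arc leaves \<open>u\<close>, so a subset using an arc into \<open>u\<close> would
  have negative balance there.\<close>

lemma signed_count_sink:
  assumes "finite A" "finite B" "untouched A u" "\<forall>e\<in>B. snd e = u \<and> fst e \<noteq> u" "b u = 0"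
  shows "signed_count (A \<union> B) b = signed_count A b"
proof -
  have "F \<subseteq> A" if F: "F \<subseteq> A \<union> B" "bal F = b" for F
  proof -
    have fin: "finite F" using F assms by (auto intro: finite_subset)
    have "of_bool (fst e = u) - of_bool (snd e = u) = - (of_bool (snd e = u) :: int)" if "e \<in> F" for e
      using that F assms(3,4) by (auto simp: untouched_def)
    then have "bal F u = - (\<Sum>e\<in>F. of_bool (snd e = u))"
      unfolding bal_def by (simp add: sum_negf)
    then have "(\<Sum>e\<in>F. of_bool (snd e = u) :: int) = 0" using F assms(5) by simp
    then have "\<forall>e\<in>F. snd e \<noteq> u" using fin by (subst (asm) sum_nonneg_eq_0_iff) auto
    then show ?thesis using F assms(4) by auto
  qed
  then have "{F. F \<subseteq> A \<union> B \<and> bal F = b} = {F. F \<subseteq> A \<and> bal F = b}" by auto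
  then show ?thesis by (simp only: signed_count_def)
qed

text \<open>A subset of balance zero splits along the two sides. Each part is balanced away from
  \<open>x\<close>, and since its balances sum to zero it is balanced at \<open>x\<close> too. The
  choices on the two sides are thus independent, and the signs multiply.\<close>

lemma signed_count_cut:
  assumes A: "A1 \<subseteq> U1 \<times> U1" "A2 \<subseteq> U2 \<times> U2" and U: "finite U1" "finite U2" "U1 \<inter> U2 = {x}"
    and nl: "(x, x) \<notin> A1"
  shows "signed_count (A1 \<union> A2) (\<lambda>_. 0) = signed_count A1 (\<lambda>_. 0) * signed_count A2 (\<lambda>_. 0)"
proof -
  have fin: "finite A1" "finite A2" using A U by (auto intro: finite_subset)
  have dis: "A1 \<inter> A2 = {}"
  proof (rule ccontr)
    assume "A1 \<inter> A2 \<noteq> {}"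
    then obtain a b where ab: "(a, b) \<in> A1" "(a, b) \<in> A2" by auto
    then have "a \<in> U1 \<inter> U2" "b \<in> U1 \<inter> U2" using A by auto
    then show False using ab nl unfolding U(3) by auto
  qed
  let ?S = "\<lambda>A. {F. F \<subseteq> A \<and> bal F = (\<lambda>_. 0)}"
  have half: "bal F1 = (\<lambda>_. 0)"
    if F: "F1 \<subseteq> X1 \<times> X1" "F2 \<subseteq> X2 \<times> X2" "finite X1" "finite X2" "X1 \<inter> X2 = {x}"
      "\<And>v. bal F1 v + bal F2 v = 0" for F1 F2 X1 X2
  proof -
    have 0: "bal F1 v = 0" if "v \<noteq> x" for v
      using F bal_outside[of F1 X1 v] bal_outside[of F2 X2 v] that
      by (metis Int_iff add.right_neutral singletonD)
    have "finite F1" using F by (meson finite_SigmaI finite_subset)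
    then have "(\<Sum>v\<in>X1. bal F1 v) = 0" using sum_bal[of F1 X1] F by simp
    moreover have "(\<Sum>v\<in>X1. bal F1 v) = bal F1 x"
      using F(3,5) 0 by (subst sum.remove[of X1 x]) (auto intro!: sum.neutral)
    ultimately show ?thesis using 0 by (metis ext)
  qed
  have img: "?S (A1 \<union> A2) = (\<lambda>(F1, F2). F1 \<union> F2) ` (?S A1 \<times> ?S A2)"
  proof (intro equalityI subsetI)
    fix F assume F: "F \<in> ?S (A1 \<union> A2)"
    let ?F1 = "F \<inter> A1" and ?F2 = "F \<inter> A2"
    have un: "F = ?F1 \<union> ?F2" using F by auto
    have b: "bal ?F1 v + bal ?F2 v = 0" for v
      using bal_union[of ?F1 ?F2 v] fin dis F un by auto
    have "bal ?F1 = (\<lambda>_. 0)" by (rule half[of _ U1 ?F2 U2]) (use A U b in auto)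
    moreover have "bal ?F2 = (\<lambda>_. 0)"
      by (rule half[of _ U2 ?F1 U1]) (use A U b in \<open>auto simp: add.commute\<close>)
    ultimately have "(?F1, ?F2) \<in> ?S A1 \<times> ?S A2" by auto
    then show "F \<in> (\<lambda>(F1, F2). F1 \<union> F2) ` (?S A1 \<times> ?S A2)" by (rule rev_image_eqI) (use F in auto)
  next
    fix F assume "F \<in> (\<lambda>(F1, F2). F1 \<union> F2) ` (?S A1 \<times> ?S A2)"
    then obtain F1 F2 where F: "F = F1 \<union> F2" "F1 \<in> ?S A1" "F2 \<in> ?S A2" by auto
    have "bal F v = 0" for v
      using F fin dis bal_union[of F1 F2 v] finite_subset[of F1 A1] finite_subset[of F2 A2] by fastforce
    then show "F \<in> ?S (A1 \<union> A2)" using F by auto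
  qed
  have inj: "inj_on (\<lambda>(F1, F2). F1 \<union> F2) (?S A1 \<times> ?S A2)"
    by (rule inj_on_inverseI[where g = "\<lambda>F. (F \<inter> A1, F \<inter> A2)"]) (use dis in auto)
  have "signed_count (A1 \<union> A2) (\<lambda>_. 0) =
      (\<Sum>(F1, F2)\<in>?S A1 \<times> ?S A2. (-1) ^ card F1 * (-1) ^ card F2)"
    unfolding signed_count_def img sum.reindex[OF inj]
  proof (rule sum.cong)
    fix P assume "P \<in> ?S A1 \<times> ?S A2"
    then obtain F1 F2 where P: "P = (F1, F2)" "F1 \<subseteq> A1" "F2 \<subseteq> A2" by auto
    have "card (F1 \<union> F2) = card F1 + card F2"
      by (rule card_Un_disjoint) (use P fin dis in \<open>auto intro: finite_subset\<close>)
    then show "((\<lambda>F. (-1) ^ card F) \<circ> (\<lambda>(F1, F2). F1 \<union> F2)) P =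
        (case P of (F1, F2) \<Rightarrow> (-1) ^ card F1 * (-1::int) ^ card F2)"
      by (simp add: P(1) power_add)
  qed simp
  also have "\<dots> = signed_count A1 (\<lambda>_. 0) * signed_count A2 (\<lambda>_. 0)"
    unfolding signed_count_def sum_product sum.cartesian_product ..
  finally show ?thesis .
qed

definition ind :: "('a \<times> 'a) set \<Rightarrow> 'a \<Rightarrow> nat" where
  "ind A v = card {u. (u, v) \<in> A}"

lemma ind_mono: "finite B \<Longrightarrow> A \<subseteq> B \<Longrightarrow> ind A v \<le> ind B v"
proof -
  assume B: "finite B" "A \<subseteq> B"
  have "{u. (u, v) \<in> B} \<subseteq> fst ` B" by force
  then have "finite {u. (u, v) \<in> B}" using B(1) by (meson finite_imageI finite_subset)
  then show ?thesis unfolding ind_def by (rule card_mono) (use B in auto)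
qed

section \<open>Induced subgraphs: AT orientations and bad list assignments\<close>

locale sgraph =
  fixes E :: "'a \<Rightarrow> 'a \<Rightarrow> bool"
  assumes E_sym: "E u v \<Longrightarrow> E v u" and E_irrefl: "\<not> E v v"
begin

lemma E_comm: "E u v \<longleftrightarrow> E v u"
  using E_sym by blast

lemma E_neq: "E u v \<Longrightarrow> u \<noteq> v"
  using E_irrefl by blast

definition dg :: "'a set \<Rightarrow> 'a \<Rightarrow> nat" where
  "dg U v = card {u \<in> U. E v u}"

text \<open>Connectivity by cuts instead of walks: the extension arguments need precisely an edge
  leaving a given proper subset.\<close>

definition conn :: "'a set \<Rightarrow> bool" where
  "conn U \<longleftrightarrow> U \<noteq> {} \<and> (\<forall>A\<subseteq>U. A \<noteq> {} \<longrightarrow> A \<noteq> U \<longrightarrow> (\<exists>a\<in>A. \<exists>b\<in>U - A. E a b))"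

definition orients :: "'a set \<Rightarrow> ('a \<times> 'a) set \<Rightarrow> bool" where
  "orients U A \<longleftrightarrow> A \<subseteq> {(u, v). u \<in> U \<and> v \<in> U \<and> E u v} \<and>
     (\<forall>u\<in>U. \<forall>v\<in>U. E u v \<longrightarrow> ((u, v) \<in> A) \<noteq> ((v, u) \<in> A))"

text \<open>Indegree and outdegree add up to the degree, so \<open>g = 1\<close> is the outdegree
  bound for \<open>h = 0\<close>, and the value 2 at \<open>x\<close> is the bound for
  \<open>h_x\<close>.\<close>

definition ATg :: "'a set \<Rightarrow> ('a \<Rightarrow> nat) \<Rightarrow> bool" where
  "ATg U g \<longleftrightarrow> finite U \<and> (\<exists>A. orients U A \<and> signed_count A (\<lambda>_. 0) \<noteq> 0 \<and> (\<forall>v\<in>U. g v \<le> ind A v))"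

abbreviation "dAT U \<equiv> ATg U (\<lambda>_. 1)"
abbreviation "xAT U x \<equiv> ATg U (\<lambda>v. if v = x then 2 else 1)"

definition bad :: "'a set \<Rightarrow> ('a \<Rightarrow> nat) \<Rightarrow> bool" where
  "bad U k \<longleftrightarrow> (\<exists>L :: 'a \<Rightarrow> nat set. (\<forall>v\<in>U. finite (L v) \<and> card (L v) = k v) \<and>
     \<not> (\<exists>\<phi>. (\<forall>v\<in>U. \<phi> v \<in> L v) \<and> (\<forall>u\<in>U. \<forall>v\<in>U. E u v \<longrightarrow> \<phi> u \<noteq> \<phi> v)))"

lemma bad_mono:
  assumes "bad U k" "\<forall>v\<in>U. k' v \<le> k v"
  shows "bad U k'"
proof -
  obtain L :: "'a \<Rightarrow> nat set" where L: "\<forall>v\<in>U. finite (L v) \<and> card (L v) = k v"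
    "\<not> (\<exists>\<phi>. (\<forall>v\<in>U. \<phi> v \<in> L v) \<and> (\<forall>u\<in>U. \<forall>v\<in>U. E u v \<longrightarrow> \<phi> u \<noteq> \<phi> v))"
    using assms(1) unfolding bad_def by blast
  have "\<exists>M. M \<subseteq> L v \<and> card M = k' v" if "v \<in> U" for v
    using obtain_subset_with_card_n[of "k' v" "L v"] L(1) assms(2) that by metis
  then obtain M where M: "\<forall>v\<in>U. M v \<subseteq> L v \<and> card (M v) = k' v" by metis
  show ?thesis unfolding bad_def
  proof (intro exI[of _ M] conjI)
    show "\<forall>v\<in>U. finite (M v) \<and> card (M v) = k' v" using M L(1) by (meson finite_subset)
    show "\<not> (\<exists>\<phi>. (\<forall>v\<in>U. \<phi> v \<in> M v) \<and> (\<forall>u\<in>U. \<forall>v\<in>U. E u v \<longrightarrow> \<phi> u \<noteq> \<phi> v))"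
      using L(2) M by blast
  qed
qed

text \<open>Even and odd numbers make the two palettes disjoint. The colour of \<open>v\<close> then
  belongs to one of the sides, and that side is left with its own bad assignment.\<close>

lemma bad_merge:
  assumes "bad U1 k1" "bad U2 k2" "U1 \<inter> U2 = {v}"
  shows "bad (U1 \<union> U2) (\<lambda>u. if u = v then k1 v + k2 v else if u \<in> U1 then k1 u else k2 u)"
proof -
  obtain L1 :: "'a \<Rightarrow> nat set" where L1: "\<forall>v\<in>U1. finite (L1 v) \<and> card (L1 v) = k1 v"
    "\<not> (\<exists>\<phi>. (\<forall>v\<in>U1. \<phi> v \<in> L1 v) \<and> (\<forall>u\<in>U1. \<forall>v\<in>U1. E u v \<longrightarrow> \<phi> u \<noteq> \<phi> v))"
    using assms(1) unfolding bad_def by blast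
  obtain L2 :: "'a \<Rightarrow> nat set" where L2: "\<forall>v\<in>U2. finite (L2 v) \<and> card (L2 v) = k2 v"
    "\<not> (\<exists>\<phi>. (\<forall>v\<in>U2. \<phi> v \<in> L2 v) \<and> (\<forall>u\<in>U2. \<forall>v\<in>U2. E u v \<longrightarrow> \<phi> u \<noteq> \<phi> v))"
    using assms(2) unfolding bad_def by blast
  define e :: "nat \<Rightarrow> nat" where "e n = 2 * n" for n
  define o' :: "nat \<Rightarrow> nat" where "o' n = 2 * n + 1" for n
  have inj: "inj e" "inj o'" by (auto simp: inj_def e_def o'_def)
  have dis: "e ` X \<inter> o' ` Y = {}" for X Y by (auto simp: e_def o'_def) presburger
  define L where "L u = (if u = v then e ` L1 v \<union> o' ` L2 v else if u \<in> U1 then e ` L1 u else o' ` L2 u)" for u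
  have v: "v \<in> U1" "v \<in> U2" using assms(3) by auto
  have "card (e ` X) = card X" "card (o' ` X) = card X" for X
    using inj by (meson card_image inj_on_subset subset_UNIV)+
  then have 1: "\<forall>u\<in>U1 \<union> U2. finite (L u) \<and>
      card (L u) = (if u = v then k1 v + k2 v else if u \<in> U1 then k1 u else k2 u)"
    using L1(1) L2(1) v dis by (auto simp: L_def card_Un_disjoint)
  have False if \<phi>: "\<forall>u\<in>U1 \<union> U2. \<phi> u \<in> L u" "\<forall>u\<in>U1 \<union> U2. \<forall>w\<in>U1 \<union> U2. E u w \<longrightarrow> \<phi> u \<noteq> \<phi> w" for \<phi>
  proof (cases "\<phi> v \<in> e ` L1 v")
    case True
    have im: "\<phi> u \<in> e ` L1 u" if "u \<in> U1" for u
      using \<phi>(1)[rule_format, of u] True that by (auto simp: L_def split: if_splits)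
    let ?\<psi> = "\<lambda>u. inv e (\<phi> u)"
    have "\<phi> u = e (?\<psi> u)" if "u \<in> U1" for u using im[OF that] by (metis f_inv_into_f rangeI image_iff)
    then have "\<forall>u\<in>U1. \<forall>w\<in>U1. E u w \<longrightarrow> ?\<psi> u \<noteq> ?\<psi> w" using \<phi>(2) by (metis UnCI)
    moreover have "\<forall>u\<in>U1. ?\<psi> u \<in> L1 u" using im inj(1) by (metis (no_types, lifting) image_iff inv_f_f)
    ultimately show False using L1(2) by (meson exI[of _ ?\<psi>])
  next
    case False
    have im: "\<phi> u \<in> o' ` L2 u" if "u \<in> U2" for u
      using \<phi>(1)[rule_format, of u] False that assms(3) by (auto simp: L_def split: if_splits)
    let ?\<psi> = "\<lambda>u. inv o' (\<phi> u)"
    have "\<phi> u = o' (?\<psi> u)" if "u \<in> U2" for u using im[OF that] by (metis f_inv_into_f rangeI image_iff)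
    then have "\<forall>u\<in>U2. \<forall>w\<in>U2. E u w \<longrightarrow> ?\<psi> u \<noteq> ?\<psi> w" using \<phi>(2) by (metis UnCI)
    moreover have "\<forall>u\<in>U2. ?\<psi> u \<in> L2 u" using im inj(2) by (metis (no_types, lifting) image_iff inv_f_f)
    ultimately show False using L2(2) by (meson exI[of _ ?\<psi>])
  qed
  then show ?thesis unfolding bad_def using 1 by blast
qed

lemma orients_finite: "finite U \<Longrightarrow> orients U A \<Longrightarrow> finite A"
  by (rule finite_subset[of _ "U \<times> U"]) (auto simp: orients_def)

lemma ATg_finite: "ATg U g \<Longrightarrow> finite U"
  by (simp add: ATg_def)

lemma ATg_mono: "ATg U g \<Longrightarrow> \<forall>v\<in>U. g' v \<le> g v \<Longrightarrow> ATg U g'"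
  unfolding ATg_def by (meson order_trans)

text \<open>All edges at \<open>u\<close> are directed into it. No Eulerian subgraph uses an arc
  into a sink, so the count stays the same while \<open>u\<close> obtains its whole degree as
  indegree.\<close>

lemma ATg_insert_sink:
  assumes "ATg W g" "u \<notin> W"
  shows "ATg (insert u W) (\<lambda>v. if v = u then dg W u else g v)"
proof -
  obtain A where A: "orients W A" "signed_count A (\<lambda>_. 0) \<noteq> 0" "\<forall>v\<in>W. g v \<le> ind A v" and fW: "finite W"
    using assms(1) unfolding ATg_def by blast
  let ?B = "{(w, u) | w. w \<in> W \<and> E w u}"
  have fin: "finite A" "finite ?B" using orients_finite[OF fW A(1)] fW by auto
  have Asub: "A \<subseteq> W \<times> W" using A(1) by (auto simp: orients_def)
  have "orients (insert u W) (A \<union> ?B)"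
  proof -
    have 1: "((a, b) \<in> A \<union> ?B) \<noteq> ((b, a) \<in> A \<union> ?B)"
      if ab: "a \<in> insert u W" "b \<in> insert u W" "E a b" for a b
    proof (cases "a = u \<or> b = u")
      case True
      then have "(a, b) \<notin> A" "(b, a) \<notin> A" using Asub assms(2) by auto
      then show ?thesis using True ab assms(2) E_irrefl[of u] E_comm[of a b] by auto
    next
      case False
      then show ?thesis using A(1) ab unfolding orients_def by auto
    qed
    show ?thesis unfolding orients_def using 1 A(1) by (auto simp: orients_def)
  qed
  moreover have "signed_count (A \<union> ?B) (\<lambda>_. 0) \<noteq> 0"
    using signed_count_sink[of A ?B u "\<lambda>_. 0"] fin A(2) Asub assms(2) E_irrefl
    unfolding untouched_def by fastforce
  moreover have "dg W u \<le> ind (A \<union> ?B) u"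
    unfolding dg_def ind_def
    by (rule card_mono) (use fW Asub E_sym in \<open>auto intro: finite_subset[of _ W]\<close>)
  moreover have "g v \<le> ind (A \<union> ?B) v" if "v \<in> W" for v
    using A(3) that ind_mono[of "A \<union> ?B" A v] fin by (meson Un_upper1 finite_UnI order_trans)
  ultimately show ?thesis unfolding ATg_def using fW by (intro conjI exI[of _ "A \<union> ?B"]) auto
qed

lemma dg_pos: "finite W \<Longrightarrow> w \<in> W \<Longrightarrow> E u w \<Longrightarrow> 1 \<le> dg W u"
  unfolding dg_def by (metis (mono_tags, lifting) One_nat_def Suc_leI card_gt_0_iff empty_iff finite_subset mem_Collect_eq subsetI)

text \<open>Vertices are added as sinks, each adjacent to the part already built and so receiving at
  least one arc. Consequently a good orientation of any nonempty induced subgraph is enough.\<close>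

lemma ATg_extend:
  assumes "finite U" "conn U" "W \<subseteq> U" "W \<noteq> {}" "ATg W g"
  shows "ATg U (\<lambda>v. if v \<in> W then g v else 1)"
  using assms(3-5)
proof (induction "card (U - W)" arbitrary: W g)
  case 0
  then have "U = W" using assms(1) by auto
  then show ?case using 0 by (auto elim!: ATg_mono)
next
  case (Suc n)
  then have "W \<noteq> U" by auto
  then obtain w u where w: "w \<in> W" "u \<in> U - W" "E w u" using assms(2) Suc.prems unfolding conn_def by blast
  have fW: "finite W" using Suc.prems ATg_finite by blast
  have "ATg (insert u W) (\<lambda>v. if v = u then dg W u else g v)"
    using ATg_insert_sink Suc.prems w by blast
  then have AT': "ATg (insert u W) (\<lambda>v. if v = u then 1 else g v)"
    by (rule ATg_mono) (use dg_pos[OF fW w(1)] w(3) E_sym in auto)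
  have "U - insert u W = (U - W) - {u}" by auto
  then have "n = card (U - insert u W)" using Suc.hyps(2) w by simp
  from Suc.hyps(1)[OF this _ _ AT'] have "ATg U (\<lambda>v. if v \<in> insert u W then if v = u then 1 else g v else 1)"
    using w Suc.prems by auto
  then show ?case by (rule ATg_mono) (use w in auto)
qed

lemma dAT_extend: "finite U \<Longrightarrow> conn U \<Longrightarrow> W \<subseteq> U \<Longrightarrow> W \<noteq> {} \<Longrightarrow> dAT W \<Longrightarrow> dAT U"
  using ATg_extend[of U W "\<lambda>_. 1"] by simp

lemma xAT_extend: "finite U \<Longrightarrow> conn U \<Longrightarrow> W \<subseteq> U \<Longrightarrow> x \<in> W \<Longrightarrow> xAT W x \<Longrightarrow> xAT U x"
  using ATg_mono[OF ATg_extend[of U W "\<lambda>v. if v = x then 2 else 1"], of "\<lambda>v. if v = x then 2 else 1"]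
  by fastforce

text \<open>Added last as a sink, \<open>x\<close> receives all its edges. This makes degree-AT
  subgraphs that avoid \<open>x\<close> useful.\<close>

lemma xAT_sink:
  assumes "dAT (U - {x})" "2 \<le> dg U x" "x \<in> U"
  shows "xAT U x"
proof -
  have "dg (U - {x}) x = dg U x" unfolding dg_def by (rule arg_cong[where f = card]) (use E_irrefl in auto)
  then have "ATg U (\<lambda>v. if v = x then dg U x else 1)"
    using ATg_insert_sink[OF assms(1), of x] assms(3) by (simp add: insert_absorb cong: if_cong)
  then show ?thesis by (rule ATg_mono) (use assms(2) in auto)
qed

text \<open>The counts multiply at the common vertex, and \<open>x\<close> receives one arc from
  each side.\<close>

lemma xAT_two_lobes:
  assumes "dAT U1" "dAT U2" "U1 \<inter> U2 = {x}" "\<forall>u\<in>U1 - {x}. \<forall>v\<in>U2 - {x}. \<not> E u v"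
  shows "xAT (U1 \<union> U2) x"
proof -
  obtain A where A: "orients U1 A" "signed_count A (\<lambda>_. 0) \<noteq> 0" "\<forall>v\<in>U1. 1 \<le> ind A v" and f1: "finite U1"
    using assms(1) unfolding ATg_def by blast
  obtain B where B: "orients U2 B" "signed_count B (\<lambda>_. 0) \<noteq> 0" "\<forall>v\<in>U2. 1 \<le> ind B v" and f2: "finite U2"
    using assms(2) unfolding ATg_def by blast
  have sub: "A \<subseteq> U1 \<times> U1" "B \<subseteq> U2 \<times> U2" using A(1) B(1) by (auto simp: orients_def)
  have fin: "finite A" "finite B" using orients_finite A(1) B(1) f1 f2 by auto
  have nl: "(v, v) \<notin> A" "(v, v) \<notin> B" for v using A(1) B(1) E_irrefl[of v] unfolding orients_def by blast+
  have nE: "\<not> E u v \<and> \<not> E v u" if "u \<in> U1" "u \<noteq> x" "v \<in> U2" "v \<noteq> x" for u v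
    using assms(4) that E_sym by blast
  have AB: "(u, v) \<in> A \<Longrightarrow> u \<in> U1 \<and> v \<in> U1 \<and> E u v" "(u, v) \<in> B \<Longrightarrow> u \<in> U2 \<and> v \<in> U2 \<and> E u v" for u v
    using A(1) B(1) by (auto simp: orients_def)
  have tot: "((u, v) \<in> A \<union> B) \<noteq> ((v, u) \<in> A \<union> B)" if uv: "u \<in> U1 \<union> U2" "v \<in> U1 \<union> U2" "E u v" for u v
  proof -
    have "(u \<in> U1 \<and> v \<in> U1) \<or> (u \<in> U2 \<and> v \<in> U2)" using uv nE[of u v] nE[of v u] assms(3) by blast
    moreover have "\<not> (u \<in> U1 \<and> v \<in> U1 \<and> u \<in> U2 \<and> v \<in> U2)" using assms(3) uv(3) E_neq by (metis IntI singletonD)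
    ultimately show ?thesis
      using A(1) B(1) uv AB[of u v] AB[of v u] unfolding orients_def by blast
  qed
  have "orients (U1 \<union> U2) (A \<union> B)"
    unfolding orients_def using tot AB by auto
  moreover have "signed_count (A \<union> B) (\<lambda>_. 0) \<noteq> 0"
    using signed_count_cut[OF sub f1 f2 assms(3) nl(1)] A(2) B(2) by simp
  moreover have "(if v = x then 2 else 1) \<le> ind (A \<union> B) v" if v: "v \<in> U1 \<union> U2" for v
  proof (cases "v = x")
    case True
    have x: "x \<in> U1" "x \<in> U2" using assms(3) by auto
    have "(u, x) \<notin> B" if "(u, x) \<in> A" for u
      using AB(1)[OF that] AB(2)[of u x] assms(3) nl(1)[of x] that by (metis IntI singletonD)
    then have "{u. (u, x) \<in> A} \<inter> {u. (u, x) \<in> B} = {}" by blast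
    moreover have "finite {u. (u, x) \<in> A}" "finite {u. (u, x) \<in> B}"
      using sub f1 f2 by (auto intro: finite_subset[of _ U1] finite_subset[of _ U2])
    moreover have "{u. (u, x) \<in> A \<union> B} = {u. (u, x) \<in> A} \<union> {u. (u, x) \<in> B}" by auto
    ultimately have "ind (A \<union> B) x = ind A x + ind B x" by (simp add: ind_def card_Un_disjoint)
    then show ?thesis using True A(3) B(3) x by fastforce
  next
    case False
    have "1 \<le> ind A v \<or> 1 \<le> ind B v" using v A(3) B(3) by auto
    then show ?thesis
      using False ind_mono[of "A \<union> B" A v] ind_mono[of "A \<union> B" B v] fin by auto
  qed
  ultimately show ?thesis unfolding ATg_def using f1 f2 by blast
qed

section \<open>Connectivity, induced paths and shortest paths\<close>

lemma conn_singleton [simp]: "conn {v}"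
  by (auto simp: conn_def)

lemma conn_nonempty: "conn U \<Longrightarrow> U \<noteq> {}"
  by (simp add: conn_def)

lemma conn_Un:
  assumes "conn A" "conn B" "(\<exists>a\<in>A. \<exists>b\<in>B. E a b) \<or> A \<inter> B \<noteq> {}"
  shows "conn (A \<union> B)"
  unfolding conn_def
proof (intro conjI allI impI)
  show "A \<union> B \<noteq> {}" using assms conn_nonempty by blast
  fix X assume X: "X \<subseteq> A \<union> B" "X \<noteq> {}" "X \<noteq> A \<union> B"
  have cut: "\<exists>a\<in>X. \<exists>b\<in>A \<union> B - X. E a b" if C: "conn C" "C \<subseteq> A \<union> B" "X \<inter> C \<noteq> {}" "\<not> C \<subseteq> X" for C
  proof -
    have "X \<inter> C \<subseteq> C" "X \<inter> C \<noteq> C" using C by auto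
    then obtain a b where "a \<in> X \<inter> C" "b \<in> C - (X \<inter> C)" "E a b"
      using C(1,3) unfolding conn_def by meson
    then show ?thesis using C(2) by blast
  qed
  show "\<exists>a\<in>X. \<exists>b\<in>A \<union> B - X. E a b"
  proof (rule ccontr)
    assume n: "\<not> ?thesis"
    have a: "X \<inter> A = {} \<or> A \<subseteq> X" using cut[OF assms(1)] n by blast
    have b: "X \<inter> B = {} \<or> B \<subseteq> X" using cut[OF assms(2)] n by blast
    then consider "X = A" "X \<inter> B = {}" | "X = B" "X \<inter> A = {}" using a X by blast
    then show False
      by cases (use n assms(3) E_sym in blast)+
  qed
qed

lemma conn_insert: "conn A \<Longrightarrow> a \<in> A \<Longrightarrow> E u a \<Longrightarrow> conn (insert u A)"
  using conn_Un[of "{u}" A] by auto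

text \<open>A set without \<open>v\<close> is left by some edge of \<open>U\<close>, which cannot
  leave the lobe; a set containing \<open>v\<close> is treated through its complement in the
  lobe.\<close>

lemma conn_lobe:
  assumes "conn U" "v \<in> U" "A \<subseteq> U - {v}" "\<forall>a\<in>A. \<forall>b\<in>U - insert v A. \<not> E a b"
  shows "conn (insert v A)"
  unfolding conn_def
proof (intro conjI allI impI)
  fix X assume X: "X \<subseteq> insert v A" "X \<noteq> {}" "X \<noteq> insert v A"
  show "\<exists>a\<in>X. \<exists>b\<in>insert v A - X. E a b"
  proof (cases "v \<in> X")
    case True
    let ?Y = "insert v A - X"
    have Y: "?Y \<subseteq> U" "?Y \<noteq> {}" "?Y \<noteq> U" using X True assms by auto
    then obtain a b where ab: "a \<in> ?Y" "b \<in> U - ?Y" "E a b" using assms(1) unfolding conn_def by meson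
    then have "b \<in> insert v A" using assms(4) True by blast
    then show ?thesis using ab E_sym by blast
  next
    case False
    have Y: "X \<subseteq> U" "X \<noteq> U" using X False assms by auto
    then obtain a b where ab: "a \<in> X" "b \<in> U - X" "E a b" using assms(1) X(2) unfolding conn_def by meson
    then have "b \<in> insert v A" using assms(4) False X(1) by blast
    then show ?thesis using ab by blast
  qed
qed simp

fun ipath :: "'a list \<Rightarrow> bool" where
  "ipath [] \<longleftrightarrow> False"
| "ipath [v] \<longleftrightarrow> True"
| "ipath (u # v # q) \<longleftrightarrow> u \<notin> set (v # q) \<and> E u v \<and> (\<forall>w\<in>set q. \<not> E u w) \<and> ipath (v # q)"

lemma ipath_nonempty: "ipath p \<Longrightarrow> p \<noteq> []"
  by auto

lemma ipath_Cons: "q \<noteq> [] \<Longrightarrow>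
    ipath (u # q) \<longleftrightarrow> u \<notin> set q \<and> ipath q \<and> (\<forall>v\<in>set q. E u v \<longleftrightarrow> v = hd q)"
proof (cases q)
  case (Cons v r)
  show ?thesis unfolding Cons using ipath.simps(3)[of u v r]
    by (cases r) (auto simp: E_irrefl)
qed simp

lemma ipath_append: "p \<noteq> [] \<Longrightarrow> q \<noteq> [] \<Longrightarrow>
    ipath (p @ q) \<longleftrightarrow> ipath p \<and> ipath q \<and> set p \<inter> set q = {} \<and>
      (\<forall>u\<in>set p. \<forall>v\<in>set q. E u v \<longleftrightarrow> u = last p \<and> v = hd q)"
proof (induction p)
  case (Cons a p)
  show ?case
  proof (cases "p = []")
    case True
    then show ?thesis using Cons.prems by (auto simp: ipath_Cons)
  next
    case False
    then have la: "last (a # p) = last p" "last p \<in> set p" by auto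
    have "hd p \<in> set p" using False by simp
    then have "set p \<inter> set q = {} \<Longrightarrow> hd p \<notin> set q" by auto
    then show ?thesis using Cons False la by (auto simp: ipath_Cons)
  qed
qed simp

lemma ipath_distinct: "ipath p \<Longrightarrow> distinct p"
  by (induction p rule: ipath.induct) auto

lemma ipath_rev: "ipath p \<Longrightarrow> ipath (rev p)"
proof (induction p)
  case (Cons a p)
  show ?case
  proof (cases "p = []")
    case False
    then show ?thesis using Cons by (auto simp: ipath_Cons ipath_append last_rev E_comm)
  qed simp
qed simp

lemma ipath_conn: "ipath p \<Longrightarrow> conn (set p)"
proof (induction p)
  case (Cons a p)
  show ?case
  proof (cases "p = []")
    case False
    then show ?thesis using Cons conn_insert[of "set p" "hd p" a] by (auto simp: ipath_Cons)
  qed simp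
qed simp

lemma ipath_appendD: "ipath (p @ q) \<Longrightarrow> (p \<noteq> [] \<longrightarrow> ipath p) \<and> (q \<noteq> [] \<longrightarrow> ipath q)"
  by (cases "p = []"; cases "q = []") (auto simp: ipath_append)

lemma ipath_E_iff: "ipath p \<Longrightarrow> u \<in> set p \<Longrightarrow> v \<in> set p \<Longrightarrow>
    E u v \<longleftrightarrow> (u, v) \<in> path_arcs p \<or> (v, u) \<in> path_arcs p"
proof (induction p)
  case (Cons a p)
  show ?case
  proof (cases "p = []")
    case True
    then show ?thesis using Cons E_irrefl by auto
  next
    case False
    have pa: "path_arcs (a # p) = insert (a, hd p) (path_arcs p)" using False by (rule arcs_Cons)
    have s: "(y, z) \<in> path_arcs p \<Longrightarrow> y \<in> set p \<and> z \<in> set p" for y z using arcs_sets by fast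
    show ?thesis using Cons False s unfolding pa by (auto simp: ipath_Cons E_irrefl E_comm)
  qed
qed simp

lemma ipath_successively: "ipath p \<Longrightarrow> successively E p"
  by (induction p rule: ipath.induct) auto

lemma ipathI:
  "p \<noteq> [] \<Longrightarrow> successively E p \<Longrightarrow>
   (\<And>i j. i < j \<Longrightarrow> j < length p \<Longrightarrow> p ! i \<noteq> p ! j \<and> (E (p ! i) (p ! j) \<longrightarrow> j = Suc i)) \<Longrightarrow> ipath p"
proof (induction p)
  case (Cons a p)
  show ?case
  proof (cases "p = []")
    case False
    have "ipath p"
    proof (rule Cons.IH[OF False])
      show "successively E p" using Cons.prems(2) False by (auto simp: successively_Cons)
      fix i j :: nat assume "i < j" "j < length p"
      then show "p ! i \<noteq> p ! j \<and> (E (p ! i) (p ! j) \<longrightarrow> j = Suc i)"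
        using Cons.prems(3)[of "Suc i" "Suc j"] by simp
    qed
    moreover have "a \<noteq> v \<and> (E a v \<longleftrightarrow> v = hd p)" if v: "v \<in> set p" for v
    proof -
      obtain j where j: "j < length p" "v = p ! j" using v by (auto simp: in_set_conv_nth)
      have "E a (hd p)" using Cons.prems(2) False by (auto simp: successively_Cons)
      then show ?thesis using Cons.prems(3)[of 0 "Suc j"] j False by (auto simp: hd_conv_nth)
    qed
    ultimately show ?thesis using False by (auto simp: ipath_Cons)
  qed simp
qed simp

lemma conn_walk:
  assumes "conn U" "A \<subseteq> U" "A \<noteq> {}" "b \<in> U"
  shows "\<exists>p. p \<noteq> [] \<and> set p \<subseteq> U \<and> successively E p \<and> hd p \<in> A \<and> last p = b"
proof -
  define R where "R = {v. \<exists>p. p \<noteq> [] \<and> set p \<subseteq> U \<and> successively E p \<and> hd p \<in> A \<and> last p = v}"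
  have "A \<subseteq> R"
  proof
    fix a assume "a \<in> A"
    then show "a \<in> R" unfolding R_def using assms(2) by (auto intro!: exI[of _ "[a]"])
  qed
  moreover have "R \<subseteq> U" by (auto simp: R_def)
  moreover have "b' \<in> R" if "a \<in> R" "b' \<in> U" "E a b'" for a b'
  proof -
    obtain p where "p \<noteq> []" "set p \<subseteq> U" "successively E p" "hd p \<in> A" "last p = a"
      using \<open>a \<in> R\<close> by (auto simp: R_def)
    then show ?thesis unfolding R_def using that
      by (auto simp: successively_append_iff intro!: exI[of _ "p @ [b']"])
  qed
  ultimately have "R = U" using assms(1,3) unfolding conn_def by (metis Diff_iff subset_empty)
  then show ?thesis using assms(4) by (auto simp: R_def)
qed

text \<open>Minimality among plain walks suffices: a repetition or a chord would shorten the walk,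
  and so would an early vertex of \<open>B\<close>, a late vertex of \<open>A\<close>, or an edge to
  one of these sets that skips a vertex. The last two clauses make the path touch its targets at one
  place only.\<close>

lemma shortest_path:
  assumes "conn U" "A \<subseteq> U" "B \<subseteq> U" "A \<noteq> {}" "B \<noteq> {}" "A \<inter> B = {}"
  shows "\<exists>p. ipath p \<and> set p \<subseteq> U \<and> 2 \<le> length p \<and> hd p \<in> A \<and> last p \<in> B \<and>
    set (tl p) \<inter> A = {} \<and> set (butlast p) \<inter> B = {} \<and>
    (\<forall>v\<in>set (butlast (butlast p)). \<forall>b\<in>B. \<not> E v b) \<and> (\<forall>v\<in>set (tl (tl p)). \<forall>a\<in>A. \<not> E a v)"
proof -
  define W where "W p \<longleftrightarrow> p \<noteq> [] \<and> set p \<subseteq> U \<and> successively E p \<and> hd p \<in> A \<and> last p \<in> B" for p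
  obtain b where "b \<in> B" using assms by auto
  then have "\<exists>p. W p" using conn_walk[OF assms(1,2,4), of b] assms(3) by (auto simp: W_def)
  then obtain p where p: "W p" and min: "\<And>q. W q \<Longrightarrow> length p \<le> length q"
    using ex_has_least_nat[of W _ length] by blast
  have len: "2 \<le> length p" using p assms(6) by (cases p; cases "tl p") (auto simp: W_def)
  note pW = p[unfolded W_def]
  have tk: "successively E (take i p)" "successively E (drop i p)" for i
    using pW successively_append_iff[of E "take i p" "drop i p"] by auto
  have lt: "last (take (Suc i) p) = p ! i" if "i < length p" for i
    using that by (simp add: take_Suc_conv_app_nth)
  have join: "W (take (Suc i) p @ drop j p)" if "i < length p" "j < length p" "E (p ! i) (p ! j)" for i j
    using that pW tk lt[of i] set_take_subset[of "Suc i" p] set_drop_subset[of j p]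
    by (auto simp: W_def successively_append_iff hd_drop_conv_nth)
  have 1: "p ! i \<noteq> p ! j \<and> (E (p ! i) (p ! j) \<longrightarrow> j = Suc i)" if ij: "i < j" "j < length p" for i j
  proof
    show "E (p ! i) (p ! j) \<longrightarrow> j = Suc i"
    proof
      assume "E (p ! i) (p ! j)"
      then have "length p \<le> length (take (Suc i) p @ drop j p)" using min[OF join[of i j]] ij by auto
      then show "j = Suc i" using ij by simp
    qed
    show "p ! i \<noteq> p ! j"
    proof
      assume eq: "p ! i = p ! j"
      show False
      proof (cases "Suc j < length p")
        case True
        have "E (p ! j) (p ! Suc j)" using pW True by (simp add: successively_conv_nth)
        then have "length p \<le> length (take (Suc i) p @ drop (Suc j) p)"
          using min[OF join[of i "Suc j"]] ij True eq by auto
        then show False using ij True by simp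
      next
        case False
        then have "last p = p ! i" using ij eq pW last_conv_nth[of p] by (metis Suc_lessI diff_Suc_1)
        then have "W (take (Suc i) p)" using pW tk lt[of i] ij set_take_subset[of "Suc i" p] by (auto simp: W_def)
        then have "length p \<le> length (take (Suc i) p)" using min by blast
        then show False using ij by simp
      qed
    qed
  qed
  have ip: "ipath p" by (rule ipathI) (use pW 1 in auto)
  have c1: "set (tl p) \<inter> A = {}"
  proof (rule ccontr)
    assume "set (tl p) \<inter> A \<noteq> {}"
    then obtain i where i: "i < length (tl p)" "tl p ! i \<in> A" by (auto simp: in_set_conv_nth)
    then have "Suc i < length p" "p ! Suc i \<in> A" by (auto simp: nth_tl)
    then have "W (drop (Suc i) p)" using pW tk set_drop_subset[of "Suc i" p] by (auto simp: W_def hd_drop_conv_nth)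
    then have "length p \<le> length (drop (Suc i) p)" using min by blast
    then show False using \<open>Suc i < length p\<close> by simp
  qed
  have c2: "set (butlast p) \<inter> B = {}"
  proof (rule ccontr)
    assume "set (butlast p) \<inter> B \<noteq> {}"
    then obtain i where i: "i < length (butlast p)" "butlast p ! i \<in> B" by (auto simp: in_set_conv_nth)
    then have i': "Suc i < length p" "p ! i \<in> B" by (auto simp: nth_butlast)
    then have "W (take (Suc i) p)" using pW tk lt[of i] set_take_subset[of "Suc i" p] by (auto simp: W_def)
    then have "length p \<le> length (take (Suc i) p)" using min by blast
    then show False using i' by simp
  qed
  have c3: "\<not> E v b" if v: "v \<in> set (butlast (butlast p))" and b: "b \<in> B" for v b
  proof
    assume e: "E v b"
    obtain i where i: "i < length (butlast (butlast p))" "v = butlast (butlast p) ! i"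
      using v by (auto simp: in_set_conv_nth)
    then have i': "Suc (Suc i) < length p" "v = p ! i" by (auto simp: nth_butlast)
    have "W (take (Suc i) p @ [b])"
      using pW tk lt[of i] i' e b assms(3) set_take_subset[of "Suc i" p]
      by (auto simp: W_def successively_append_iff)
    then have "length p \<le> length (take (Suc i) p @ [b])" using min by blast
    then show False using i' by simp
  qed
  have c4: "\<not> E a v" if v: "v \<in> set (tl (tl p))" and a: "a \<in> A" for v a
  proof
    assume e: "E a v"
    obtain i where i: "i < length (tl (tl p))" "v = tl (tl p) ! i"
      using v by (auto simp: in_set_conv_nth)
    then have i': "Suc (Suc i) < length p" "v = p ! Suc (Suc i)" by (auto simp: nth_tl)
    have "W (a # drop (Suc (Suc i)) p)"
      using pW tk i' e a assms(2) set_drop_subset[of "Suc (Suc i)" p]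
      by (auto simp: W_def successively_Cons hd_drop_conv_nth)
    then have "length p \<le> length (a # drop (Suc (Suc i)) p)" using min by blast
    then show False using i' by simp
  qed
  show ?thesis using ip pW len c1 c2 c3 c4 by blast
qed

section \<open>Orientations read off from path systems\<close>

lemma path_system_pair:
  "path_system ps \<Longrightarrow> p \<in> set ps \<Longrightarrow> q \<in> set ps \<Longrightarrow> p \<noteq> q \<Longrightarrow>
   inner p \<inter> set q = {} \<and> inner q \<inter> set p = {} \<and> (length p = 2 \<and> length q = 2 \<longrightarrow> set p \<noteq> set q)"
  by (induction ps) auto

lemma in_tl_arc: "v \<in> set (tl p) \<Longrightarrow> \<exists>u. (u, v) \<in> path_arcs p"
  by (induction p rule: path_arcs.induct) auto

lemma arcs_adjacent: "successively E p \<Longrightarrow> (u, v) \<in> path_arcs p \<Longrightarrow> E u v"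
  by (induction p rule: path_arcs.induct) auto

text \<open>Every path is directed along its list. By \<open>cover\<close> no other edge joins two
  vertices of \<open>W\<close>, so the whole induced subgraph is oriented. A vertex of some
  \<open>tl p\<close> has an incoming arc, and two different paths ending in \<open>x\<close> bring
  two arcs, which cannot coincide in a path system.\<close>

lemma path_system_AT:
  assumes ps: "path_system ps" "\<forall>p\<in>set ps. successively E p"
    and W: "W = \<Union>(set ` set ps)"
    and cover: "\<And>u v. E u v \<Longrightarrow> u \<in> W \<Longrightarrow> v \<in> W \<Longrightarrow> (u, v) \<in> all_arcs ps \<or> (v, u) \<in> all_arcs ps"
    and into: "\<forall>v\<in>W. \<exists>p\<in>set ps. v \<in> set (tl p)"
    and nz: "path_count (map path_type ps) (\<lambda>_. 0) \<noteq> 0"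
  shows "dAT W" and "p \<in> set ps \<Longrightarrow> q \<in> set ps \<Longrightarrow> p \<noteq> q \<Longrightarrow> last p = x \<Longrightarrow> last q = x \<Longrightarrow> xAT W x"
proof -
  let ?A = "all_arcs ps"
  have "E u v \<and> u \<in> W \<and> v \<in> W" if "(u, v) \<in> ?A" for u v
    using that arcs_sets[of u v] arcs_adjacent[of _ u v] ps(2) unfolding W all_arcs_def by blast
  then have or: "orients W ?A" unfolding orients_def using cover all_arcs_antisym[OF ps(1)] by blast
  have fW: "finite W" by (simp add: W)
  have fA: "finite ?A" by (rule orients_finite[OF fW or])
  have nz': "signed_count ?A (\<lambda>_. 0) \<noteq> 0" using signed_count_path_system[OF ps(1)] nz by simp
  have finr: "finite {u. (u, v) \<in> ?A}" for v
    by (rule finite_subset[of _ "fst ` ?A"]) (use fA in \<open>auto simp: rev_image_eqI\<close>)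
  have 1: "1 \<le> ind ?A v" if v: "v \<in> W" for v
  proof -
    obtain p where p: "p \<in> set ps" "v \<in> set (tl p)" using into v by blast
    then obtain u where "(u, v) \<in> path_arcs p" using in_tl_arc by metis
    then have "u \<in> {u. (u, v) \<in> ?A}" using p by (auto simp: all_arcs_def)
    then show ?thesis unfolding ind_def using finr[of v] by (metis One_nat_def Suc_leI card_gt_0_iff empty_iff)
  qed
  show "dAT W" unfolding ATg_def using fW or nz' 1 by auto
  assume pq: "p \<in> set ps" "q \<in> set ps" "p \<noteq> q" "last p = x" "last q = x"
  have len: "2 \<le> length r" if "r \<in> set ps" for r
    using ps(1) that by (induction ps) auto
  have ltl: "last r \<in> set (tl r)" if "r \<in> set ps" for r
    using len[OF that] by (cases r; cases "tl r") auto
  obtain u where u: "(u, x) \<in> path_arcs p" using in_tl_arc[OF ltl[OF pq(1)]] pq by auto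
  obtain w where w: "(w, x) \<in> path_arcs q" using in_tl_arc[OF ltl[OF pq(2)]] pq by auto
  have "u \<noteq> w" using arcs_no_common[of p q u x] path_system_pair[OF ps(1) pq(1-3)] u w by blast
  moreover have "{u, w} \<subseteq> {u. (u, x) \<in> ?A}" using u w pq by (auto simp: all_arcs_def)
  ultimately have "2 \<le> ind ?A x" unfolding ind_def using card_mono[OF finr[of x], of "{u, w}"] by simp
  then show "xAT W x" unfolding ATg_def using fW or nz' 1 by auto
qed

end

section \<open>Orientations made of directed paths\<close>

text \<open>The form in which concrete configurations are checked: \<open>vs\<close> lists the
  branch vertices, \<open>ix\<close> gives the positions of the ends of each path, and the count
  with all weights 1 is evaluated.\<close>

lemma odd_path_count:
  assumes "distinct vs" "map (\<lambda>p. (hd p, last p)) ps = map (\<lambda>(i, j). (vs ! i, vs ! j)) ix"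
    and "\<forall>(i, j)\<in>set ix. i < length vs \<and> j < length vs"
    and "odd (index_count (map (\<lambda>(i, j). (i, j, 1)) ix) (replicate n 0))" "length vs = n"
  shows "path_count (map path_type ps) (\<lambda>_. 0) \<noteq> 0"
proof -
  define ts where "ts = map (\<lambda>(p, i, j). (i, j, (-1::int) ^ (length p - 1))) (zip ps ix)"
  have len: "length ps = length ix" using arg_cong[OF assms(2), of length] by simp
  have "hd (ps ! k) = vs ! fst (ix ! k) \<and> last (ps ! k) = vs ! snd (ix ! k)" if "k < length ps" for k
    using arg_cong[OF assms(2), of "\<lambda>l. l ! k"] that len by (simp add: case_prod_beta)
  then have 1: "map path_type ps = map (\<lambda>(i, j, s). (vs ! i, vs ! j, s)) ts"
    using len by (auto intro!: nth_equalityI simp: ts_def path_type_def split: prod.splits)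
  have 2: "\<forall>(i, j, s)\<in>set ts. i < length vs \<and> j < length vs"
    using assms(3) by (auto simp: ts_def dest: set_zip_rightD)
  have 3: "map (\<lambda>(i, j, s). (i, j, 1)) ts = map (\<lambda>(i, j). (i, j, 1)) ix"
    using len by (auto intro!: nth_equalityI simp: ts_def split: prod.splits)
  have "even (index_count ts b) = even (index_count (map (\<lambda>(i, j, s). (i, j, 1)) ts) b)" for b
    by (rule index_count_parity) (auto simp: ts_def)
  then show ?thesis unfolding 1 path_count_zero[OF assms(1) 2] using assms(4,5) 3 by (metis even_zero)
qed

definition edges_of :: "'a list \<Rightarrow> ('a \<times> 'a) set" where
  "edges_of p = path_arcs p \<union> (path_arcs p)\<inverse>"

lemma arcs_append: "p \<noteq> [] \<Longrightarrow> q \<noteq> [] \<Longrightarrow>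
    path_arcs (p @ q) = path_arcs p \<union> {(last p, hd q)} \<union> path_arcs q"
  by (induction p rule: path_arcs.induct) (auto simp: arcs_Cons)

lemma edges_of_append: "p \<noteq> [] \<Longrightarrow> q \<noteq> [] \<Longrightarrow>
    edges_of (p @ q) = edges_of p \<union> {(last p, hd q), (hd q, last p)} \<union> edges_of q"
  by (auto simp: edges_of_def arcs_append)

lemma edges_of_Cons: "q \<noteq> [] \<Longrightarrow> edges_of (u # q) = {(u, hd q), (hd q, u)} \<union> edges_of q"
  by (auto simp: edges_of_def arcs_Cons)

lemma edges_of_simps [simp]: "edges_of [] = {}" "edges_of [v] = {}"
  by (auto simp: edges_of_def)

lemma edges_of_sub: "edges_of m \<subseteq> edges_of (a # m @ [b])"
  by (cases "m = []") (auto simp: edges_of_append edges_of_Cons)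

lemma edges_of_ends: "m \<noteq> [] \<Longrightarrow> {(a, hd m), (hd m, a), (b, last m), (last m, b)} \<subseteq> edges_of (a # m @ [b])"
  by (auto simp: edges_of_append edges_of_Cons)

lemma edges_of_split: "edges_of (p @ a # q) = edges_of (p @ [a]) \<union> edges_of (a # q)"
  by (cases "p = []") (auto simp: edges_of_append)

lemma edges_of_rev: "edges_of (rev p) = edges_of p"
proof (induction p)
  case (Cons a p)
  then show ?case
    by (cases "p = []") (auto simp: edges_of_append edges_of_Cons last_rev)
qed simp

lemma all_arcs_cover: "(u, v) \<in> \<Union>(edges_of ` set ps) \<Longrightarrow> (u, v) \<in> all_arcs ps \<or> (v, u) \<in> all_arcs ps"
  by (auto simp: all_arcs_def edges_of_def)

lemma edges_of_sym: "(u, v) \<in> edges_of p \<longleftrightarrow> (v, u) \<in> edges_of p"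
  by (auto simp: edges_of_def)

lemma inner_simps [simp]:
  "inner (a # m @ [b]) = set m" "inner [a, b] = {}"
  by (auto simp: inner_def)

context sgraph
begin

lemma ipath_edges: "ipath p \<Longrightarrow> u \<in> set p \<Longrightarrow> v \<in> set p \<Longrightarrow> E u v \<Longrightarrow> (u, v) \<in> edges_of p"
  using ipath_E_iff[of p u v] by (auto simp: edges_of_def)

section \<open>Theta graphs\<close>

text \<open>The paths through \<open>m1\<close> and \<open>m2\<close> lead from \<open>s\<close> to
  \<open>x\<close>, the one through \<open>m3\<close> leads back. The balanced subsets are the empty
  one and the two directed cycles sharing the way back. An empty \<open>m3\<close> stands for the
  edge between \<open>x\<close> and \<open>s\<close>.\<close>

lemma theta_core:
  assumes "ipath m1" "ipath m2" "m3 \<noteq> [] \<Longrightarrow> ipath m3" "distinct (x # s # m1 @ m2 @ m3)"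
    and e1: "\<forall>z\<in>set m1. (E x z \<longleftrightarrow> z = last m1) \<and> (E s z \<longleftrightarrow> z = hd m1)"
    and e2: "\<forall>z\<in>set m2. (E x z \<longleftrightarrow> z = last m2) \<and> (E s z \<longleftrightarrow> z = hd m2)"
    and e3: "\<forall>z\<in>set m3. (E x z \<longleftrightarrow> z = hd m3) \<and> (E s z \<longleftrightarrow> z = last m3)"
    and xs: "E x s \<longleftrightarrow> m3 = []"
    and n: "\<forall>u\<in>set m1. \<forall>v\<in>set m2. \<not> E u v" "\<forall>u\<in>set m1. \<forall>v\<in>set m3. \<not> E u v"
      "\<forall>u\<in>set m2. \<forall>v\<in>set m3. \<not> E u v"
  shows "dAT ({x, s} \<union> set m1 \<union> set m2 \<union> set m3) \<and> xAT ({x, s} \<union> set m1 \<union> set m2 \<union> set m3) x"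
proof -
  let ?W = "{x, s} \<union> set m1 \<union> set m2 \<union> set m3"
  let ?ps = "[s # m1 @ [x], s # m2 @ [x], x # m3 @ [s]]"
  have ne: "m1 \<noteq> []" "m2 \<noteq> []" using assms(1,2) by auto
  have ps: "path_system ?ps" using assms(4) ne by auto
  have suc: "\<forall>p\<in>set ?ps. successively E p"
    using ne assms(1-3) e1 e2 e3 xs
    by (auto simp: successively_Cons successively_append_iff ipath_successively E_comm)
  have ends: "{(s, hd m1), (x, last m1)} \<subseteq> edges_of (s # m1 @ [x])" "{(s, hd m2), (x, last m2)} \<subseteq> edges_of (s # m2 @ [x])"
    "\<And>z. z \<in> set m3 \<Longrightarrow> {(x, hd m3), (s, last m3)} \<subseteq> edges_of (x # m3 @ [s])"
    using ne edges_of_ends[of m1 s x] edges_of_ends[of m2 s x] edges_of_ends[of m3 x s] by (auto, (cases "m3 = []"; simp)+)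
  have cov: "(u, v) \<in> \<Union>(edges_of ` set ?ps)" if "E u v" "u \<in> ?W" "v \<in> ?W" for u v
  proof -
    have k: "E u v \<Longrightarrow> (u, v) \<in> \<Union>(edges_of ` set ?ps)"
      if uv: "u \<in> {x, s} \<and> v \<in> ?W \<or> (\<exists>m\<in>{m1, m2, m3}. u \<in> set m \<and> v \<in> set m)" for u v
    proof -
      assume E: "E u v"
      consider "\<exists>m\<in>{m1, m2, m3}. u \<in> set m \<and> v \<in> set m" | "u = x" "v \<in> ?W" | "u = s" "v \<in> ?W"
        using uv by blast
      then show ?thesis
      proof cases
        case 1
        then obtain m where m: "m \<in> {m1, m2, m3}" "u \<in> set m" "v \<in> set m" by blast
        then have "ipath m" using assms(1-3) by (cases "m3 = []") auto
        then have "(u, v) \<in> edges_of m" using ipath_edges m E by blast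
        moreover have "edges_of m \<subseteq> \<Union>(edges_of ` set ?ps)"
          using m(1) edges_of_sub[of m1 s x] edges_of_sub[of m2 s x] edges_of_sub[of m3 x s] by auto
        ultimately show ?thesis by blast
      next
        case 2
        then consider "v = s" | "v \<in> set m1" | "v \<in> set m2" | "v \<in> set m3" using E E_irrefl by blast
        then show ?thesis
        proof cases
          case 1
          then show ?thesis using xs E \<open>u = x\<close> by (auto simp: edges_of_Cons)
        qed (use e1 e2 e3 E \<open>u = x\<close> ends(1,2) ends(3)[of v] in auto)
      next
        case 3
        then consider "v = x" | "v \<in> set m1" | "v \<in> set m2" | "v \<in> set m3" using E E_irrefl by blast
        then show ?thesis
        proof cases
          case 1
          then show ?thesis using xs E \<open>u = s\<close> E_comm[of s x] by (auto simp: edges_of_Cons)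
        qed (use e1 e2 e3 E \<open>u = s\<close> ends(1,2) ends(3)[of v] in auto)
      qed
    qed
    have "u \<in> {x, s} \<and> v \<in> ?W \<or> (\<exists>m\<in>{m1, m2, m3}. u \<in> set m \<and> v \<in> set m) \<or> v \<in> {x, s} \<and> u \<in> ?W"
      using that n E_comm[of u v] by auto
    then show ?thesis using k[of u v] k[of v u] that(1) E_comm[of u v] edges_of_sym[of u v] by blast
  qed
  have nz: "path_count (map path_type ?ps) (\<lambda>_. 0) \<noteq> 0"
    by (rule odd_path_count[where n = 2 and vs = "[x, s]" and ix = "[(1, 0), (1, 0), (0, 1)]"])
      ((use assms(4) in auto)[1], simp, simp, code_simp, simp)
  have W: "?W = \<Union>(set ` set ?ps)" by auto
  have into: "\<forall>v\<in>?W. \<exists>p\<in>set ?ps. v \<in> set (tl p)" by auto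
  have neq: "s # m1 @ [x] \<noteq> s # m2 @ [x]" using ne assms(4) by (cases m1) auto
  have "dAT ?W" by (rule path_system_AT(1)[OF ps suc W all_arcs_cover[OF cov] into nz])
  moreover have "xAT ?W x"
    by (rule path_system_AT(2)[OF ps suc W all_arcs_cover[OF cov] into nz _ _ neq]) simp_all
  ultimately show ?thesis by blast
qed

text \<open>The inner vertices of a path from \<open>u\<close> to \<open>w\<close>; a single vertex
  adjacent to both is allowed. Whether \<open>u\<close> and \<open>w\<close> are themselves adjacent
  is left open, so that links can be combined with an edge.\<close>

definition link :: "'a set \<Rightarrow> 'a \<Rightarrow> 'a \<Rightarrow> bool" where
  "link C u w \<longleftrightarrow> (\<exists>m. ipath m \<and> set m \<subseteq> C \<and> (\<forall>z\<in>set m. (E u z \<longleftrightarrow> z = hd m) \<and> (E w z \<longleftrightarrow> z = last m)))"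

text \<open>A common neighbour in \<open>D\<close> is a link by itself. Without one, a shortest path
  in \<open>D\<close> between the two neighbourhoods meets each of them exactly once.\<close>

lemma linkI:
  assumes "conn D" "D \<subseteq> C" "a \<in> D" "E u a" "b \<in> D" "E w b"
  shows "link C u w"
proof (cases "\<exists>d\<in>D. E u d \<and> E w d")
  case True
  then obtain d where "d \<in> D" "E u d" "E w d" by blast
  then show ?thesis unfolding link_def using assms(2) by (intro exI[of _ "[d]"]) auto
next
  case False
  let ?A = "{d \<in> D. E u d}" and ?B = "{d \<in> D. E w d}"
  have "\<exists>p. ipath p \<and> set p \<subseteq> D \<and> 2 \<le> length p \<and> hd p \<in> ?A \<and> last p \<in> ?B \<and>
    set (tl p) \<inter> ?A = {} \<and> set (butlast p) \<inter> ?B = {} \<and>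
    (\<forall>v\<in>set (butlast (butlast p)). \<forall>b\<in>?B. \<not> E v b) \<and> (\<forall>v\<in>set (tl (tl p)). \<forall>a\<in>?A. \<not> E a v)"
    by (rule shortest_path) (use assms False in auto)
  then obtain p where p: "ipath p" "set p \<subseteq> D" "hd p \<in> ?A" "last p \<in> ?B"
    "set (tl p) \<inter> ?A = {}" "set (butlast p) \<inter> ?B = {}" by blast
  have "E u z \<longleftrightarrow> z = hd p" "E w z \<longleftrightarrow> z = last p" if z: "z \<in> set p" for z
  proof -
    have "z = hd p \<or> z \<in> set (tl p)" using z by (cases p) auto
    then show "E u z \<longleftrightarrow> z = hd p" using p z by auto
    have "z = last p \<or> z \<in> set (butlast p)"
      using z append_butlast_last_id[of p] by (metis Un_iff empty_iff empty_set insert_iff list.simps(15) set_append)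
    then show "E w z \<longleftrightarrow> z = last p" using p z by auto
  qed
  then show ?thesis unfolding link_def using p(1,2) assms(2) by blast
qed

lemma theta:
  assumes "x \<noteq> s" "link C1 x s" "link C2 x s" "E x s \<or> link C3 x s"
    and "x \<notin> C1 \<union> C2 \<union> C3" "s \<notin> C1 \<union> C2 \<union> C3"
    and "C1 \<inter> C2 = {}" "C1 \<inter> C3 = {}" "C2 \<inter> C3 = {}"
    and "\<forall>u\<in>C1. \<forall>v\<in>C2. \<not> E u v" "\<forall>u\<in>C1. \<forall>v\<in>C3. \<not> E u v" "\<forall>u\<in>C2. \<forall>v\<in>C3. \<not> E u v"
  shows "\<exists>W. W \<subseteq> {x, s} \<union> C1 \<union> C2 \<union> C3 \<and> x \<in> W \<and> dAT W \<and> xAT W x"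
proof -
  obtain m1 where m1: "ipath m1" "set m1 \<subseteq> C1" "\<forall>z\<in>set m1. (E x z \<longleftrightarrow> z = hd m1) \<and> (E s z \<longleftrightarrow> z = last m1)"
    using assms(2) unfolding link_def by blast
  obtain m2 where m2: "ipath m2" "set m2 \<subseteq> C2" "\<forall>z\<in>set m2. (E x z \<longleftrightarrow> z = hd m2) \<and> (E s z \<longleftrightarrow> z = last m2)"
    using assms(3) unfolding link_def by blast
  obtain m3 where m3: "m3 \<noteq> [] \<Longrightarrow> ipath m3" "set m3 \<subseteq> C3"
    "\<forall>z\<in>set m3. (E x z \<longleftrightarrow> z = hd m3) \<and> (E s z \<longleftrightarrow> z = last m3)" "E x s \<longleftrightarrow> m3 = []"
  proof (cases "E x s")
    case True
    then show ?thesis using that[of "[]"] by simp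
  next
    case False
    then obtain m where "ipath m" "set m \<subseteq> C3" "\<forall>z\<in>set m. (E x z \<longleftrightarrow> z = hd m) \<and> (E s z \<longleftrightarrow> z = last m)"
      using assms(4) unfolding link_def by blast
    then show ?thesis using that[of m] False ipath_nonempty[of m] by auto
  qed
  have ne: "m1 \<noteq> []" "m2 \<noteq> []" using m1(1) m2(1) by auto
  have "distinct m3" using m3(1) ipath_distinct by (cases "m3 = []") auto
  moreover have "distinct m1" "distinct m2" using m1(1) m2(1) ipath_distinct by auto
  \<comment> \<open>Links are read from \<open>x\<close> to \<open>s\<close>, but
    \<open>theta_core\<close> lists its first two paths towards \<open>x\<close>; hence the
    reversals.\<close>
  ultimately have d: "distinct (x # s # rev m1 @ rev m2 @ m3)"
    using assms(1,5-9) m1(2) m2(2) m3(2) by auto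
  have "dAT ({x, s} \<union> set (rev m1) \<union> set (rev m2) \<union> set m3) \<and> xAT ({x, s} \<union> set (rev m1) \<union> set (rev m2) \<union> set m3) x"
    by (rule theta_core)
      (use d ne m1 m2 m3 ipath_rev assms(10-12) in \<open>auto simp: last_rev hd_rev subset_iff\<close>)
  moreover have "{x, s} \<union> set (rev m1) \<union> set (rev m2) \<union> set m3 \<subseteq> {x, s} \<union> C1 \<union> C2 \<union> C3"
    using m1(2) m2(2) m3(2) by auto
  ultimately show ?thesis by blast
qed

text \<open>An induced cycle, not a triangle, with a distinguished vertex. It has
  \<open>length l + 1\<close> vertices, so odd \<open>length l\<close> means an even cycle.\<close>

definition cyc :: "'a \<Rightarrow> 'a list \<Rightarrow> bool" where
  "cyc a l \<longleftrightarrow> ipath l \<and> a \<notin> set l \<and> 3 \<le> length l \<and> (\<forall>z\<in>set l. E a z \<longleftrightarrow> z = hd l \<or> z = last l)"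

text \<open>Directed around, the cycle has two Eulerian subgraphs, the empty one and itself, and
  both are even. As 2 is not odd, the weights have to be computed. The closing arc is a path of its
  own because the lists of a path system have distinct entries.\<close>

lemma even_cycle_dAT:
  assumes "cyc a l" "odd (length l)"
  shows "dAT (insert a (set l))"
proof -
  obtain m w where l: "l = m @ [w]" using assms by (cases l rule: rev_cases) (auto simp: cyc_def)
  have m: "m \<noteq> []" using assms l by (auto simp: cyc_def)
  have ip: "ipath l" using assms by (simp add: cyc_def)
  have ea: "\<forall>z\<in>set l. E a z \<longleftrightarrow> z = hd m \<or> z = w" using assms m by (auto simp: cyc_def l)
  let ?W = "insert a (set l)" and ?ps = "[a # m @ [w], [w, a]]"
  have d: "distinct (a # m @ [w])" using assms ipath_distinct[of l] by (auto simp: cyc_def l)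
  have ps: "path_system ?ps" using d m by auto
  have suc: "\<forall>p\<in>set ?ps. successively E p"
    using ipath_successively[OF ip] ea m by (auto simp: l successively_Cons E_comm)
  have aux: "(a, v) \<in> \<Union>(edges_of ` set ?ps)" if "E a v" "v \<in> ?W" for v
    using that ea E_irrefl m by (auto simp: edges_of_Cons)
  have cov: "(u, v) \<in> \<Union>(edges_of ` set ?ps)" if uv: "E u v" "u \<in> ?W" "v \<in> ?W" for u v
  proof -
    consider "u \<in> set l" "v \<in> set l" | "u = a" | "v = a" using uv by auto
    then show ?thesis
    proof cases
      case 1
      then have "(u, v) \<in> edges_of l" using ipath_edges[OF ip] uv(1) by blast
      then show ?thesis using m unfolding l by (auto simp: edges_of_Cons)
    next
      case 2
      then show ?thesis using aux uv by blast
    next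
      case 3
      then show ?thesis using aux[of u] uv E_comm[of u v] edges_of_sym[of u v] by blast
    qed
  qed
  have "length m > 0" "even (length m)" using assms(2) m by (auto simp: l)
  then have "map path_type ?ps = map (\<lambda>(i, j, s). ([a, w] ! i, [a, w] ! j, s)) [(0, 1, -1), (1, 0, -1)]"
    by (simp add: path_type_def)
  moreover have "index_count [(0, 1, -1), (1, 0, -1)] (replicate (length [a, w]) 0) \<noteq> 0" by simp
  moreover have "distinct [a, w]" using d by auto
  ultimately have nz: "path_count (map path_type ?ps) (\<lambda>_. 0) \<noteq> 0"
    using path_count_zero[of "[a, w]" "[(0, 1, -1), (1, 0, -1)]"] by simp
  have W: "?W = \<Union>(set ` set ?ps)" by (auto simp: l)
  have into: "\<forall>v\<in>?W. \<exists>p\<in>set ?ps. v \<in> set (tl p)" by (auto simp: l)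
  show ?thesis by (rule path_system_AT(1)[OF ps suc W all_arcs_cover[OF cov] into nz])
qed

section \<open>Subdivided \<open>K_4\<close>: a triangle with three legs to \<open>x\<close>\<close>

text \<open>
  Each leg is listed from its triangle vertex to its unique neighbour of \<open>x\<close>; requiring
  \<open>ipath (l @ [x])\<close> makes the last vertex of \<open>l\<close> the only one adjacent to \<open>x\<close>.
\<close>

definition trilegs :: "'a \<Rightarrow> 'a list \<Rightarrow> 'a list \<Rightarrow> 'a list \<Rightarrow> bool" where
  "trilegs x l1 l2 l3 \<longleftrightarrow> l1 \<noteq> [] \<and> l2 \<noteq> [] \<and> l3 \<noteq> [] \<and>
     ipath (l1 @ [x]) \<and> ipath (l2 @ [x]) \<and> ipath (l3 @ [x]) \<and>
     set l1 \<inter> set l2 = {} \<and> set l1 \<inter> set l3 = {} \<and> set l2 \<inter> set l3 = {} \<and>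
     (\<forall>u\<in>set l1. \<forall>v\<in>set l2. E u v \<longleftrightarrow> u = hd l1 \<and> v = hd l2) \<and>
     (\<forall>u\<in>set l1. \<forall>v\<in>set l3. E u v \<longleftrightarrow> u = hd l1 \<and> v = hd l3) \<and>
     (\<forall>u\<in>set l2. \<forall>v\<in>set l3. E u v \<longleftrightarrow> u = hd l2 \<and> v = hd l3)"

lemma trilegs_swap12:
  assumes "trilegs x l1 l2 l3"
  shows "trilegs x l2 l1 l3"
proof -
  have "E u v \<longleftrightarrow> u = hd l2 \<and> v = hd l1" if "u \<in> set l2" "v \<in> set l1" for u v
    using assms that unfolding trilegs_def E_comm[of u v] by auto
  then show ?thesis using assms unfolding trilegs_def by (simp add: Int_commute)
qed

lemma trilegs_swap23:
  assumes "trilegs x l1 l2 l3"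
  shows "trilegs x l1 l3 l2"
proof -
  have "E u v \<longleftrightarrow> u = hd l3 \<and> v = hd l2" if "u \<in> set l3" "v \<in> set l2" for u v
    using assms that unfolding trilegs_def E_comm[of u v] by auto
  then show ?thesis using assms unfolding trilegs_def by (simp add: Int_commute)
qed

lemma trilegs_edges:
  assumes "trilegs x l1 l2 l3" "E u v" "u \<in> {x} \<union> set l1 \<union> set l2 \<union> set l3" "v \<in> {x} \<union> set l1 \<union> set l2 \<union> set l3"
  shows "(u, v) \<in> edges_of (l1 @ [x]) \<union> edges_of (l2 @ [x]) \<union> edges_of (l3 @ [x]) \<union>
    edges_of [hd l1, hd l2] \<union> edges_of [hd l2, hd l3] \<union> edges_of [hd l3, hd l1]"
proof -
  have t: "(u, v) \<in> edges_of [a, b] \<longleftrightarrow> (u = a \<and> v = b) \<or> (u = b \<and> v = a)" for u v a b :: 'a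
    by (auto simp: edges_of_def)
  have h: "u \<in> set l1 \<Longrightarrow> v \<in> set l2 \<Longrightarrow> E u v \<Longrightarrow> u = hd l1 \<and> v = hd l2"
    "u \<in> set l1 \<Longrightarrow> v \<in> set l3 \<Longrightarrow> E u v \<Longrightarrow> u = hd l1 \<and> v = hd l3"
    "u \<in> set l2 \<Longrightarrow> v \<in> set l3 \<Longrightarrow> E u v \<Longrightarrow> u = hd l2 \<and> v = hd l3" for u v
    using assms(1) by (simp_all add: trilegs_def)
  consider (1) "u \<in> set (l1 @ [x])" "v \<in> set (l1 @ [x])" | (2) "u \<in> set (l2 @ [x])" "v \<in> set (l2 @ [x])"
    | (3) "u \<in> set (l3 @ [x])" "v \<in> set (l3 @ [x])"
    | (4) "u \<in> set l1 \<and> v \<in> set l2 \<or> u \<in> set l2 \<and> v \<in> set l1"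
    | (5) "u \<in> set l1 \<and> v \<in> set l3 \<or> u \<in> set l3 \<and> v \<in> set l1"
    | (6) "u \<in> set l2 \<and> v \<in> set l3 \<or> u \<in> set l3 \<and> v \<in> set l2"
    using assms(3,4) by auto
  then show ?thesis
  proof cases
    case 1 then show ?thesis using ipath_edges[of "l1 @ [x]" u v] assms by (simp add: trilegs_def)
  next
    case 2 then show ?thesis using ipath_edges[of "l2 @ [x]" u v] assms by (simp add: trilegs_def)
  next
    case 3 then show ?thesis using ipath_edges[of "l3 @ [x]" u v] assms by (simp add: trilegs_def)
  next
    case 4 then show ?thesis using h(1)[of u v] h(1)[of v u] assms(2) E_comm[of u v] by (auto simp: t)
  next
    case 5 then show ?thesis using h(2)[of u v] h(2)[of v u] assms(2) E_comm[of u v] by (auto simp: t)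
  next
    case 6 then show ?thesis using h(3)[of u v] h(3)[of v u] assms(2) E_comm[of u v] by (auto simp: t)
  qed
qed

lemma trilegs_obtain:
  assumes "trilegs x l1 l2 l3"
  obtains v1 t1 v2 t2 v3 t3 where "l1 = v1 # t1" "l2 = v2 # t2" "l3 = v3 # t3"
    "distinct (x # v1 # v2 # v3 # t1 @ t2 @ t3)"
    "successively E (v1 # t1 @ [x])" "successively E (v2 # t2 @ [x])" "successively E (x # rev t3 @ [v3])"
    "E v1 v2" "E v2 v3" "E v3 v1"
proof -
  obtain v1 t1 v2 t2 v3 t3 where l: "l1 = v1 # t1" "l2 = v2 # t2" "l3 = v3 # t3"
    using assms unfolding trilegs_def by (metis neq_Nil_conv)
  have ip: "ipath (v1 # t1 @ [x])" "ipath (v2 # t2 @ [x])" "ipath (v3 # t3 @ [x])"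
    using assms by (simp_all add: trilegs_def l)
  have "distinct (x # v1 # v2 # v3 # t1 @ t2 @ t3)"
    using assms ip[THEN ipath_distinct] by (auto simp: trilegs_def l)
  moreover have "E v1 v2" "E v2 v3" "E v3 v1" using assms by (auto simp: trilegs_def l E_comm)
  moreover have "successively E (rev (v3 # t3 @ [x]))" using ipath_rev[OF ip(3)] ipath_successively by blast
  ultimately show ?thesis using that[of v1 t1 v2 t2 v3 t3] l ip[THEN ipath_successively] by simp
qed

text \<open>Legs 1 and 2 are directed into \<open>x\<close>, leg 3 out of \<open>x\<close>, and the
  triangle cyclically. Of the four Eulerian subgraphs the empty one and the triangle cancel; the two
  cycles through \<open>x\<close> contribute \<open>s3 * (s2 - s1)\<close>, where
  \<open>s1, s2, s3\<close> are the signs of the legs. This vanishes exactly when legs 1 and 2 have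
  the same parity.\<close>

lemma trilegs_parity:
  assumes "trilegs x l1 l2 l3" "odd (length l1) \<noteq> odd (length l2)"
  shows "xAT ({x} \<union> set l1 \<union> set l2 \<union> set l3) x"
proof -
  obtain v1 t1 v2 t2 v3 t3 where l: "l1 = v1 # t1" "l2 = v2 # t2" "l3 = v3 # t3"
    and d: "distinct (x # v1 # v2 # v3 # t1 @ t2 @ t3)"
    and sc: "successively E (v1 # t1 @ [x])" "successively E (v2 # t2 @ [x])" "successively E (x # rev t3 @ [v3])"
    and e: "E v1 v2" "E v2 v3" "E v3 v1"
    by (rule trilegs_obtain[OF assms(1)]) blast
  let ?W = "{x} \<union> set l1 \<union> set l2 \<union> set l3"
  let ?ps = "[v1 # t1 @ [x], v2 # t2 @ [x], x # rev t3 @ [v3], [v3, v1], [v1, v2], [v2, v3]]"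
  have ps: "path_system ?ps" using d
    by (simp add: doubleton_eq_iff Int_Un_distrib Int_Un_distrib2 Int_commute disjoint_iff) blast
  have suc: "\<forall>p\<in>set ?ps. successively E p" using sc e by auto
  have r3: "edges_of (x # rev t3 @ [v3]) = edges_of (v3 # t3 @ [x])"
    using edges_of_rev[of "v3 # t3 @ [x]"] by simp
  have cov: "(u, v) \<in> \<Union>(edges_of ` set ?ps)" if "E u v" "u \<in> ?W" "v \<in> ?W" for u v
    using trilegs_edges[OF assms(1) that] r3 by (auto simp: l)
  let ?ts = "\<lambda>s1 s2 s3 :: int. [(1, 0, s1), (2, 0, s2), (0, 3, s3), (3, 1, -1), (1, 2, -1), (2, 3, -1)]"
  have idx: "index_count (?ts s1 s2 s3) (replicate 4 0) \<noteq> 0"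
    if "s1 = 1 \<and> s2 = -1 \<or> s1 = -1 \<and> s2 = 1" "s3 = 1 \<or> s3 = -1" for s1 s2 s3
  proof -
    have "\<forall>s1\<in>{1, -1}. \<forall>s3\<in>{1, -1}. index_count (?ts s1 (- s1) s3) (replicate 4 0) \<noteq> 0"
      by code_simp
    moreover have "s2 = - s1" "s1 \<in> {1, -1}" "s3 \<in> {1, -1}" using that by auto
    ultimately show ?thesis by blast
  qed
  let ?vs = "[x, v1, v2, v3]"
  define s where "s l = (-1::int) ^ length l" for l :: "'a list"
  have "map path_type ?ps = map (\<lambda>(i, j, s). (?vs ! i, ?vs ! j, s)) (?ts (s l1) (s l2) (s l3))"
    by (simp add: path_type_def s_def l)
  moreover have "index_count (?ts (s l1) (s l2) (s l3)) (replicate 4 0) \<noteq> 0"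
    by (rule idx) (use assms(2) in \<open>cases "even (length l1)"; cases "even (length l3)"; auto simp: s_def\<close>)+
  moreover have "path_count (map (\<lambda>(i, j, s). (?vs ! i, ?vs ! j, s)) (?ts (s l1) (s l2) (s l3))) (\<lambda>_. 0) =
      index_count (?ts (s l1) (s l2) (s l3)) (replicate (length ?vs) 0)"
    by (rule path_count_zero) (use d in auto)
  moreover have "length ?vs = 4" by simp
  ultimately have nz: "path_count (map path_type ?ps) (\<lambda>_. 0) \<noteq> 0" by metis
  have W: "?W = \<Union>(set ` set ?ps)" by (auto simp: l)
  have into: "\<forall>v\<in>?W. \<exists>p\<in>set ?ps. v \<in> set (tl p)" by (auto simp: l)
  have neq: "v1 # t1 @ [x] \<noteq> v2 # t2 @ [x]" using d by auto
  show ?thesis by (rule path_system_AT(2)[OF ps suc W all_arcs_cover[OF cov] into nz _ _ neq]) simp_all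
qed

text \<open>
  With the legs 1 and 2 directed into \<open>x\<close>, leg 3 out of \<open>x\<close> and \<open>y\<close> placed between \<open>v\<^sub>3\<close> and \<open>v\<^sub>1, v\<^sub>2\<close>, there
  are seven spanning Eulerian subgraphs. The same number occurs in \<open>trilegs_ear\<close>, where one of the
  two routes between \<open>a\<close> and \<open>b\<close> is directed backwards. An odd number suffices, whatever the signs.
\<close>

lemma trilegs_apex:
  assumes "trilegs x l1 l2 l3" "y \<notin> {x} \<union> set l1 \<union> set l2 \<union> set l3"
    and "\<forall>z\<in>{x} \<union> set l1 \<union> set l2 \<union> set l3. E y z \<longleftrightarrow> z = hd l1 \<or> z = hd l2 \<or> z = hd l3"
  shows "xAT (insert y ({x} \<union> set l1 \<union> set l2 \<union> set l3)) x"
proof -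
  obtain v1 t1 v2 t2 v3 t3 where l: "l1 = v1 # t1" "l2 = v2 # t2" "l3 = v3 # t3"
    and d: "distinct (x # v1 # v2 # v3 # t1 @ t2 @ t3)"
    and sc: "successively E (v1 # t1 @ [x])" "successively E (v2 # t2 @ [x])" "successively E (x # rev t3 @ [v3])"
    and e: "E v1 v2" "E v2 v3" "E v3 v1"
    by (rule trilegs_obtain[OF assms(1)]) blast
  let ?V = "{x} \<union> set l1 \<union> set l2 \<union> set l3" let ?W = "insert y ?V"
  let ?ps = "[v1 # t1 @ [x], v2 # t2 @ [x], x # rev t3 @ [v3], [v3, y], [y, v1], [y, v2], [v3, v1], [v3, v2], [v1, v2]]"
  have yd: "distinct (y # x # v1 # v2 # v3 # t1 @ t2 @ t3)" using d assms(2) l by auto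
  have ps: "path_system ?ps" using yd
    by (simp add: doubleton_eq_iff Int_Un_distrib Int_Un_distrib2 Int_commute disjoint_iff) blast
  have ey: "E y v1" "E y v2" "E y v3" using assms(3) l by auto
  have suc: "\<forall>p\<in>set ?ps. successively E p" using sc e ey by (auto simp: E_comm)
  have r3: "edges_of (x # rev t3 @ [v3]) = edges_of (v3 # t3 @ [x])"
    using edges_of_rev[of "v3 # t3 @ [x]"] by simp
  have ee: "edges_of [a, b] = {(a, b), (b, a)}" for a b :: 'a by (auto simp: edges_of_def)
  have aux: "(y, v) \<in> \<Union>(edges_of ` set ?ps)" if "E y v" "v \<in> ?W" for v
  proof -
    have "v \<noteq> y" using that(1) E_irrefl by blast
    then have "v = hd l1 \<or> v = hd l2 \<or> v = hd l3" using assms(3) that by blast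
    then show ?thesis by (auto simp: ee l)
  qed
  have cov: "(u, v) \<in> \<Union>(edges_of ` set ?ps)" if uv: "E u v" "u \<in> ?W" "v \<in> ?W" for u v
  proof -
    consider "u \<in> ?V" "v \<in> ?V" | "u = y" | "v = y" using uv by blast
    then show ?thesis
    proof cases
      case 1
      then show ?thesis using trilegs_edges[OF assms(1) uv(1)] r3 by (auto simp: l ee)
    next
      case 2 then show ?thesis using aux uv by blast
    next
      case 3 then show ?thesis using aux[of u] uv E_comm[of u v] edges_of_sym[of u v] by blast
    qed
  qed
  have nz: "path_count (map path_type ?ps) (\<lambda>_. 0) \<noteq> 0"
    by (rule odd_path_count[where n = 5 and vs = "[x, v1, v2, v3, y]" and
        ix = "[(1, 0), (2, 0), (0, 3), (3, 4), (4, 1), (4, 2), (3, 1), (3, 2), (1, 2)]"])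
      ((use yd in auto)[1], simp, simp, code_simp, simp)
  have W: "?W = \<Union>(set ` set ?ps)" by (auto simp: l)
  have into: "\<forall>v\<in>?W. \<exists>p\<in>set ?ps. v \<in> set (tl p)" by (auto simp: l)
  have neq: "v1 # t1 @ [x] \<noteq> v2 # t2 @ [x]" using d by auto
  show ?thesis by (rule path_system_AT(2)[OF ps suc W all_arcs_cover[OF cov] into nz _ _ neq]) simp_all
qed

lemma trilegs_ear:
  assumes tl: "trilegs x l1 l2 l3" and l1: "l1 = pre @ a # mid @ b # post"
    and Y: "ipath Y" "set Y \<inter> ({x} \<union> set l1 \<union> set l2 \<union> set l3) = {}"
    and att: "\<forall>y\<in>set Y. \<forall>z\<in>{x} \<union> set l1 \<union> set l2 \<union> set l3. E y z \<longleftrightarrow> y = hd Y \<and> z = a \<or> y = last Y \<and> z = b"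
  shows "xAT (set Y \<union> ({x} \<union> set l1 \<union> set l2 \<union> set l3)) x"
proof -
  obtain v1 t1 v2 t2 v3 t3 where l: "l1 = v1 # t1" "l2 = v2 # t2" "l3 = v3 # t3"
    and d: "distinct (x # v1 # v2 # v3 # t1 @ t2 @ t3)"
    and sc: "successively E (v1 # t1 @ [x])" "successively E (v2 # t2 @ [x])" "successively E (x # rev t3 @ [v3])"
    and e: "E v1 v2" "E v2 v3" "E v3 v1"
    by (rule trilegs_obtain[OF tl]) blast
  let ?V = "{x} \<union> set l1 \<union> set l2 \<union> set l3" let ?W = "set Y \<union> ?V"
  have Yne: "Y \<noteq> []" using Y(1) by auto
  have d1: "distinct (x # l1 @ v2 # v3 # t2 @ t3)" using d by (auto simp: l)
  have D: "distinct (x # v2 # v3 # t2 @ t3 @ pre @ a # mid @ b # post @ Y)"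
    using d1 Y(2) ipath_distinct[OF Y(1)] unfolding l1 l(2,3)
    by (simp add: Int_Un_distrib Int_Un_distrib2 Int_commute disjoint_iff) blast
  have ra: "E (hd Y) a" "E (last Y) b" using att Yne by (auto simp: l1)
  have sl: "successively E (pre @ a # mid @ b # post @ [x])" 
  proof -
    have "pre @ a # mid @ b # post @ [x] = l1 @ [x]" by (simp add: l1)
    also have "\<dots> = v1 # t1 @ [x]" by (simp add: l)
    finally show ?thesis using sc(1) by (simp only:)
  qed
  have s: "successively E (a # mid @ [b])" "successively E (b # post @ [x])" "successively E (pre @ [a])"
    using sl by (auto simp: successively_append_iff successively_Cons hd_append split: if_splits)
  have sY: "successively E (b # rev Y @ [a])"
    using ipath_successively[OF ipath_rev[OF Y(1)]] ra Yne
    by (auto simp: successively_append_iff successively_Cons hd_rev last_rev E_comm)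
  have r3: "edges_of (x # rev t3 @ [v3]) = edges_of (v3 # t3 @ [x])"
    using edges_of_rev[of "v3 # t3 @ [x]"] by simp
  have rY: "edges_of (b # rev Y @ [a]) = edges_of (a # Y @ [b])"
    using edges_of_rev[of "a # Y @ [b]"] by simp
  have ee: "edges_of [u, v] = {(u, v), (v, u)}" for u v :: 'a by (auto simp: edges_of_def)
  have split1: "edges_of (l1 @ [x]) = edges_of (pre @ [a]) \<union> edges_of (a # mid @ [b]) \<union> edges_of (b # post @ [x])"
  proof -
    have "edges_of (l1 @ [x]) = edges_of (pre @ [a]) \<union> edges_of ((a # mid) @ b # post @ [x])"
      unfolding l1 using edges_of_split[of pre a "mid @ b # post @ [x]"] by simp
    also have "edges_of ((a # mid) @ b # post @ [x]) = edges_of (a # mid @ [b]) \<union> edges_of (b # post @ [x])"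
      using edges_of_split[of "a # mid" b "post @ [x]"] by simp
    finally show ?thesis by blast
  qed
  let ?rs = "[a # mid @ [b], b # rev Y @ [a], b # post @ [x], v2 # t2 @ [x], x # rev t3 @ [v3], [v3, v1], [v1, v2], [v2, v3]]"
  \<comment> \<open>If \<open>pre\<close> is empty, \<open>a\<close> is the triangle vertex itself;
    the path from that vertex to \<open>a\<close> would have no arc and is left out.\<close>
  let ?ps = "if pre = [] then ?rs else (pre @ [a]) # ?rs"
  have sub0: "set ?rs \<subseteq> set ?ps" by auto
  have insub: "edges_of (pre @ [a]) \<subseteq> \<Union>(edges_of ` set ?ps)" by auto
  have aux: "(u, v) \<in> \<Union>(edges_of ` set ?ps)" if uv: "E u v" "u \<in> set Y" "v \<in> ?W" for u v
  proof -
    have "(u, v) \<in> edges_of (a # Y @ [b])"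
    proof (cases "v \<in> set Y")
      case True
      then show ?thesis using ipath_edges[OF Y(1) uv(2)] uv(1) Yne
        by (auto simp: edges_of_Cons edges_of_append)
    next
      case False
      then have "u = hd Y \<and> v = a \<or> u = last Y \<and> v = b" using att uv by blast
      then show ?thesis using Yne by (auto simp: edges_of_Cons edges_of_append)
    qed
    then show ?thesis using rY sub0 by auto
  qed
  have cov: "(u, v) \<in> \<Union>(edges_of ` set ?ps)" if uv: "E u v" "u \<in> ?W" "v \<in> ?W" for u v
  proof -
    consider "u \<in> ?V" "v \<in> ?V" | "u \<in> set Y" | "v \<in> set Y" using uv by blast
    then show ?thesis
    proof cases
      case 1
      have "(u, v) \<in> edges_of (pre @ [a]) \<union> \<Union>(edges_of ` set ?rs)"
        using trilegs_edges[OF tl uv(1) 1] r3 unfolding split1 by (auto simp: l ee)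
      then show ?thesis using insub sub0 by blast
    next
      case 2 then show ?thesis using aux uv by blast
    next
      case 3 then show ?thesis using aux[of v u] uv E_comm[of u v] edges_of_sym[of u v] by blast
    qed
  qed
  have W: "?W = \<Union>(set ` set ?ps)"
  proof -
    have h: "v1 \<in> set (pre @ [a])" using l(1) l1 by (cases pre) auto
    then show ?thesis by (auto simp: l1 l(2,3))
  qed
  show ?thesis
  proof (cases "pre = []")
    case True
    have v1: "v1 = a" using l(1) l1 True by simp
    let ?qs = "[a # mid @ [b], b # rev Y @ [a], b # post @ [x], v2 # t2 @ [x], x # rev t3 @ [v3], [v3, a], [a, v2], [v2, v3]]"
    have pseq: "?ps = ?qs" using True v1 by simp
    have ps: "path_system ?qs" using D Yne unfolding True
      by (simp add: doubleton_eq_iff Int_Un_distrib Int_Un_distrib2 Int_commute disjoint_iff) blast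
    have suc: "\<forall>p\<in>set ?qs. successively E p" using s sY sc e v1 by auto
    have nz: "path_count (map path_type ?qs) (\<lambda>_. 0) \<noteq> 0"
      by (rule odd_path_count[where n = 5 and vs = "[x, v2, v3, a, b]" and
          ix = "[(3, 4), (4, 3), (4, 0), (1, 0), (0, 2), (2, 3), (3, 1), (1, 2)]"])
        ((use D in auto)[1], simp, simp, code_simp, simp)
    have into: "\<forall>v\<in>?W. \<exists>p\<in>set ?qs. v \<in> set (tl p)" using True by (auto simp: l1 l(2,3))
    have neq: "b # post @ [x] \<noteq> v2 # t2 @ [x]" using D by auto
    show ?thesis
      by (rule path_system_AT(2)[OF ps suc W[unfolded pseq] all_arcs_cover[OF cov[unfolded pseq]] into nz _ _ neq])
        simp_all
  next
    case False
    then obtain pre' where pre: "pre = v1 # pre'" using l(1) l1 by (cases pre) auto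
    let ?qs = "[v1 # pre' @ [a], a # mid @ [b], b # rev Y @ [a], b # post @ [x], v2 # t2 @ [x], x # rev t3 @ [v3], [v3, v1], [v1, v2], [v2, v3]]"
    have pseq: "?ps = ?qs" using pre by simp
    have ps: "path_system ?qs" using D Yne unfolding pre
      by (simp add: doubleton_eq_iff Int_Un_distrib Int_Un_distrib2 Int_commute disjoint_iff) blast
    have suc: "\<forall>p\<in>set ?qs. successively E p" using s sY sc e pre by auto
    have nz: "path_count (map path_type ?qs) (\<lambda>_. 0) \<noteq> 0"
      by (rule odd_path_count[where n = 6 and vs = "[x, v2, v3, a, b, v1]" and
          ix = "[(5, 3), (3, 4), (4, 3), (4, 0), (1, 0), (0, 2), (2, 5), (5, 1), (1, 2)]"])
        ((use D pre in auto)[1], simp, simp, code_simp, simp)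
    have into: "\<forall>v\<in>?W. \<exists>p\<in>set ?qs. v \<in> set (tl p)" by (auto simp: l1 l(2,3) pre)
    have neq: "b # post @ [x] \<noteq> v2 # t2 @ [x]" using D by auto
    show ?thesis
      by (rule path_system_AT(2)[OF ps suc W[unfolded pseq] all_arcs_cover[OF cov[unfolded pseq]] into nz _ _ neq])
        simp_all
  qed
qed

end

section \<open>Degree-AT graphs and degree-sized lists\<close>

context sgraph
begin

text \<open>
  The path \<open>Y\<close> is a shortest one, in the graph without the first attachment point, from the vertices
  attached only there to the rest of \<open>M \<union> X\<close>. For \<open>X = {x}\<close> the three cases are the ways in which a
  2-connected graph can extend \<open>M \<union> {x}\<close>.
\<close>

lemma attachment:
  assumes cut: "\<forall>a\<in>M. conn (U - {a})" and sub: "M \<subseteq> U" "X \<subseteq> U" "M \<inter> X = {}"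
    and y0: "y0 \<in> U - X - M" "a0 \<in> M" "E y0 a0" and ne: "(M - {a0}) \<union> X \<noteq> {}"
  shows "(\<exists>y\<in>U - X - M. \<exists>a\<in>M. \<exists>b\<in>M. a \<noteq> b \<and> E y a \<and> E y b) \<or>
    (\<exists>Y. \<exists>a\<in>M. ipath Y \<and> set Y \<subseteq> U - X - M \<and> (\<forall>y\<in>set Y. \<forall>z\<in>M. E y z \<longleftrightarrow> y = hd Y \<and> z = a) \<and>
       (\<forall>y\<in>set Y. (\<exists>c\<in>X. E y c) \<longleftrightarrow> y = last Y)) \<or>
    (\<exists>Y. \<exists>a\<in>M. \<exists>b\<in>M. a \<noteq> b \<and> ipath Y \<and> set Y \<subseteq> U - X - M \<and>
       (\<forall>y\<in>set Y. \<forall>z\<in>M. E y z \<longleftrightarrow> y = hd Y \<and> z = a \<or> y = last Y \<and> z = b) \<and>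
       (\<forall>y\<in>set Y. \<forall>c\<in>X. \<not> E y c))"
    (is "?one \<or> ?two \<or> ?three")
proof (rule ccontr)
  assume n: "\<not> ?thesis"
  have uniq: "a = b" if "y \<in> U - X - M" "a \<in> M" "b \<in> M" "E y a" "E y b" for y a b
    using n that by blast
  have single: "False" if "w \<in> U - X - M" "f \<in> M" "E w f" "c \<in> X" "E w c" for w f c
  proof -
    have ?two by (intro exI[of _ "[w]"] bexI[of _ f]) (use that uniq[of w] in auto)
    then show False using n by blast
  qed
  let ?A = "{y \<in> U - X - M. E y a0}" and ?B = "(M - {a0}) \<union> X"
  have "\<exists>p. ipath p \<and> set p \<subseteq> U - {a0} \<and> 2 \<le> length p \<and> hd p \<in> ?A \<and> last p \<in> ?B \<and>
    set (tl p) \<inter> ?A = {} \<and> set (butlast p) \<inter> ?B = {} \<and>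
    (\<forall>v\<in>set (butlast (butlast p)). \<forall>b\<in>?B. \<not> E v b) \<and> (\<forall>v\<in>set (tl (tl p)). \<forall>a\<in>?A. \<not> E a v)"
    by (rule shortest_path) (use cut sub y0 ne in auto)
  then obtain p where p: "ipath p" "set p \<subseteq> U - {a0}" "2 \<le> length p" "hd p \<in> ?A" "last p \<in> ?B"
    "set (tl p) \<inter> ?A = {}" "set (butlast p) \<inter> ?B = {}"
    "\<forall>v\<in>set (butlast (butlast p)). \<forall>b\<in>?B. \<not> E v b" by blast
  define Y where "Y = butlast p"
  define b where "b = last p"
  have Yne: "Y \<noteq> []" using p(3) by (cases p; cases "tl p") (auto simp: Y_def)
  have pY: "p = Y @ [b]" using p(3) by (cases p rule: rev_cases) (auto simp: Y_def b_def)
  have ipY: "ipath Y" and Eb: "E (last Y) b" using p(1) Yne unfolding pY by (auto simp: ipath_append)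
  have YR: "set Y \<subseteq> U - X - M" using p(2,7) by (auto simp: pY)
  have hdY: "hd Y \<in> ?A" using p(4) Yne by (simp add: pY)
  have onlyhd: "y = hd Y" if "y \<in> set Y" "E y a0" for y
  proof (rule ccontr)
    assume "y \<noteq> hd Y"
    then have "y \<in> set (tl p)" using that Yne by (cases Y) (auto simp: pY)
    then show False using p(6) that YR by auto
  qed
  have onlylast: "y = last Y" if "y \<in> set Y" "z \<in> ?B" "E y z" for y z
  proof (rule ccontr)
    assume "y \<noteq> last Y"
    then have "y \<in> set (butlast Y)" using that Yne by (metis append_butlast_last_id in_set_conv_decomp rotate1.simps(2) set_ConsD set_rotate1)
    then show False using p(8) that unfolding pY by auto
  qed
  have lY: "last Y \<in> U - X - M" using YR Yne last_in_set by blast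
  have last_nbr: "last Y \<in> set Y" using Yne by simp
  show False
  proof (cases "b \<in> X")
    case True
    have nf: "\<not> E (last Y) f" if "f \<in> M" "f \<noteq> a0" for f using single[OF lY that(1) _ True Eb] by blast
    have "?two"
    proof (intro exI[of _ Y] bexI[of _ a0] conjI)
      show "\<forall>y\<in>set Y. \<forall>z\<in>M. E y z \<longleftrightarrow> y = hd Y \<and> z = a0"
        using onlyhd onlylast nf hdY by blast
      show "\<forall>y\<in>set Y. (\<exists>c\<in>X. E y c) \<longleftrightarrow> y = last Y" using onlylast True Eb by blast
    qed (use ipY YR y0 in auto)
    then show False using n by blast
  next
    case False
    then have b: "b \<in> M" "b \<noteq> a0" using p(5) by (auto simp: b_def)
    have "?three"
    proof (rule exI[of _ Y], rule bexI[of _ a0], rule bexI[of _ b], intro conjI)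
      show "\<forall>y\<in>set Y. \<forall>c\<in>X. \<not> E y c" using onlylast single[OF lY b(1) Eb] by blast
      have "E y z \<longleftrightarrow> y = hd Y \<and> z = a0 \<or> y = last Y \<and> z = b" if "y \<in> set Y" "z \<in> M" for y z
      proof
        assume "E y z"
        then show "y = hd Y \<and> z = a0 \<or> y = last Y \<and> z = b"
          using that onlyhd[of y] onlylast[of y z] uniq[OF lY b(1) _ Eb, of z] by (cases "z = a0") auto
      qed (use hdY Eb in auto)
      then show "\<forall>y\<in>set Y. \<forall>z\<in>M. E y z \<longleftrightarrow> y = hd Y \<and> z = a0 \<or> y = last Y \<and> z = b" by blast
    qed (use ipY YR y0 b in auto)
    then show False using n by blast
  qed
qed

text \<open>With \<open>X\<close> empty there is no path ending at \<open>X\<close>, so only the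
  other two cases remain. A second vertex of \<open>M\<close> now has to serve as the target of the
  shortest path.\<close>

lemma attachment_plain:
  assumes cut: "\<forall>a\<in>M. conn (U - {a})" and con: "conn U" and M: "M \<subseteq> U" "M \<noteq> U" "\<forall>a. M \<noteq> {a}" "M \<noteq> {}"
  shows "(\<exists>y\<in>U - M. \<exists>a\<in>M. \<exists>b\<in>M. a \<noteq> b \<and> E y a \<and> E y b) \<or>
    (\<exists>Y. \<exists>a\<in>M. \<exists>b\<in>M. a \<noteq> b \<and> ipath Y \<and> set Y \<subseteq> U - M \<and>
       (\<forall>y\<in>set Y. \<forall>z\<in>M. E y z \<longleftrightarrow> y = hd Y \<and> z = a \<or> y = last Y \<and> z = b))"
proof -
  obtain a0 y0 where y0: "a0 \<in> M" "y0 \<in> U - M" "E a0 y0"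
    using con M unfolding conn_def by meson
  have "(M - {a0}) \<union> {} \<noteq> {}" using M(3,4) by blast
  moreover have "y0 \<in> U - {} - M" using y0(2) by simp
  ultimately have att: "(\<exists>y\<in>U - {} - M. \<exists>a\<in>M. \<exists>b\<in>M. a \<noteq> b \<and> E y a \<and> E y b) \<or>
    (\<exists>Y. \<exists>a\<in>M. ipath Y \<and> set Y \<subseteq> U - {} - M \<and> (\<forall>y\<in>set Y. \<forall>z\<in>M. E y z \<longleftrightarrow> y = hd Y \<and> z = a) \<and>
       (\<forall>y\<in>set Y. (\<exists>c\<in>{}. E y c) \<longleftrightarrow> y = last Y)) \<or>
    (\<exists>Y. \<exists>a\<in>M. \<exists>b\<in>M. a \<noteq> b \<and> ipath Y \<and> set Y \<subseteq> U - {} - M \<and>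
       (\<forall>y\<in>set Y. \<forall>z\<in>M. E y z \<longleftrightarrow> y = hd Y \<and> z = a \<or> y = last Y \<and> z = b) \<and>
       (\<forall>y\<in>set Y. \<forall>c\<in>{}. \<not> E y c))" (is "?one \<or> ?two \<or> ?three")
    using attachment[OF cut M(1) empty_subsetI Int_empty_right _ y0(1) E_sym[OF y0(3)]] by blast
  have "\<not> ?two" using ipath_nonempty last_in_set by (metis (no_types, lifting) empty_iff)
  then have "?one \<or> ?three" using att by blast
  then show ?thesis unfolding Diff_empty by (elim disjE) auto
qed

lemma attachment_plainE:
  assumes "\<forall>a\<in>M. conn (U - {a})" "conn U" "M \<subseteq> U" "M \<noteq> U" "\<forall>a. M \<noteq> {a}" "M \<noteq> {}"
  obtains (vertex) y a b where "y \<in> U - M" "a \<in> M" "b \<in> M" "a \<noteq> b" "E y a" "E y b"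
  | (path) Y a b where "a \<in> M" "b \<in> M" "a \<noteq> b" "ipath Y" "set Y \<subseteq> U - M"
      "\<forall>y\<in>set Y. \<forall>z\<in>M. E y z \<longleftrightarrow> y = hd Y \<and> z = a \<or> y = last Y \<and> z = b"
  using attachment_plain[OF assms] by blast

lemma conn_nbr: "conn U \<Longrightarrow> v \<in> U \<Longrightarrow> U \<noteq> {v} \<Longrightarrow> \<exists>b\<in>U. b \<noteq> v \<and> E v b"
proof -
  assume U: "conn U" "v \<in> U" "U \<noteq> {v}"
  then have "{v} \<subseteq> U" "{v} \<noteq> U" by auto
  then have "\<exists>a\<in>{v}. \<exists>b\<in>U - {v}. E a b" using U(1) unfolding conn_def by blast
  then show ?thesis by blast
qed

section \<open>Attachments to induced paths and cycles\<close>

text \<open>Let \<open>c\<close> be the second neighbour of \<open>y\<close> along the path. The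
  edge from \<open>y\<close> to \<open>c\<close> and the two routes through the pieces of the path
  before and after \<open>c\<close> form a theta; the pieces are not adjacent because the path is
  induced.\<close>

lemma fan:
  assumes "ipath l" "y \<notin> set l" "3 \<le> card {z \<in> set l. E y z}"
  shows "\<exists>W. W \<subseteq> insert y (set l) \<and> W \<noteq> {} \<and> dAT W"
proof -
  have "{z \<in> set l. E y z} \<noteq> {}" using assms(3) by (metis card.empty not_numeral_le_zero)
  then have "\<exists>z\<in>set l. E y z" by blast
  from split_list_first_prop[OF this] obtain p1 a r where l: "l = p1 @ a # r" "E y a" "\<forall>z\<in>set p1. \<not> E y z"
    by blast
  have d: "distinct l" using ipath_distinct[OF assms(1)] .
  have "{z \<in> set l. E y z} = insert a {z \<in> set r. E y z}" using l by auto
  then have r: "2 \<le> card {z \<in> set r. E y z}" using assms(3) by (simp add: card_insert_if split: if_splits)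
  then have "{z \<in> set r. E y z} \<noteq> {}" by (metis card.empty not_numeral_le_zero)
  then have "\<exists>z\<in>set r. E y z" by blast
  from split_list_first_prop[OF this] obtain p2 c r2 where r2: "r = p2 @ c # r2" "E y c" "\<forall>z\<in>set p2. \<not> E y z"
    by blast
  have "{z \<in> set r. E y z} = insert c {z \<in> set r2. E y z}" using r2 by auto
  then have "{z \<in> set r2. E y z} \<noteq> {}" using r by (metis One_nat_def Suc_1 card.empty card_insert_disjoint finite.emptyI empty_iff not_less_eq_eq le_refl)
  then obtain e where e: "e \<in> set r2" "E y e" by blast
  let ?q = "p1 @ a # p2"
  have ll: "l = ?q @ c # r2" using l(1) r2(1) by simp
  have ip: "ipath ?q" "ipath (c # r2)" "\<forall>u\<in>set ?q. \<forall>v\<in>set (c # r2). E u v \<longleftrightarrow> u = last ?q \<and> v = c"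
    "set ?q \<inter> set (c # r2) = {}"
    using assms(1) unfolding ll by (subst (asm) ipath_append; simp)+
  have ne: "r2 \<noteq> []" using e by auto
  have ip2: "ipath r2" "c \<notin> set r2" "\<forall>v\<in>set r2. E c v \<longleftrightarrow> v = hd r2" using ip(2) ne by (auto simp: ipath_Cons)
  have "\<exists>W. W \<subseteq> {y, c} \<union> set ?q \<union> set r2 \<union> {} \<and> y \<in> W \<and> dAT W \<and> xAT W y"
  proof (rule theta)
    show "y \<noteq> c" using r2(2) E_irrefl by blast
    have "last ?q \<in> set ?q" by (rule last_in_set) simp
    moreover have "E (last ?q) c" using ip(3) calculation by simp
    moreover from this have "E c (last ?q)" by (rule E_sym)
    ultimately show "link (set ?q) y c"
      using linkI[OF ipath_conn[OF ip(1)] subset_refl, of a y "last ?q" c] l(2) by auto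
    show "link (set r2) y c"
      using linkI[OF ipath_conn[OF ip2(1)] subset_refl, of e y "hd r2" c] e ne ip2(3) by auto
    show "E y c \<or> link {} y c" using r2(2) by blast
    show "\<forall>u\<in>set ?q. \<forall>v\<in>set r2. \<not> E u v" using ip(3) ip2(2) by auto
    show "y \<notin> set ?q \<union> set r2 \<union> {}" using assms(2) ll by auto
    show "c \<notin> set ?q \<union> set r2 \<union> {}" using ip(4) ip2(2) by auto
    show "set ?q \<inter> set r2 = {}" using ip(4) by auto
  qed auto
  then show ?thesis unfolding ll by auto
qed

text \<open>Any vertex of the cycle can be the distinguished one. The cases of the proof are that
  \<open>b\<close> is the last, the first or an inner vertex of \<open>l\<close>.\<close>

lemma cyc_rotate:
  assumes "cyc a l" "b \<in> set l"
  shows "\<exists>l'. cyc b l' \<and> insert b (set l') = insert a (set l) \<and> length l' = length l"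
proof -
  obtain p q where l: "l = p @ b # q" using split_list[OF assms(2)] by blast
  have c: "ipath l" "a \<notin> set l" "3 \<le> length l" "\<forall>z\<in>set l. E a z \<longleftrightarrow> z = hd l \<or> z = last l"
    using assms(1) by (auto simp: cyc_def)
  have d: "distinct l" using ipath_distinct[OF c(1)] .
  have hl: "p \<noteq> [] \<Longrightarrow> hd p \<in> set p" "q \<noteq> [] \<Longrightarrow> last q \<in> set q" "p \<noteq> [] \<Longrightarrow> last p \<in> set p"
    "q \<noteq> [] \<Longrightarrow> hd q \<in> set q" by auto
  have dpq: "set p \<inter> set q = {}" "b \<notin> set p" "b \<notin> set q" using d by (auto simp: l)
  have "cyc b (q @ a # p)"
  proof (cases "q = []")
    case True
    then have p: "p \<noteq> []" using c(3) l by auto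
    have "ipath p" "\<forall>u\<in>set p. E u b \<longleftrightarrow> u = last p" "b \<notin> set p"
      using c(1) p True by (auto simp: l ipath_append)
    moreover have "\<forall>z\<in>set p. E a z \<longleftrightarrow> z = hd p" "E a b"
      using c(4) p True d by (auto simp: l)
    ultimately show ?thesis using True p c(2,3) hl by (auto simp: cyc_def l ipath_Cons E_comm)
  next
    case q: False
    have bq: "ipath q" "\<forall>u\<in>set q. E b u \<longleftrightarrow> u = hd q" "b \<notin> set q"
      using c(1) q ipath_appendD[of p "b # q"] by (auto simp: l ipath_Cons)
    have "hd l \<notin> set q" using hl(1) dpq by (cases "p = []") (auto simp: l disjoint_iff)
    then have aq: "\<forall>z\<in>set q. E a z \<longleftrightarrow> z = last q" using c(4) q by (auto simp: l)
    show ?thesis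
    proof (cases "p = []")
      case True
      have "E a b" using c(4) True by (auto simp: l)
      then have "ipath (q @ [a])" using bq aq q c(2) by (auto simp: l ipath_append E_comm)
      then show ?thesis using True q bq c(2,3) \<open>E a b\<close> hl by (auto simp: cyc_def l E_comm)
    next
      case False
      have bp: "ipath p" "\<forall>u\<in>set p. \<forall>v\<in>set (b # q). E u v \<longleftrightarrow> u = last p \<and> v = b"
        "set p \<inter> set (b # q) = {}"
        using c(1) False by (auto simp: l ipath_append)
      have "hd l = hd p" "last l = last q" using False q by (auto simp: l)
      then have ap: "\<forall>z\<in>set p. E a z \<longleftrightarrow> z = hd p" and "\<not> E a b"
        using c(4) hl(1,2) False q dpq by (auto simp: l)
      have "ipath (a # p)" using bp(1) ap c(2) False by (auto simp: l ipath_Cons)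
      moreover have "E u v \<longleftrightarrow> u = last q \<and> v = a" if "u \<in> set q" "v \<in> set (a # p)" for u v
      proof (cases "v = a")
        case True
        then show ?thesis using aq that E_comm[of u a] by auto
      next
        case nv: False
        then have "v \<in> set p" using that by auto
        then have "\<not> E v u" using bp(2,3) bq(3) that(1) by (metis list.set_intros(2))
        then show ?thesis using nv E_sym by blast
      qed
      ultimately have "ipath (q @ a # p)" using bq(1) q bp(3) c(2) by (auto simp: l ipath_append)
      moreover have "E b z \<longleftrightarrow> z = hd q \<or> z = last p" if z: "z \<in> set (q @ a # p)" for z
      proof -
        consider "z \<in> set q" | "z = a" | "z \<in> set p" using z by auto
        then show ?thesis
        proof cases
          case 1 then show ?thesis using bq(2) bp(3) hl False by (auto simp: disjoint_iff)
        next
          case 2 then show ?thesis using \<open>\<not> E a b\<close> E_comm[of a b] c(2) hl q False by (auto simp: l)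
        next
          case 3 then show ?thesis using bp(2,3) hl q E_comm[of b z] by (auto simp: disjoint_iff)
        qed
      qed
      moreover have "b \<notin> set (q @ a # p)" using c(2) bq(3) bp(3) by (auto simp: l)
      ultimately show ?thesis using c(3) False q by (simp add: cyc_def l)
    qed
  qed
  then show ?thesis by (intro exI[of _ "q @ a # p"]) (auto simp: l)
qed

text \<open>A theta with branch vertices \<open>a\<close> and \<open>b\<close>: its routes are the
  ear and the two sides of the cycle, one of which may be a single edge.\<close>

lemma cyc_ear:
  assumes "cyc a l" "b \<in> set l" "conn Y" "Y \<inter> insert a (set l) = {}" "\<exists>y\<in>Y. E y a" "\<exists>y\<in>Y. E y b"
    and "\<forall>y\<in>Y. \<forall>z\<in>set l - {b}. \<not> E y z"
  shows "\<exists>W. W \<subseteq> Y \<union> insert a (set l) \<and> W \<noteq> {} \<and> dAT W"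
proof -
  obtain p q where l: "l = p @ b # q" using split_list[OF assms(2)] by blast
  have c: "ipath l" "a \<notin> set l" "3 \<le> length l" "\<forall>z\<in>set l. E a z \<longleftrightarrow> z = hd l \<or> z = last l"
    using assms(1) by (auto simp: cyc_def)
  have d: "distinct l" using ipath_distinct[OF c(1)] .
  have lk: "link Y a b" using linkI[OF assms(3) subset_refl] assms(5,6) E_sym by blast
  have lp: "link (set p) a b" if p: "p \<noteq> []"
  proof -
    have "ipath p" "E (last p) b" using c(1) p by (auto simp: l ipath_append)
    moreover have "E a (hd p)" using c(4) p by (auto simp: l)
    ultimately show ?thesis using linkI[OF ipath_conn subset_refl, of p "hd p" a "last p" b] p E_sym by auto
  qed
  have lq: "link (set q) a b" if q: "q \<noteq> []"
  proof -
    have "ipath q" "E b (hd q)" using c(1) q ipath_appendD[of p "b # q"] by (auto simp: l ipath_Cons)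
    moreover have "E a (last q)" using c(4) q by (auto simp: l)
    ultimately show ?thesis using linkI[OF ipath_conn subset_refl, of q "last q" a "hd q" b] q by auto
  qed
  have npq: "\<forall>u\<in>set p. \<forall>v\<in>set q. \<not> E u v"
  proof (cases "p = []")
    case False
    then have "\<forall>u\<in>set p. \<forall>v\<in>set (b # q). E u v \<longleftrightarrow> u = last p \<and> v = b" using c(1) by (auto simp: l ipath_append)
    then show ?thesis using d unfolding l by (metis distinct.simps(2) distinct_append list.set_intros(2))
  qed simp
  have nY: "\<forall>y\<in>Y. \<forall>v\<in>set p. \<not> E y v" "\<forall>y\<in>Y. \<forall>v\<in>set q. \<not> E y v" "a \<notin> Y" "b \<notin> Y" "Y \<inter> set p = {}" "Y \<inter> set q = {}"
    using assms(4,7) d by (auto simp: l)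
  have dd: "a \<noteq> b" "a \<notin> set p" "a \<notin> set q" "b \<notin> set p" "b \<notin> set q" "set p \<inter> set q = {}"
    using c(2) d by (auto simp: l)
  have ab: "E a b" if "p = [] \<or> q = []" using c(4) that by (auto simp: l)
  have "\<exists>W. W \<subseteq> {a, b} \<union> Y \<union> set p \<union> set q \<and> a \<in> W \<and> dAT W \<and> xAT W a"
  proof (cases "p = []")
    case False
    show ?thesis
      by (rule theta) (use lk lp[OF False] lq ab nY dd npq in auto)
  next
    case True
    then have "q \<noteq> []" using c(3) by (auto simp: l)
    have "\<exists>W. W \<subseteq> {a, b} \<union> Y \<union> set q \<union> {} \<and> a \<in> W \<and> dAT W \<and> xAT W a"
      by (rule theta) (use lk lq[OF \<open>q \<noteq> []\<close>] ab True nY dd in auto)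
    then show ?thesis by blast
  qed
  then show ?thesis unfolding l by auto
qed

section \<open>Bad lists for complete graphs and odd cycles, and splitting at cut vertices\<close>

lemma bad_complete:
  assumes "finite U" "U \<noteq> {}" "\<forall>u\<in>U. \<forall>v\<in>U. u \<noteq> v \<longrightarrow> E u v"
  shows "bad U (\<lambda>_. card U - 1)"
  unfolding bad_def
proof (intro exI[of _ "\<lambda>_. {..<card U - 1}"] conjI notI)
  assume "\<exists>\<phi>. (\<forall>v\<in>U. \<phi> v \<in> {..<card U - 1}) \<and> (\<forall>u\<in>U. \<forall>v\<in>U. E u v \<longrightarrow> \<phi> u \<noteq> \<phi> v)"
  then obtain \<phi> where \<phi>: "\<forall>v\<in>U. \<phi> v \<in> {..<card U - 1}" "\<forall>u\<in>U. \<forall>v\<in>U. E u v \<longrightarrow> \<phi> u \<noteq> \<phi> v" by blast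
  have "inj_on \<phi> U" using \<phi>(2) assms(3) by (auto simp: inj_on_def)
  then have "card U \<le> card {..<card U - 1}" using \<phi>(1) by (intro card_inj_on_le[of \<phi>]) auto
  then show False using assms(1,2) by (cases "card U") auto
qed auto

lemma alternate:
  assumes "successively E p" "p \<noteq> []" "\<forall>v\<in>set p. \<phi> v \<in> {0, 1::nat}" "\<forall>u\<in>set p. \<forall>v\<in>set p. E u v \<longrightarrow> \<phi> u \<noteq> \<phi> v"
  shows "\<phi> (last p) = (if odd (length p) then \<phi> (hd p) else 1 - \<phi> (hd p))"
  using assms
proof (induction p)
  case (Cons a p)
  show ?case
  proof (cases "p = []")
    case False
    have "\<phi> (last p) = (if odd (length p) then \<phi> (hd p) else 1 - \<phi> (hd p))"
      by (rule Cons.IH) (use Cons.prems False in \<open>auto simp: successively_Cons\<close>)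
    moreover have "E a (hd p)" using Cons.prems False by (auto simp: successively_Cons)
    then have "\<phi> a \<noteq> \<phi> (hd p)" using Cons.prems(4) False by auto
    moreover have "\<phi> a \<in> {0, 1}" "\<phi> (hd p) \<in> {0, 1}" using Cons.prems(3) False by auto
    ultimately show ?thesis using False by auto
  qed simp
qed simp

lemma bad_odd_cycle:
  assumes "cyc a l" "even (length l)"
  shows "bad (insert a (set l)) (\<lambda>_. 2)"
  unfolding bad_def
proof (intro exI[of _ "\<lambda>_. {0, 1}"] conjI notI)
  assume "\<exists>\<phi>. (\<forall>v\<in>insert a (set l). \<phi> v \<in> {0, 1::nat}) \<and> (\<forall>u\<in>insert a (set l). \<forall>v\<in>insert a (set l). E u v \<longrightarrow> \<phi> u \<noteq> \<phi> v)"
  then obtain \<phi> where \<phi>: "\<forall>v\<in>insert a (set l). \<phi> v \<in> {0, 1::nat}" "\<forall>u\<in>insert a (set l). \<forall>v\<in>insert a (set l). E u v \<longrightarrow> \<phi> u \<noteq> \<phi> v" by blast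
  have l: "l \<noteq> []" "ipath l" using assms(1) by (auto simp: cyc_def)
  then have l: "l \<noteq> []" "ipath l" "E a (hd l)" "E a (last l)"
    using assms(1) hd_in_set[of l] last_in_set[of l] by (auto simp: cyc_def)
  have "\<phi> (last l) = 1 - \<phi> (hd l)"
    using alternate[OF ipath_successively[OF l(2)] l(1), of \<phi>] \<phi> assms(2) by auto
  moreover have "\<phi> a \<noteq> \<phi> (hd l)" "\<phi> a \<noteq> \<phi> (last l)" using \<phi>(2) l by auto
  moreover have "\<phi> a \<in> {0, 1}" "\<phi> (hd l) \<in> {0, 1}" using \<phi>(1) l(1) by auto
  ultimately show False by auto
qed auto

lemma cyc_degree:
  assumes "cyc a l" "v \<in> insert a (set l)"
  shows "dg (insert a (set l)) v \<le> 2"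
proof -
  obtain l' where l': "cyc v l'" "insert v (set l') = insert a (set l)"
    using cyc_rotate[OF assms(1)] assms by (cases "v = a") auto
  have "{u \<in> insert v (set l'). E v u} \<subseteq> {hd l', last l'}" using l'(1) E_irrefl by (auto simp: cyc_def)
  then have "card {u \<in> insert v (set l'). E v u} \<le> card {hd l', last l'}" by (intro card_mono) auto
  also have "\<dots> \<le> 2" by (simp add: card_insert_if)
  finally show ?thesis by (simp add: dg_def l'(2))
qed

lemma dg_le: "finite U \<Longrightarrow> v \<in> U \<Longrightarrow> dg U v \<le> card U - 1"
proof -
  assume U: "finite U" "v \<in> U"
  have "dg U v \<le> card (U - {v})" unfolding dg_def by (rule card_mono) (use U E_irrefl in auto)
  then show ?thesis using U by simp
qed

lemma cut_split:
  assumes "conn U" "v \<in> U" "U \<noteq> {v}" "\<not> conn (U - {v})"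
  obtains U1 U2 where "U1 \<union> U2 = U" "U1 \<inter> U2 = {v}" "conn U1" "conn U2" "U1 \<noteq> U" "U2 \<noteq> U"
    "\<forall>u\<in>U1 - {v}. \<forall>w\<in>U2 - {v}. \<not> E u w"
proof -
  have "U - {v} \<noteq> {}" using assms by auto
  then obtain A where A: "A \<subseteq> U - {v}" "A \<noteq> {}" "A \<noteq> U - {v}" "\<forall>a\<in>A. \<forall>b\<in>U - {v} - A. \<not> E a b"
    using assms(4) unfolding conn_def by blast
  let ?B = "U - {v} - A"
  have "conn (insert v A)" by (rule conn_lobe[OF assms(1,2) A(1)]) (use A(4) in auto)
  moreover have "conn (insert v ?B)" by (rule conn_lobe[OF assms(1,2)]) (use A(1,4) E_sym in \<open>auto, blast\<close>)
  moreover have "insert v A \<union> insert v ?B = U" "insert v A \<inter> insert v ?B = {v}"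
    "insert v A \<noteq> U" "insert v ?B \<noteq> U" "\<forall>u\<in>insert v A - {v}. \<forall>w\<in>insert v ?B - {v}. \<not> E u w"
    using A assms(2) by auto
  ultimately show ?thesis using that by blast
qed

lemma dg_split:
  assumes "finite U" "U1 \<union> U2 = U" "U1 \<inter> U2 = {v}" "\<forall>u\<in>U1 - {v}. \<forall>w\<in>U2 - {v}. \<not> E u w"
  shows "dg U v = dg U1 v + dg U2 v" "u \<in> U1 \<Longrightarrow> u \<noteq> v \<Longrightarrow> dg U u = dg U1 u" "u \<in> U2 \<Longrightarrow> u \<noteq> v \<Longrightarrow> dg U u = dg U2 u"
proof -
  have fin: "finite U1" "finite U2" using assms by auto
  have "{u \<in> U. E v u} = {u \<in> U1. E v u} \<union> {u \<in> U2. E v u}" using assms(2) by auto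
  moreover have "{u \<in> U1. E v u} \<inter> {u \<in> U2. E v u} = {}" using assms(3) E_irrefl[of v] by auto
  ultimately show "dg U v = dg U1 v + dg U2 v" using fin by (simp add: dg_def card_Un_disjoint)
  show "dg U u = dg U1 u" if "u \<in> U1" "u \<noteq> v"
    unfolding dg_def by (rule arg_cong[where f = card]) (use that assms(2-4) in blast)
  show "dg U u = dg U2 u" if "u \<in> U2" "u \<noteq> v"
    unfolding dg_def by (rule arg_cong[where f = card]) (use that assms(2-4) E_sym in blast)
qed

text \<open>Something must attach to a largest clique \<open>M\<close> that is not everything. Two
  vertices \<open>a\<close>, \<open>b\<close> of \<open>M\<close> are joined by their edge, through
  a third clique vertex \<open>c\<close>, and through the attachment. This is a theta if the
  attachment avoids \<open>c\<close>, and a single vertex that avoids no \<open>c\<close> would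
  enlarge the clique.\<close>

lemma triangle_dAT_or_complete:
  assumes fin: "finite U" and con: "conn U" and cut: "\<forall>v\<in>U. conn (U - {v})"
    and tri: "\<exists>a\<in>U. \<exists>b\<in>U. \<exists>c\<in>U. E a b \<and> E b c \<and> E a c"
  shows "dAT U \<or> (\<forall>u\<in>U. \<forall>v\<in>U. u \<noteq> v \<longrightarrow> E u v)"
proof -
  define Q where "Q M \<longleftrightarrow> M \<subseteq> U \<and> (\<forall>u\<in>M. \<forall>v\<in>M. u \<noteq> v \<longrightarrow> E u v)" for M
  obtain a b c where abc: "a \<in> U" "b \<in> U" "c \<in> U" "E a b" "E b c" "E a c" using tri by blast
  then have Q3: "Q {a, b, c}" by (auto simp: Q_def E_comm)
  have "\<forall>M. Q M \<longrightarrow> card M < Suc (card U)" using fin by (auto simp: Q_def less_Suc_eq_le card_mono)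
  then obtain M where M: "Q M" "\<And>M'. Q M' \<Longrightarrow> card M' \<le> card M"
    using ex_has_greatest_nat[of Q "{a, b, c}" card "Suc (card U)"] Q3 by blast
  have "card {a, b, c} = 3" using abc E_irrefl by (auto simp: card_insert_if)
  then have cM: "3 \<le> card M" using M(2)[OF Q3] by simp
  have MU: "M \<subseteq> U" "finite M" using M(1) fin by (auto simp: Q_def intro: finite_subset)
  have third: "\<exists>c\<in>M. c \<noteq> a \<and> c \<noteq> b" for a b
  proof (rule ccontr)
    assume "\<not> ?thesis"
    then have "M \<subseteq> {a, b}" by auto
    then have "card M \<le> card {a, b}" by (intro card_mono) auto
    also have "\<dots> \<le> 2" by (simp add: card_insert_if)
    finally show False using cM by simp
  qed
  show ?thesis
  proof (cases "M = U")
    case True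
    then show ?thesis using M(1) by (auto simp: Q_def)
  next
    case False
    have th: "dAT U" if "a \<in> M" "b \<in> M" "c \<in> M" "a \<noteq> b" "c \<noteq> a" "c \<noteq> b" "conn Y" "Y \<subseteq> U - M"
      "\<exists>y\<in>Y. E y a" "\<exists>y\<in>Y. E y b" "\<forall>y\<in>Y. \<not> E y c" for a b c Y
    proof -
      have e: "E a b" "E a c" "E b c" using M(1) that(1-6) by (auto simp: Q_def)
      have "\<exists>W. W \<subseteq> {a, b} \<union> Y \<union> {c} \<union> {} \<and> a \<in> W \<and> dAT W \<and> xAT W a"
      proof (rule theta)
        show "link Y a b" using linkI[OF that(7) subset_refl] that(9,10) E_sym by blast
        show "link {c} a b" using linkI[OF conn_singleton subset_refl] e by blast
      qed (use that e E_sym in auto)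
      then obtain W where "W \<subseteq> {a, b} \<union> Y \<union> {c}" "a \<in> W" "dAT W" by auto
      then show ?thesis using dAT_extend[OF fin con, of W] that MU by auto
    qed
    have "\<forall>a\<in>M. conn (U - {a})" "M \<noteq> {}" "\<forall>a. M \<noteq> {a}" using cut MU third by blast+
    from attachment_plain[OF this(1) con MU(1) False this(3,2)] consider
      (1) y a b where "y \<in> U - M" "a \<in> M" "b \<in> M" "a \<noteq> b" "E y a" "E y b" |
      (2) Y a b where "a \<in> M" "b \<in> M" "a \<noteq> b" "ipath Y" "set Y \<subseteq> U - M"
        "\<forall>y\<in>set Y. \<forall>z\<in>M. E y z \<longleftrightarrow> y = hd Y \<and> z = a \<or> y = last Y \<and> z = b"
      by blast
    then show ?thesis
    proof cases
      case 1
      have "\<exists>c\<in>M. \<not> E y c"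
      proof (rule ccontr)
        assume n: "\<not> ?thesis"
        then have "Q (insert y M)" using M(1) 1(1) E_sym by (auto simp: Q_def)
        then have "card (insert y M) \<le> card M" using M(2) by blast
        then show False using 1(1) MU(2) by simp
      qed
      then obtain c where c: "c \<in> M" "\<not> E y c" by blast
      have "dAT U" by (rule th[of a b c "{y}"]) (use 1 c in auto)
      then show ?thesis ..
    next
      case 2
      obtain c where c: "c \<in> M" "c \<noteq> a" "c \<noteq> b" using third by blast
      have "hd Y \<in> set Y" "last Y \<in> set Y" using ipath_nonempty[OF 2(4)] by auto
      then have "dAT U" using th[of a b c "set Y"] 2 c ipath_conn[OF 2(4)] by blast
      then show ?thesis ..
    qed
  qed
qed

text \<open>In the absence of triangles, a vertex and a shortest path between two of its neighbours
  form an induced cycle of length at least 4. An even cycle is good, an odd cycle that is the whole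
  graph has bad lists, and otherwise an attachment to the cycle creates a theta.\<close>

lemma degree_two_connected:
  assumes fin: "finite U" and con: "conn U" and cut: "\<forall>v\<in>U. conn (U - {v})"
  shows "dAT U \<or> bad U (dg U)"
proof (cases "\<forall>u\<in>U. \<forall>v\<in>U. u \<noteq> v \<longrightarrow> E u v")
  case True
  have "bad U (\<lambda>_. card U - 1)" by (rule bad_complete) (use fin con conn_nonempty True in auto)
  then show ?thesis using bad_mono[of U _ "dg U"] dg_le[OF fin] by blast
next
  case nc: False
  show ?thesis
  proof (cases "\<exists>a\<in>U. \<exists>b\<in>U. \<exists>c\<in>U. E a b \<and> E b c \<and> E a c")
    case True
    then show ?thesis using triangle_dAT_or_complete[OF fin con cut] nc by blast
  next
    case tf: False
    obtain v v' where v: "v \<in> U" "v' \<in> U" "v \<noteq> v'" "\<not> E v v'" using nc by blast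
    obtain u where u: "u \<in> U" "u \<noteq> v" "E v u" using conn_nbr[OF con v(1)] v by blast
    have "conn (U - {u})" "v \<in> U - {u}" "U - {u} \<noteq> {v}" using cut v u by auto
    then obtain w where w: "w \<in> U" "w \<noteq> u" "w \<noteq> v" "E v w" using conn_nbr by blast
    let ?B = "{z \<in> U - {u}. E v z}"
    have "\<exists>p. ipath p \<and> set p \<subseteq> U - {v} \<and> 2 \<le> length p \<and> hd p \<in> {u} \<and> last p \<in> ?B \<and>
      set (tl p) \<inter> {u} = {} \<and> set (butlast p) \<inter> ?B = {} \<and>
      (\<forall>v\<in>set (butlast (butlast p)). \<forall>b\<in>?B. \<not> E v b) \<and> (\<forall>v\<in>set (tl (tl p)). \<forall>a\<in>{u}. \<not> E a v)"
      by (rule shortest_path) (use cut v u w E_irrefl in auto)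
    then obtain p where p: "ipath p" "set p \<subseteq> U - {v}" "2 \<le> length p" "hd p = u" "last p \<in> ?B"
      "set (tl p) \<inter> {u} = {}" "set (butlast p) \<inter> ?B = {}" by blast
    have pne: "p \<noteq> []" using p by auto
    have ev: "E v z \<longleftrightarrow> z = hd p \<or> z = last p" if z: "z \<in> set p" for z
    proof -
      have "z = last p \<or> z \<in> set (butlast p)" using z pne
        by (metis Un_iff append_butlast_last_id empty_iff empty_set insert_iff list.simps(15) set_append)
      then show ?thesis using p(2,4,5,7) u z by auto
    qed
    have "length p \<noteq> 2"
    proof
      assume "length p = 2"
      then obtain s t where st: "p = [s, t]" by (cases p; cases "tl p") auto
      then have "E s t" "E v s" "E v t" "s \<in> U" "t \<in> U" using p(1,2) ev by auto
      then show False using tf v(1) by blast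
    qed
    then have cy: "cyc v p" using p ev by (auto simp: cyc_def)
    let ?M = "insert v (set p)"
    have MU: "?M \<subseteq> U" using p v by auto
    have ext: "dAT U" if "\<exists>W. W \<subseteq> U \<and> W \<noteq> {} \<and> dAT W" using that dAT_extend[OF fin con] by blast
    show ?thesis
    proof (cases "odd (length p)")
      case True
      then show ?thesis using ext even_cycle_dAT[OF cy] MU by blast
    next
      case ev: False
      show ?thesis
      proof (cases "?M = U")
        case True
        have "bad U (\<lambda>_. 2)" using bad_odd_cycle[OF cy] ev True by simp
        then have "bad U (dg U)" by (rule bad_mono) (use cyc_degree[OF cy] True in auto)
        then show ?thesis ..
      next
        case False
        have Mc: "\<forall>a\<in>?M. conn (U - {a})" using cut MU by blast
        have two: "\<forall>a. ?M \<noteq> {a}" using pne cy hd_in_set[of p] unfolding cyc_def by (metis insertI1 insertI2 singletonD)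
        show ?thesis
        proof (rule attachment_plainE[OF Mc con MU False two insert_not_empty])
          fix y a b assume 1: "y \<in> U - ?M" "a \<in> ?M" "b \<in> ?M" "a \<noteq> b" "E y a" "E y b"
          obtain l where l: "cyc a l" "insert a (set l) = ?M"
            using cyc_rotate[OF cy, of a] cy 1(2) by (cases "a = v") auto
          have bl: "b \<in> set l" using 1(3,4) l(2) by auto
          show ?thesis
          proof (cases "\<exists>c\<in>?M. c \<noteq> a \<and> c \<noteq> b \<and> E y c")
            case False
            have "a \<notin> set l" using l(1) by (simp add: cyc_def)
            then have "\<forall>z\<in>set l - {b}. \<not> E y z" using False unfolding l(2)[symmetric] by auto
            moreover have "y \<notin> insert a (set l)" using 1(1) l(2) by blast
            ultimately have "\<exists>W. W \<subseteq> {y} \<union> insert a (set l) \<and> W \<noteq> {} \<and> dAT W"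
              by (intro cyc_ear[OF l(1) bl]) (use 1(5,6) in auto)
            then obtain W where W: "W \<subseteq> {y} \<union> ?M" "W \<noteq> {}" "dAT W" unfolding l(2) by blast
            have "W \<subseteq> U" using W(1) 1(1) MU by auto
            then show ?thesis using ext W by blast
          next
            case True
            then obtain c where c: "c \<in> ?M" "c \<noteq> a" "c \<noteq> b" "E y c" by blast
            have hl: "hd l \<in> set l" using l(1) ipath_nonempty[of l] by (auto simp: cyc_def)
            then have hl: "hd l \<in> set l" "E a (hd l)" using l(1) by (auto simp: cyc_def)
            \<comment> \<open>As \<open>y\<close> is adjacent to \<open>a\<close> and there are no
              triangles, \<open>y\<close> misses the neighbour \<open>hd l\<close> of
              \<open>a\<close> on the cycle. Opening the cycle at \<open>hd l\<close> leaves an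
              induced path that carries all cycle neighbours of \<open>y\<close>, as
              \<open>fan\<close> requires.\<close>
            have ny: "\<not> E y (hd l)" using tf hl 1 l(2) MU by blast
            obtain l' where l': "cyc (hd l) l'" "insert (hd l) (set l') = ?M"
              using cyc_rotate[OF l(1) hl(1)] l(2) by auto
            have "z \<in> set l'" if "z \<in> ?M" "E y z" for z
              using that ny unfolding l'(2)[symmetric] by auto
            then have "{a, b, c} \<subseteq> {z \<in> set l'. E y z}" using 1 c by blast
            then have "card {a, b, c} \<le> card {z \<in> set l'. E y z}" by (intro card_mono) auto
            then have "3 \<le> card {z \<in> set l'. E y z}" using 1(4) c by simp
            then have "\<exists>W. W \<subseteq> insert y (set l') \<and> W \<noteq> {} \<and> dAT W"
              using fan[of l' y] l'(1) 1(1) unfolding l'(2)[symmetric] by (auto simp: cyc_def)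
            then obtain W where W: "W \<subseteq> insert y (set l')" "W \<noteq> {}" "dAT W" by blast
            have "set l' \<subseteq> ?M" unfolding l'(2)[symmetric] by blast
            then have "W \<subseteq> U" using W(1) 1(1) MU by auto
            then show ?thesis using ext W by blast
          qed
        next
          fix Y a b assume 2: "a \<in> ?M" "b \<in> ?M" "a \<noteq> b" "ipath Y" "set Y \<subseteq> U - ?M"
            "\<forall>y\<in>set Y. \<forall>z\<in>?M. E y z \<longleftrightarrow> y = hd Y \<and> z = a \<or> y = last Y \<and> z = b"
          obtain l where l: "cyc a l" "insert a (set l) = ?M"
            using cyc_rotate[OF cy, of a] cy 2(1) by (cases "a = v") auto
          have bl: "b \<in> set l" using 2(2,3) l(2) by auto
          have hY: "hd Y \<in> set Y" "last Y \<in> set Y" using ipath_nonempty[OF 2(4)] by auto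
          have al: "a \<notin> set l" using l(1) by (simp add: cyc_def)
          have "\<exists>W. W \<subseteq> set Y \<union> insert a (set l) \<and> W \<noteq> {} \<and> dAT W"
          proof (rule cyc_ear[OF l(1) bl ipath_conn[OF 2(4)]])
            show "\<forall>y\<in>set Y. \<forall>z\<in>set l - {b}. \<not> E y z" using 2(6) al unfolding l(2)[symmetric] by auto
            show "set Y \<inter> insert a (set l) = {}" unfolding l(2) using 2(5) by blast
            show "\<exists>y\<in>set Y. E y a" "\<exists>y\<in>set Y. E y b" using 2(1,2,6) hY by blast+
          qed
          then obtain W where W: "W \<subseteq> set Y \<union> ?M" "W \<noteq> {}" "dAT W" unfolding l(2) by blast
          have "W \<subseteq> U" using W(1) 2(5) MU by auto
          then show ?thesis using ext W by blast
        qed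
      qed
    qed
  qed
qed

text \<open>A degree-AT lobe extends to the whole graph; otherwise both lobes have bad lists, whose
  sizes add up at the cut vertex to its degree. The exceptional graphs are the Gallai trees, whose
  blocks are complete graphs and odd cycles.\<close>

theorem degree_dichotomy:
  assumes "finite U" "conn U"
  shows "dAT U \<or> bad U (dg U)"
  using assms
proof (induction "card U" arbitrary: U rule: less_induct)
  case less
  show ?case
  proof (cases "\<forall>v\<in>U. conn (U - {v})")
    case True
    then show ?thesis using degree_two_connected less.prems by blast
  next
    case False
    then obtain v where v: "v \<in> U" "\<not> conn (U - {v})" by blast
    show ?thesis
    proof (cases "U = {v}")
      case True
      have "bad U (\<lambda>_. card U - 1)" by (rule bad_complete) (use True in auto)
      then show ?thesis using bad_mono[of U _ "dg U"] dg_le[OF less.prems(1)] by blast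
    next
      case False
      obtain U1 U2 where U: "U1 \<union> U2 = U" "U1 \<inter> U2 = {v}" "conn U1" "conn U2" "U1 \<noteq> U" "U2 \<noteq> U"
        "\<forall>u\<in>U1 - {v}. \<forall>w\<in>U2 - {v}. \<not> E u w"
        using cut_split[OF less.prems(2) v(1) False v(2)] by blast
      have lt: "card U1 < card U" "card U2 < card U" "finite U1" "finite U2"
        using U less.prems(1) by (auto intro!: psubset_card_mono)
      show ?thesis
      proof (cases "dAT U1 \<or> dAT U2")
        case True
        then show ?thesis using dAT_extend[OF less.prems] U conn_nonempty by blast
      next
        case False
        then have "bad U1 (dg U1)" "bad U2 (dg U2)" using less.hyps lt U by blast+
        from bad_merge[OF this U(2)] have
          "bad U (\<lambda>u. if u = v then dg U1 v + dg U2 v else if u \<in> U1 then dg U1 u else dg U2 u)"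
          unfolding U(1) .
        then have "bad U (dg U)"
          by (rule bad_mono) (use dg_split[OF less.prems(1) U(1,2,7)] U(1) in auto)
        then show ?thesis ..
      qed
    qed
  qed
qed

end

section \<open>Two-connected pairs\<close>

context sgraph
begin

lemma ipath_snoc: "l \<noteq> [] \<Longrightarrow> ipath (l @ [x]) \<longleftrightarrow> ipath l \<and> x \<notin> set l \<and> (\<forall>u\<in>set l. E u x \<longleftrightarrow> u = last l)"
  by (auto simp: ipath_append)

lemma trilegsI:
  assumes "ipath l1" "ipath l2" "ipath l3"
    and "x \<notin> set l1" "x \<notin> set l2" "x \<notin> set l3"
    and "\<And>u. u \<in> set l1 \<Longrightarrow> E u x \<longleftrightarrow> u = last l1" "\<And>u. u \<in> set l2 \<Longrightarrow> E u x \<longleftrightarrow> u = last l2"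
      "\<And>u. u \<in> set l3 \<Longrightarrow> E u x \<longleftrightarrow> u = last l3"
    and "set l1 \<inter> set l2 = {}" "set l1 \<inter> set l3 = {}" "set l2 \<inter> set l3 = {}"
    and "\<And>u v. u \<in> set l1 \<Longrightarrow> v \<in> set l2 \<Longrightarrow> E u v \<longleftrightarrow> u = hd l1 \<and> v = hd l2"
      "\<And>u v. u \<in> set l1 \<Longrightarrow> v \<in> set l3 \<Longrightarrow> E u v \<longleftrightarrow> u = hd l1 \<and> v = hd l3"
      "\<And>u v. u \<in> set l2 \<Longrightarrow> v \<in> set l3 \<Longrightarrow> E u v \<longleftrightarrow> u = hd l2 \<and> v = hd l3"
  shows "trilegs x l1 l2 l3"
  unfolding trilegs_def using assms ipath_nonempty by (simp add: ipath_snoc)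

lemma trilegsD:
  assumes "trilegs x l1 l2 l3"
  shows "l1 \<noteq> []" "l2 \<noteq> []" "l3 \<noteq> []" "ipath l1" "ipath l2" "ipath l3"
    "x \<notin> set l1" "x \<notin> set l2" "x \<notin> set l3"
    "\<And>u. u \<in> set l1 \<Longrightarrow> E u x \<longleftrightarrow> u = last l1" "\<And>u. u \<in> set l2 \<Longrightarrow> E u x \<longleftrightarrow> u = last l2"
    "\<And>u. u \<in> set l3 \<Longrightarrow> E u x \<longleftrightarrow> u = last l3"
    "set l1 \<inter> set l2 = {}" "set l1 \<inter> set l3 = {}" "set l2 \<inter> set l3 = {}"
    "\<And>u v. u \<in> set l1 \<Longrightarrow> v \<in> set l2 \<Longrightarrow> E u v \<longleftrightarrow> u = hd l1 \<and> v = hd l2"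
    "\<And>u v. u \<in> set l1 \<Longrightarrow> v \<in> set l3 \<Longrightarrow> E u v \<longleftrightarrow> u = hd l1 \<and> v = hd l3"
    "\<And>u v. u \<in> set l2 \<Longrightarrow> v \<in> set l3 \<Longrightarrow> E u v \<longleftrightarrow> u = hd l2 \<and> v = hd l3"
proof -
  show ne: "l1 \<noteq> []" "l2 \<noteq> []" "l3 \<noteq> []" using assms by (simp_all add: trilegs_def)
  have ip: "ipath (l1 @ [x])" "ipath (l2 @ [x])" "ipath (l3 @ [x])" using assms by (simp_all add: trilegs_def)
  show "ipath l1" "ipath l2" "ipath l3" "x \<notin> set l1" "x \<notin> set l2" "x \<notin> set l3"
    using ip ne by (simp_all add: ipath_snoc)
  show "\<And>u. u \<in> set l1 \<Longrightarrow> E u x \<longleftrightarrow> u = last l1" "\<And>u. u \<in> set l2 \<Longrightarrow> E u x \<longleftrightarrow> u = last l2"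
    "\<And>u. u \<in> set l3 \<Longrightarrow> E u x \<longleftrightarrow> u = last l3"
    using ip ne by (simp_all add: ipath_snoc)
qed (use assms in \<open>simp_all add: trilegs_def\<close>)

lemma in_split_cases:
  assumes "a \<in> set l" "b \<in> set l" "a \<noteq> b"
  obtains pre mid post where "l = pre @ a # mid @ b # post" | pre mid post where "l = pre @ b # mid @ a # post"
proof -
  obtain p q where l: "l = p @ a # q" using split_list[OF assms(1)] by blast
  then consider "b \<in> set q" | "b \<in> set p" using assms by auto
  then show ?thesis
  proof cases
    case 1
    then obtain q1 q2 where "q = q1 @ b # q2" using split_list by metis
    then show ?thesis using that(1)[of p q1 q2] l by simp
  next
    case 2
    then obtain q1 q2 where "p = q1 @ b # q2" using split_list by metis
    then show ?thesis using that(2)[of q1 q2 q] l by simp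
  qed
qed

end

section \<open>2-connected pairs without AT orientation\<close>

locale critical_pair = sgraph E for E :: "'a \<Rightarrow> 'a \<Rightarrow> bool" +
  fixes U :: "'a set" and x :: 'a
  assumes fin: "finite U" and con: "conn U" and xU: "x \<in> U" and cut: "\<forall>v\<in>U. conn (U - {v})"
    and deg3: "3 \<le> dg U x" and nAT: "\<not> xAT U x"
begin

lemma nX: "W \<subseteq> U \<Longrightarrow> x \<in> W \<Longrightarrow> \<not> xAT W x"
  using xAT_extend[OF fin con] nAT by blast

text \<open>Away from \<open>x\<close>, indegree 1 everywhere would already suffice:
  \<open>x\<close> could be added as a sink with at least three incoming arcs.\<close>

lemma nT: "W \<subseteq> U - {x} \<Longrightarrow> W \<noteq> {} \<Longrightarrow> \<not> dAT W"
  using dAT_extend[of "U - {x}" W] xAT_sink[of U x] fin cut xU deg3 nAT by auto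

lemma theta_x:
  assumes "s \<in> U" "s \<noteq> x" "link C1 x s" "link C2 x s" "E x s \<or> link C3 x s"
    and "C1 \<subseteq> U - {x}" "C2 \<subseteq> U - {x}" "C3 \<subseteq> U - {x}" "s \<notin> C1" "s \<notin> C2" "s \<notin> C3"
    and "C1 \<inter> C2 = {}" "C1 \<inter> C3 = {}" "C2 \<inter> C3 = {}"
    and "\<forall>u\<in>C1. \<forall>v\<in>C2. \<not> E u v" "\<forall>u\<in>C1. \<forall>v\<in>C3. \<not> E u v" "\<forall>u\<in>C2. \<forall>v\<in>C3. \<not> E u v"
  shows False
proof -
  have "\<exists>W. W \<subseteq> {x, s} \<union> C1 \<union> C2 \<union> C3 \<and> x \<in> W \<and> dAT W \<and> xAT W x"
    by (rule theta[OF assms(2)[symmetric] assms(3-5) _ _ assms(12-17)]) (use assms(6-11) in auto)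
  then obtain W where W: "W \<subseteq> {x, s} \<union> C1 \<union> C2 \<union> C3" "x \<in> W" "xAT W x" by blast
  have "W \<subseteq> U" using W(1) assms(1,6-8) xU by auto
  then show False using nX W by blast
qed

lemma theta_T:
  assumes "a \<in> U - {x}" "b \<in> U - {x}" "a \<noteq> b" "E a b" "link C1 a b" "link C2 a b"
    and "C1 \<subseteq> U - {x}" "C2 \<subseteq> U - {x}" "a \<notin> C1" "a \<notin> C2" "b \<notin> C1" "b \<notin> C2" "C1 \<inter> C2 = {}"
    and "\<forall>u\<in>C1. \<forall>v\<in>C2. \<not> E u v"
  shows False
proof -
  have "\<exists>W. W \<subseteq> {a, b} \<union> C1 \<union> C2 \<union> {} \<and> a \<in> W \<and> dAT W \<and> xAT W a"
    by (rule theta[OF assms(3,5,6) disjI1[OF assms(4)] _ _ assms(13) _ _ assms(14)]) (use assms(9-12) in auto)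
  then obtain W where W: "W \<subseteq> {a, b} \<union> C1 \<union> C2" "a \<in> W" "dAT W" by auto
  have "W \<subseteq> U - {x}" using W(1) assms(1,2,7,8) by auto
  then show False using nT W by blast
qed

text \<open>\<open>P\<close> is a shortest path outside \<open>x\<close> between two neighbours of
  \<open>x\<close>, and \<open>Q\<close> leads from a third neighbour to a vertex \<open>z\<close>
  next to \<open>P\<close>. If \<open>z\<close> has one neighbour on \<open>P\<close>, that
  neighbour and \<open>x\<close> are the branch vertices of a theta. If its first and last
  neighbours \<open>s1\<close>, \<open>s2\<close> are not consecutive on \<open>P\<close>, the
  branch vertices are \<open>z\<close> and \<open>x\<close>. Otherwise \<open>z\<close>,
  \<open>s1\<close>, \<open>s2\<close> form the triangle.\<close>

lemma exists_trilegs: "\<exists>l1 l2 l3. trilegs x l1 l2 l3 \<and> set l1 \<union> set l2 \<union> set l3 \<subseteq> U - {x}"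
proof -
  let ?T = "U - {x}"
  define N where "N = {z \<in> U. E x z}"
  have cT: "conn ?T" using cut xU by blast
  have NT: "N \<subseteq> ?T" using E_irrefl by (auto simp: N_def)
  have cN: "3 \<le> card N" using deg3 by (simp add: dg_def N_def)
  have fN: "finite N" using fin by (simp add: N_def)
  have third: "\<exists>c\<in>N. c \<noteq> a \<and> c \<noteq> b" for a b
  proof (rule ccontr)
    assume "\<not> ?thesis"
    then have "N \<subseteq> {a, b}" by auto
    then have "card N \<le> card {a, b}" by (intro card_mono) auto
    also have "\<dots> \<le> 2" by (simp add: card_insert_if)
    finally show False using cN by simp
  qed
  obtain p where p: "p \<in> N" using third by blast
  have "\<exists>P. ipath P \<and> set P \<subseteq> ?T \<and> 2 \<le> length P \<and> hd P \<in> {p} \<and> last P \<in> N - {p} \<and>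
    set (tl P) \<inter> {p} = {} \<and> set (butlast P) \<inter> (N - {p}) = {} \<and>
    (\<forall>v\<in>set (butlast (butlast P)). \<forall>b\<in>N - {p}. \<not> E v b) \<and> (\<forall>v\<in>set (tl (tl P)). \<forall>a\<in>{p}. \<not> E a v)"
    by (rule shortest_path) (use cT NT p third[of p p] in auto)
  then obtain P where P: "ipath P" "set P \<subseteq> ?T" "2 \<le> length P" "hd P = p" "last P \<in> N - {p}"
    "set (butlast P) \<inter> (N - {p}) = {}" by blast
  define q where "q = last P"
  have Pne: "P \<noteq> []" using P(3) by auto
  have PN: "z \<in> N \<longleftrightarrow> z = p \<or> z = q" if z: "z \<in> set P" for z
  proof -
    have "z = last P \<or> z \<in> set (butlast P)" using z Pne
      by (metis Un_iff append_butlast_last_id empty_iff empty_set insert_iff list.simps(15) set_append)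
    then show ?thesis using P(5,6) p by (auto simp: q_def)
  qed
  have pq: "p \<in> set P" "q \<in> set P" "p \<noteq> q" "q \<in> N" using P(4,5) Pne by (auto simp: q_def)
  have "\<exists>R. ipath R \<and> set R \<subseteq> ?T \<and> 2 \<le> length R \<and> hd R \<in> N - {p, q} \<and> last R \<in> set P \<and>
    set (tl R) \<inter> (N - {p, q}) = {} \<and> set (butlast R) \<inter> set P = {} \<and>
    (\<forall>v\<in>set (butlast (butlast R)). \<forall>b\<in>set P. \<not> E v b) \<and> (\<forall>v\<in>set (tl (tl R)). \<forall>a\<in>N - {p, q}. \<not> E a v)"
    by (rule shortest_path) (use cT NT P(2) Pne third[of p q] PN in auto)
  then obtain R where R: "ipath R" "set R \<subseteq> ?T" "2 \<le> length R" "hd R \<in> N - {p, q}" "last R \<in> set P"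
    "set (tl R) \<inter> (N - {p, q}) = {}" "set (butlast R) \<inter> set P = {}"
    "\<forall>v\<in>set (butlast (butlast R)). \<forall>b\<in>set P. \<not> E v b" by blast
  define Q where "Q = butlast R"
  have RQ: "R = Q @ [last R]" using R(3) by (cases R rule: rev_cases) (auto simp: Q_def)
  have Qne: "Q \<noteq> []" using R(3) arg_cong[OF RQ, of length] by auto
  have Q: "ipath Q" "E (last Q) (last R)" using R(1) Qne RQ by (metis ipath_append list.sel(1) not_Cons_self2 list.set_intros(1) last_in_set)+
  have QP: "set Q \<inter> set P = {}" using R(7) by (simp add: Q_def)
  have QT: "set Q \<subseteq> ?T" using R(2) by (auto simp: Q_def dest: in_set_butlastD)
  have QN: "z \<in> N \<longleftrightarrow> z = hd Q" if z: "z \<in> set Q" for z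
  proof -
    have h: "hd Q = hd R" using Qne RQ by (metis hd_append2)
    have "z = hd Q \<or> z \<in> set (tl Q)" using z by (cases Q) auto
    moreover have "set (tl Q) \<subseteq> set (tl R)" using Qne RQ by (metis Un_iff set_append subsetI tl_append2)
    moreover have "z \<noteq> p" "z \<noteq> q" using z QP pq by auto
    ultimately show ?thesis using R(4,6) h by auto
  qed
  have Qa: "z = last Q" if "z \<in> set Q" "b \<in> set P" "E z b" for z b
  proof (rule ccontr)
    assume "z \<noteq> last Q"
    then have "z \<in> set (butlast Q)" using that(1) Qne
      by (metis Un_iff append_butlast_last_id empty_iff empty_set insert_iff list.simps(15) set_append)
    then show False using R(8) that unfolding Q_def by blast
  qed
  define z where "z = last Q"
  have zQ: "z \<in> set Q" "hd Q \<in> set Q" using Qne by (auto simp: z_def)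
  have lkQ: "link (set Q) x s" if "E z s" for s
    using linkI[OF ipath_conn[OF Q(1)] subset_refl, of "hd Q" x z s] zQ QN that E_sym by (auto simp: N_def)
  have "\<exists>s\<in>set P. E z s" using R(5) Q(2) by (auto simp: z_def)
  from split_list_first_prop[OF this] obtain P1 s1 P2 where s1: "P = P1 @ s1 # P2" "E z s1" "\<forall>s\<in>set P1. \<not> E z s" by blast
  have dP: "distinct P" using ipath_distinct[OF P(1)] .
  have xN: "E x v" if "v \<in> N" for v using that by (simp add: N_def)
  have hdP1: "hd P1 = p" if "P1 \<noteq> []" using P(4) that s1(1) by simp
  have lastP2: "last P2 = q" if "P2 \<noteq> []" using that s1(1) by (simp add: q_def)
  have s1T: "s1 \<in> U" "s1 \<noteq> x" using P(2) s1(1) by auto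
  have c1: "ipath P1" "E s1 (last P1)" if "P1 \<noteq> []"
    using P(1) that E_sym unfolding s1(1) by (auto simp: ipath_append)
  have c2: "ipath P2" "E s1 (hd P2)" if "P2 \<noteq> []"
    using P(1) that ipath_appendD[of P1 "s1 # P2"] unfolding s1(1) by (auto simp: ipath_Cons)
  have n12: "\<not> E u v" if "u \<in> set P1" "v \<in> set P2" for u v
  proof -
    have "P1 \<noteq> []" using that by auto
    then have "\<forall>u\<in>set P1. \<forall>v\<in>set (s1 # P2). E u v \<longleftrightarrow> u = last P1 \<and> v = s1"
      using P(1) unfolding s1(1) by (auto simp: ipath_append)
    moreover have "v \<noteq> s1" using dP that(2) unfolding s1(1) by auto
    ultimately show ?thesis using that by simp
  qed
  show ?thesis
  proof (cases "\<exists>s\<in>set P2. E z s")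
    case False
    have onlys: "E u v \<Longrightarrow> v = s1" if "u \<in> set Q" "v \<in> set P" for u v
      using Qa[OF that] False s1(3) that(2) unfolding z_def[symmetric] s1(1) by auto
    have sub: "set Q \<subseteq> ?T" "set P1 \<subseteq> ?T" "set P2 \<subseteq> ?T" using QT P(2) s1(1) by auto
    have ds: "s1 \<notin> set P1" "s1 \<notin> set P2" "set P1 \<inter> set P2 = {}" "s1 \<notin> set Q"
      "set Q \<inter> set P1 = {}" "set Q \<inter> set P2 = {}" using dP QP s1(1) by auto
    have na: "\<forall>u\<in>set Q. \<forall>v\<in>set P1. \<not> E u v" "\<forall>u\<in>set Q. \<forall>v\<in>set P2. \<not> E u v"
      using onlys ds s1(1) by auto
    have l1: "link (set P1) x s1" if "P1 \<noteq> []"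
      using linkI[OF ipath_conn[OF c1(1)[OF that]] subset_refl, of "hd P1" x "last P1" s1]
        that c1(2)[OF that] hdP1[OF that] xN[OF p] by auto
    have l2: "link (set P2) x s1" if "P2 \<noteq> []"
      using linkI[OF ipath_conn[OF c2(1)[OF that]] subset_refl, of "last P2" x "hd P2" s1]
        that c2(2)[OF that] lastP2[OF that] xN[OF pq(4)] by auto
    have "P1 \<noteq> [] \<or> P2 \<noteq> []" using P(3) s1(1) by auto
    have e: "E x s1" if "P1 = [] \<or> P2 = []"
      using that xN[OF p] xN[OF pq(4)] P(4) s1(1) by (auto simp: q_def)
    have False
    proof (cases "P1 = []")
      case True
      then have "P2 \<noteq> []" using P(3) s1(1) by auto
      then show False
        using theta_x[OF s1T lkQ[OF s1(2)] l2, of "{}"] e True sub ds na by auto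
    next
      case f1: False
      show False
      proof (cases "P2 = []")
        case True
        then show False using theta_x[OF s1T lkQ[OF s1(2)] l1[OF f1], of "{}"] e sub ds na by auto
      next
        case f2: False
        then show False
          using theta_x[OF s1T lkQ[OF s1(2)] l1[OF f1] disjI2[OF l2[OF f2]] sub] ds na n12 by blast
      qed
    qed
    then show ?thesis ..
  next
    case True
    from split_list_last_prop[OF this] obtain P3 s2 P4 where s2: "P2 = P3 @ s2 # P4" "E z s2" "\<forall>s\<in>set P4. \<not> E z s" by blast
    have PP: "P = (P1 @ [s1]) @ P3 @ s2 # P4" using s1(1) s2(1) by simp
    have A: "ipath (P1 @ [s1])" using P(1) ipath_appendD[of "P1 @ [s1]" "P3 @ s2 # P4"] unfolding PP by auto
    have B: "ipath (s2 # P4)" using P(1) ipath_appendD[of "P1 @ [s1] @ P3" "s2 # P4"] unfolding PP by auto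
    have hA: "hd (P1 @ [s1]) = p" using P(4) unfolding s1(1) by (cases P1) auto
    have lB: "last (s2 # P4) = q" by (simp add: q_def PP)
    have AB: "\<forall>u\<in>set (P1 @ [s1]). \<forall>v\<in>set (P3 @ s2 # P4). E u v \<longleftrightarrow> u = s1 \<and> v = hd (P3 @ s2 # P4)"
      "set (P1 @ [s1]) \<inter> set (P3 @ s2 # P4) = {}"
      using P(1) ipath_append[of "P1 @ [s1]" "P3 @ s2 # P4"] unfolding PP by auto
    have subA: "set (P1 @ [s1]) \<subseteq> ?T" "set (s2 # P4) \<subseteq> ?T" using P(2) unfolding PP by auto
    have zP: "z \<notin> set P" using QP zQ by auto
    have zU: "z \<in> U" "z \<noteq> x" using QT zQ by auto
    show ?thesis
    proof (cases "P3 = []")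
      case f: False
      have nAB: "\<not> E u v" if "u \<in> set (P1 @ [s1])" "v \<in> set (s2 # P4)" for u v
      proof -
        have "hd (P3 @ s2 # P4) \<in> set P3" using f by simp
        moreover have "set P3 \<inter> set (s2 # P4) = {}" using dP unfolding PP by auto
        ultimately have "v \<noteq> hd (P3 @ s2 # P4)" using that(2) by auto
        then show ?thesis using AB(1) that by auto
      qed
      have la: "link (set (P1 @ [s1])) x z"
        using linkI[OF ipath_conn[OF A] subset_refl, of p x s1 z] hA hd_in_set[of "P1 @ [s1]"] xN[OF p] s1(2) by auto
      have lb: "link (set (s2 # P4)) x z"
        using linkI[OF ipath_conn[OF B] subset_refl, of q x s2 z] lB last_in_set[of "s2 # P4"] xN[OF pq(4)] s2(2) by auto
      \<comment> \<open>Here \<open>z\<close> is a branch vertex and is taken off the route through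
        \<open>Q\<close>; if nothing remains, \<open>z\<close> itself is a neighbour of
        \<open>x\<close>.\<close>
      define Q' where "Q' = butlast Q"
      have QQ: "Q = Q' @ [z]" using Qne by (simp add: Q'_def z_def)
      have Q'P: "\<not> E u v" if "u \<in> set Q'" "v \<in> set P" for u v
      proof
        assume "E u v"
        have "u \<in> set Q" using that(1) by (simp add: QQ)
        from Qa[OF this that(2) \<open>E u v\<close>] have "u = z" by (simp only: z_def)
        then show False using ipath_distinct[OF Q(1)] QQ that by simp
      qed
      have lc: "E x z \<or> link (set Q') x z"
      proof (cases "Q' = []")
        case True
        then show ?thesis using QN[OF zQ(1)] QQ xN by simp
      next
        case fq: False
        have "ipath Q'" "E (last Q') z" using Q(1) fq unfolding QQ by (auto simp: ipath_append)
        moreover have "E x (hd Q')" using QN[OF zQ(2)] xN fq by (simp add: QQ)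
        ultimately show ?thesis
          using linkI[OF ipath_conn subset_refl, of Q' "hd Q'" x "last Q'" z] fq E_sym by auto
      qed
      have PA: "set (P1 @ [s1]) \<subseteq> set P" "set (s2 # P4) \<subseteq> set P" unfolding PP by auto
      have QP': "set Q' \<inter> set P = {}" using QP QQ by auto
      have False
      proof (rule theta_x[OF zU la lb lc subA])
        show "set Q' \<subseteq> ?T" using QT QQ by auto
        show "z \<notin> set Q'" using ipath_distinct[OF Q(1)] QQ by simp
        show "z \<notin> set (P1 @ [s1])" "z \<notin> set (s2 # P4)" using zP PA by blast+
        show "set (P1 @ [s1]) \<inter> set (s2 # P4) = {}" using AB(2) by auto
        show "set (P1 @ [s1]) \<inter> set Q' = {}" "set (s2 # P4) \<inter> set Q' = {}" using QP' PA by blast+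
        show "\<forall>u\<in>set (P1 @ [s1]). \<forall>v\<in>set (s2 # P4). \<not> E u v" using nAB by blast
        show "\<forall>u\<in>set (P1 @ [s1]). \<forall>v\<in>set Q'. \<not> E u v" "\<forall>u\<in>set (s2 # P4). \<forall>v\<in>set Q'. \<not> E u v"
          using Q'P PA E_comm by (meson subsetD)+
      qed
      then show ?thesis ..
    next
      case e3: True
      have rn: "rev (P1 @ [s1]) \<noteq> []" by simp
      \<comment> \<open>Legs start at the triangle, whereas \<open>P1 @ [s1]\<close> and
        \<open>Q\<close> start at neighbours of \<open>x\<close>.\<close>
      have "trilegs x (rev (P1 @ [s1])) (s2 # P4) (rev Q)"
      proof (rule trilegsI)
        show "ipath (rev (P1 @ [s1]))" "ipath (s2 # P4)" "ipath (rev Q)"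
          using ipath_rev[OF A] B ipath_rev[OF Q(1)] by auto
        show "x \<notin> set (rev (P1 @ [s1]))" "x \<notin> set (s2 # P4)" "x \<notin> set (rev Q)" using subA QT by auto
        have lr: "last (rev (P1 @ [s1])) = p" using hA by (simp only: last_rev)
        show "E u x \<longleftrightarrow> u = last (rev (P1 @ [s1]))" if "u \<in> set (rev (P1 @ [s1]))" for u
        proof -
          have "u \<in> set P" "u \<in> U" using that subA unfolding PP by auto
          moreover have "u \<noteq> q" using lB last_in_set[of "s2 # P4"] AB(2) that by auto
          ultimately show ?thesis using PN[of u] lr E_comm[of u x] by (auto simp: N_def)
        qed
        show "E u x \<longleftrightarrow> u = last (s2 # P4)" if "u \<in> set (s2 # P4)" for u
        proof -
          have "u \<in> set P" "u \<in> U" using that subA unfolding PP by auto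
          moreover have "u \<noteq> p" using hA hd_in_set[of "P1 @ [s1]"] AB(2) that by auto
          ultimately show ?thesis using PN[of u] lB E_comm[of u x] by (auto simp: N_def)
        qed
        show "E u x \<longleftrightarrow> u = last (rev Q)" if "u \<in> set (rev Q)" for u
          using QN[of u] QT that E_comm[of u x] by (auto simp: N_def last_rev)
        show "set (rev (P1 @ [s1])) \<inter> set (s2 # P4) = {}" using AB(2) by auto
        show "set (rev (P1 @ [s1])) \<inter> set (rev Q) = {}" "set (s2 # P4) \<inter> set (rev Q) = {}"
          using QP unfolding PP by auto
        show "E u v \<longleftrightarrow> u = hd (rev (P1 @ [s1])) \<and> v = hd (s2 # P4)"
          if "u \<in> set (rev (P1 @ [s1]))" "v \<in> set (s2 # P4)" for u v
          using AB(1) e3 that by auto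
        show "E u v \<longleftrightarrow> u = hd (rev (P1 @ [s1])) \<and> v = hd (rev Q)"
          if "u \<in> set (rev (P1 @ [s1]))" "v \<in> set (rev Q)" for u v
          using Qa[of v u] that s1(2,3) E_comm[of u v] unfolding PP by (auto simp: hd_rev z_def)
        have "\<not> E z v" if "v \<in> set P4" for v using s2(3) that by blast
        then show "E u v \<longleftrightarrow> u = hd (s2 # P4) \<and> v = hd (rev Q)"
          if "u \<in> set (s2 # P4)" "v \<in> set (rev Q)" for u v
          using Qa[of v u] that s2(2) E_comm[of u v] unfolding PP by (auto simp: hd_rev z_def)
      qed
      moreover have "set (rev (P1 @ [s1])) \<union> set (s2 # P4) \<union> set (rev Q) \<subseteq> ?T" using subA QT by auto
      ultimately show ?thesis by blast
    qed
  qed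
qed

section \<open>Tripods and the paths that can be attached to them\<close>

definition tripod :: "'a list \<Rightarrow> 'a list \<Rightarrow> 'a list \<Rightarrow> 'a set \<Rightarrow> bool" where
  "tripod l1 l2 l3 M \<longleftrightarrow> trilegs x l1 l2 l3 \<and> M = set l1 \<union> set l2 \<union> set l3 \<and> M \<subseteq> U - {x}"

lemma tripod_swap12: "tripod l1 l2 l3 M \<Longrightarrow> tripod l2 l1 l3 M"
  unfolding tripod_def using trilegs_swap12 by blast

lemma tripod_swap23: "tripod l1 l2 l3 M \<Longrightarrow> tripod l1 l3 l2 M"
  unfolding tripod_def using trilegs_swap23 by blast

lemma tripod_member:
  assumes "tripod l1 l2 l3 M" "a \<in> M"
  obtains k1 k2 k3 where "tripod k1 k2 k3 M" "a \<in> set k1"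
proof -
  have "a \<in> set l1 \<or> a \<in> set l2 \<or> a \<in> set l3" using assms by (auto simp: tripod_def)
  then show ?thesis
    using that assms(1) tripod_swap12[OF assms(1)] tripod_swap12[OF tripod_swap23[OF assms(1)]] by blast
qed

lemma tripod_parity: "tripod l1 l2 l3 M \<Longrightarrow> odd (length l1) = odd (length l2) \<and> odd (length l1) = odd (length l3)"
proof -
  have *: "odd (length l1) = odd (length l2)" if t: "tripod l1 l2 l3 M" for l1 l2 l3
  proof (rule ccontr)
    assume "odd (length l1) \<noteq> odd (length l2)"
    then have "xAT ({x} \<union> set l1 \<union> set l2 \<union> set l3) x" using trilegs_parity t unfolding tripod_def by blast
    moreover have "{x} \<union> set l1 \<union> set l2 \<union> set l3 \<subseteq> U" using t xU by (auto simp: tripod_def)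
    ultimately show False using nX[of "{x} \<union> set l1 \<union> set l2 \<union> set l3"] by blast
  qed
  assume t: "tripod l1 l2 l3 M"
  show ?thesis using *[OF t] *[OF tripod_swap23[OF t]] by blast
qed

text \<open>A path that touches \<open>M\<close> only at \<open>a\<close> and leads to
  \<open>x\<close> is a third route between them. The other two follow the leg of \<open>a\<close>
  outwards to \<open>x\<close>, and go back to the triangle and out along another leg.\<close>

lemma spider:
  assumes t: "tripod l1 l2 l3 M" and a: "a \<in> M" and Y: "ipath Y" "set Y \<subseteq> U - {x} - M"
    and att: "\<forall>y\<in>set Y. \<forall>z\<in>M. E y z \<longleftrightarrow> y = hd Y \<and> z = a" and YN: "\<forall>y\<in>set Y. E y x \<longleftrightarrow> y = last Y"
  shows False
proof -
  obtain k1 k2 k3 where k: "tripod k1 k2 k3 M" "a \<in> set k1" using tripod_member[OF t a] by blast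
  have tl: "trilegs x k1 k2 k3" and M: "M = set k1 \<union> set k2 \<union> set k3" "M \<subseteq> U - {x}" using k(1) by (auto simp: tripod_def)
  note D = trilegsD[OF tl]
  obtain pre post where k1: "k1 = pre @ a # post" using split_list[OF k(2)] by blast
  have d: "distinct k1" using ipath_distinct[OF D(4)] .
  have Yne: "Y \<noteq> []" using Y(1) by auto
  have "hd Y \<in> set Y" "last Y \<in> set Y" using Yne by auto
  then have lY: "link (set Y) x a"
    using linkI[OF ipath_conn[OF Y(1)] subset_refl, of "last Y" x "hd Y" a] YN att a E_sym by blast
  have pre: "ipath pre" "E a (last pre)" "hd pre = hd k1" if "pre \<noteq> []"
    using D(4) that E_sym unfolding k1 by (auto simp: ipath_append)
  have hh: "E (hd k1) (hd k2)" using D(16)[of "hd k1" "hd k2"] D(1,2) by simp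
  have lk2: "last k2 \<in> set k2" "E x (last k2)" using D(2) D(11)[of "last k2"] E_comm[of x "last k2"] by auto
  have l2: "link (set pre \<union> set k2) x a"
  proof (cases "pre = []")
    case True
    then have "E a (hd k2)" using hh k1 by simp
    then show ?thesis
      using linkI[OF ipath_conn[OF D(5)], of "set pre \<union> set k2" "last k2" x "hd k2" a] lk2 D(2) by auto
  next
    case False
    have "conn (set pre \<union> set k2)"
      by (rule conn_Un[OF ipath_conn[OF pre(1)[OF False]] ipath_conn[OF D(5)]])
        (use hh pre(3)[OF False] hd_in_set[OF False] hd_in_set[OF D(2)] in metis)
    then show ?thesis
      using linkI[OF _ subset_refl, of "set pre \<union> set k2" "last k2" x "last pre" a] lk2 pre(2)[OF False] False by auto
  qed
  have l3: "E x a \<or> link (set post) x a"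
  proof (cases "post = []")
    case True
    then show ?thesis using D(10)[OF k(2)] k1 E_comm[of x a] by simp
  next
    case False
    have "ipath post" "E a (hd post)"
      using D(4) ipath_appendD[of pre "a # post"] False unfolding k1 by (auto simp: ipath_Cons)
    moreover have "last post = last k1" "last k1 \<in> set k1" using False k1 by auto
    moreover from this have "E x (last post)" using D(10)[of "last k1"] E_comm[of x "last k1"] by simp
    ultimately show ?thesis
      using linkI[OF ipath_conn subset_refl, of post "last post" x "hd post" a] False last_in_set[OF False] by auto
  qed
  have np: "\<not> E u v" if "u \<in> set pre" "v \<in> set post" for u v
  proof -
    have "pre \<noteq> []" using that by auto
    then have "\<forall>u\<in>set pre. \<forall>v\<in>set (a # post). E u v \<longleftrightarrow> u = last pre \<and> v = a"
      using D(4) unfolding k1 by (auto simp: ipath_append)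
    moreover have "v \<noteq> a" using d that(2) unfolding k1 by auto
    ultimately show ?thesis using that by simp
  qed
  have n2: "\<not> E u v" if "u \<in> set k2" "v \<in> set post" for u v
  proof -
    have "v \<noteq> hd k1" using d that(2) unfolding k1 by (cases pre) auto
    then show ?thesis using D(16)[of v u] that k1 E_comm[of u v] by auto
  qed
  have aT: "a \<in> U" "a \<noteq> x" using a M by auto
  have sub: "set Y \<subseteq> U - {x}" "set pre \<union> set k2 \<subseteq> U - {x}" "set post \<subseteq> U - {x}" using Y M k1 by auto
  have dis: "a \<notin> set Y" "a \<notin> set pre \<union> set k2" "a \<notin> set post" "set Y \<inter> (set pre \<union> set k2) = {}"
    "set Y \<inter> set post = {}" "(set pre \<union> set k2) \<inter> set post = {}"
    using Y(2) a d D(13) M k1 by auto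
  have nY: "\<forall>u\<in>set Y. \<forall>v\<in>set pre \<union> set k2. \<not> E u v" "\<forall>u\<in>set Y. \<forall>v\<in>set post. \<not> E u v"
    using att M k1 dis by auto
  show False
    by (rule theta_x[OF aT lY l2 l3 sub dis nY]) (use np n2 in auto)
qed

text \<open>Routes an attachment along a leg towards the triangle: \<open>Y\<close> absorbs the leg
  except its first vertex \<open>v\<close>, unless \<open>v\<close> is already adjacent to
  \<open>Y\<close>.\<close>

lemma grow:
  assumes "ipath (v # t)" "conn Y" "\<exists>y\<in>Y. \<exists>u\<in>set (v # t). E y u"
  shows "\<exists>D. conn D \<and> Y \<subseteq> D \<and> D \<subseteq> Y \<union> set t \<and> (\<exists>d\<in>D. E v d)"
proof (cases "\<exists>y\<in>Y. E y v")
  case True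
  then show ?thesis using assms(2) E_sym by blast
next
  case False
  then obtain y u where yu: "y \<in> Y" "u \<in> set t" "E y u" using assms(3) by auto
  then have t: "t \<noteq> []" by auto
  have "ipath t" "E v (hd t)" using assms(1) t by (auto simp: ipath_Cons)
  moreover have "conn (Y \<union> set t)" by (rule conn_Un[OF assms(2) ipath_conn[OF \<open>ipath t\<close>]]) (use yu in blast)
  ultimately show ?thesis using t by (intro exI[of _ "Y \<union> set t"]) auto
qed

text \<open>The triangle vertices of the two touched legs are joined by their edge, through the
  third triangle vertex, and through \<open>Y\<close> with the rest of both legs. As
  \<open>Y\<close> misses the third triangle vertex, this is a theta, and it avoids
  \<open>x\<close>.\<close>

lemma two_legs:
  assumes t: "tripod l1 l2 l3 M" and Y: "conn Y" "Y \<subseteq> U - {x} - M"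
    and a: "\<exists>y\<in>Y. \<exists>u\<in>set l1. E y u" "\<exists>y\<in>Y. \<exists>u\<in>set l2. E y u" and n: "\<forall>y\<in>Y. \<not> E y (hd l3)"
  shows False
proof -
  have tl: "trilegs x l1 l2 l3" and M: "M = set l1 \<union> set l2 \<union> set l3" "M \<subseteq> U - {x}" using t by (auto simp: tripod_def)
  note D = trilegsD[OF tl]
  obtain v1 t1 v2 t2 where l: "l1 = v1 # t1" "l2 = v2 # t2" using D(1,2) by (metis neq_Nil_conv)
  define v3 where "v3 = hd l3"
  have v3: "v3 \<in> set l3" using D(3) by (simp add: v3_def)
  obtain D1 where D1: "conn D1" "Y \<subseteq> D1" "D1 \<subseteq> Y \<union> set t1" "\<exists>d\<in>D1. E v1 d"
    using grow[of v1 t1 Y] D(4) Y(1) a(1) unfolding l by blast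
  have "\<exists>y\<in>D1. \<exists>u\<in>set (v2 # t2). E y u" using a(2) D1(2) unfolding l by blast
  then obtain D2 where D2: "conn D2" "D1 \<subseteq> D2" "D2 \<subseteq> D1 \<union> set t2" "\<exists>d\<in>D2. E v2 d"
    using grow[of v2 t2 D1] D(5) D1(1) unfolding l by blast
  let ?C = "Y \<union> set t1 \<union> set t2"
  have D2C: "D2 \<subseteq> ?C" using D1(3) D2(3) by blast
  have lk: "link ?C v1 v2" using linkI[OF D2(1) D2C] D1(4) D2(2,4) by blast
  have e: "E v1 v2" "E v1 v3" "E v2 v3"
    using D(16)[of v1 v2] D(17)[of v1 v3] D(18)[of v2 v3] v3 by (auto simp: l v3_def)
  have lk3: "link {v3} v1 v2" using linkI[OF conn_singleton subset_refl] e by blast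
  have dd: "distinct (v1 # t1)" "distinct (v2 # t2)" using ipath_distinct[OF D(4)] ipath_distinct[OF D(5)] unfolding l by blast+
  have nt: "\<not> E u v3" if "u \<in> set t1 \<union> set t2" for u
  proof
    assume "E u v3"
    then have "u = v1 \<and> u \<in> set t1 \<or> u = v2 \<and> u \<in> set t2" using that D(17)[of u v3] D(18)[of u v3] v3 by (auto simp: l)
    then show False using dd by auto
  qed
  show False
  proof (rule theta_T[OF _ _ _ e(1) lk3 lk])
    show "v1 \<in> U - {x}" "v2 \<in> U - {x}" "{v3} \<subseteq> U - {x}" "?C \<subseteq> U - {x}" using M l v3 Y(2) by auto
    show "v1 \<noteq> v2" using e(1) E_irrefl by blast
    show "v1 \<notin> {v3}" "v2 \<notin> {v3}" using e E_irrefl by auto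
    show "v1 \<notin> ?C" "v2 \<notin> ?C" using dd D(13) Y(2) M l by auto
    show "{v3} \<inter> ?C = {}" using v3 Y(2) M D(14,15) l by auto
    show "\<forall>u\<in>{v3}. \<forall>v\<in>?C. \<not> E u v" using nt n E_sym by (auto simp: v3_def)
  qed
qed

lemma same_leg_ear:
  assumes t: "tripod l1 l2 l3 M" and ab: "a \<in> set l1" "b \<in> set l1" "a \<noteq> b"
    and Y: "ipath Y" "set Y \<subseteq> U - {x} - M"
    and att: "\<forall>y\<in>set Y. \<forall>z\<in>M. E y z \<longleftrightarrow> y = hd Y \<and> z = a \<or> y = last Y \<and> z = b"
    and YN: "\<forall>y\<in>set Y. \<not> E y x"
  shows False
proof -
  have tl: "trilegs x l1 l2 l3" and M: "M = set l1 \<union> set l2 \<union> set l3" "M \<subseteq> U - {x}" using t by (auto simp: tripod_def)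
  have Mx: "{x} \<union> set l1 \<union> set l2 \<union> set l3 = insert x M" using M(1) by auto
  have x: "x \<notin> M" "x \<noteq> a" "x \<noteq> b" using M ab by auto
  have Yne: "Y \<noteq> []" using Y(1) by auto
  have dj: "set Y \<inter> insert x M = {}" using Y(2) by auto
  have "xAT (set Y \<union> insert x M) x"
  proof (rule in_split_cases[OF ab])
    fix pre mid post assume l1: "l1 = pre @ a # mid @ b # post"
    show ?thesis
      using trilegs_ear[OF tl l1 Y(1)] dj att YN x unfolding Mx by auto
  next
    fix pre mid post assume l1: "l1 = pre @ b # mid @ a # post"
    show ?thesis
      using trilegs_ear[OF tl l1 ipath_rev[OF Y(1)]] dj att YN x Yne unfolding Mx
      by (auto simp: hd_rev last_rev)
  qed
  then show False using nX[of "set Y \<union> insert x M"] Y(2) M(2) xU by blast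
qed

text \<open>Ends on one leg are covered by \<open>same_leg_ear\<close>. Ends on two legs leave the
  head of the third leg without a neighbour in \<open>Y\<close>, since \<open>a\<close> and
  \<open>b\<close> are the only contacts, so \<open>two_legs\<close> applies.\<close>

lemma ear:
  assumes t: "tripod l1 l2 l3 M" and ab: "a \<in> M" "b \<in> M" "a \<noteq> b"
    and Y: "ipath Y" "set Y \<subseteq> U - {x} - M"
    and att: "\<forall>y\<in>set Y. \<forall>z\<in>M. E y z \<longleftrightarrow> y = hd Y \<and> z = a \<or> y = last Y \<and> z = b"
    and YN: "\<forall>y\<in>set Y. \<not> E y x"
  shows False
proof -
  obtain k1 k2 k3 where k: "tripod k1 k2 k3 M" "a \<in> set k1" using tripod_member[OF t ab(1)] by blast
  have M: "M = set k1 \<union> set k2 \<union> set k3" and tl: "trilegs x k1 k2 k3" using k(1) by (auto simp: tripod_def)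
  note D = trilegsD[OF tl]
  have hl: "hd Y \<in> set Y" "last Y \<in> set Y" using ipath_nonempty[OF Y(1)] by auto
  have ea: "E (hd Y) a" "E (last Y) b" using att ab hl by blast+
  have *: False if k: "tripod k1 k2 k3 M" "a \<in> set k1" "b \<in> set k2" for k1 k2 k3
  proof -
    have tl: "trilegs x k1 k2 k3" and M: "M = set k1 \<union> set k2 \<union> set k3" using k(1) by (auto simp: tripod_def)
    note D = trilegsD[OF tl]
    have "hd k3 \<in> set k3" using D(3) by simp
    then have "hd k3 \<in> M" "hd k3 \<noteq> a" "hd k3 \<noteq> b" using M k D(14,15) by auto
    then have "\<forall>y\<in>set Y. \<not> E y (hd k3)" using att by blast
    then show False using two_legs[OF k(1) ipath_conn[OF Y(1)] Y(2)] ea hl k by blast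
  qed
  consider "b \<in> set k1" | "b \<in> set k2" | "b \<in> set k3" using ab(2) M by auto
  then show False
  proof cases
    case 1 then show ?thesis using same_leg_ear[OF k(1,2) _ ab(3) Y att YN] by blast
  next
    case 2 then show ?thesis using *[OF k] by blast
  next
    case 3 then show ?thesis using *[OF tripod_swap23[OF k(1)] k(2)] by blast
  qed
qed

end

context critical_pair
begin

lemma tripodD:
  assumes "tripod l1 l2 l3 M"
  shows "trilegs x l1 l2 l3" "M = set l1 \<union> set l2 \<union> set l3" "M \<subseteq> U - {x}"
  using assms by (auto simp: tripod_def)

section \<open>Vertices with two neighbours in a tripod\<close>

text \<open>Leg 1 read backwards followed by leg 2 is one induced path. A further neighbour on leg 1
  would be the third neighbour of \<open>y\<close> on it, giving a fan that avoids
  \<open>x\<close>.\<close>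

lemma vertex_no_extra:
  assumes t: "tripod l1 l2 l3 M" and y: "y \<in> U - {x} - M" and e: "E y (hd l1)" "E y (hd l2)"
    and s: "s \<in> set l1" "E y s"
  shows "s = hd l1"
proof (rule ccontr)
  assume ne: "s \<noteq> hd l1"
  note M = tripodD[OF t]
  note D = trilegsD[OF M(1)]
  have "ipath (rev l1 @ l2)"
    using D(1,2) ipath_rev[OF D(4)] D(5,13,16) by (auto simp: ipath_append last_rev)
  moreover have "y \<notin> set (rev l1 @ l2)" using y M(2) by auto
  moreover have "3 \<le> card {z \<in> set (rev l1 @ l2). E y z}"
  proof -
    have h: "hd l1 \<in> set l1" "hd l2 \<in> set l2" using D(1,2) by auto
    have "hd l2 \<noteq> s" "hd l2 \<noteq> hd l1" using h s D(13) by auto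
    then have "card {s, hd l1, hd l2} = 3" using ne by auto
    moreover have "{s, hd l1, hd l2} \<subseteq> {z \<in> set (rev l1 @ l2). E y z}" using h s e by auto
    then have "card {s, hd l1, hd l2} \<le> card {z \<in> set (rev l1 @ l2). E y z}" by (intro card_mono) auto
    ultimately show ?thesis by simp
  qed
  ultimately obtain W where W: "W \<subseteq> insert y (set (rev l1 @ l2))" "W \<noteq> {}" "dAT W" using fan by blast
  have "W \<subseteq> U - {x}" using W(1) y M by auto
  then show False using nT W by blast
qed

text \<open>\<open>y\<close> and the head \<open>v\<close> of leg 1 exchange roles:
  \<open>[y]\<close> is a leg because \<open>y\<close> is adjacent to \<open>x\<close>, and
  \<open>v\<close> is now adjacent to the three triangle vertices but not to
  \<open>x\<close>.\<close>

lemma apex_in_N: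
  assumes t: "tripod l1 l2 l3 M" and y: "y \<in> U - {x} - M"
    and att: "\<forall>z\<in>M. E y z \<longleftrightarrow> z = hd l1 \<or> z = hd l2 \<or> z = hd l3" and N: "E x y" "\<not> E x (hd l1)"
  shows False
proof -
  note M = tripodD[OF t]
  note D = trilegsD[OF M(1)]
  define v where "v = hd l1"
  have v: "v \<in> set l1" using D(1) by (simp add: v_def)
  have h: "hd l2 \<in> set l2" "hd l3 \<in> set l3" using D(2,3) by auto
  have yM: "y \<notin> set l1" "y \<notin> set l2" "y \<notin> set l3" using y M by auto
  have v2: "v \<notin> set l2" "v \<notin> set l3" using v D(13,14) by auto
  have E2: "E y z \<longleftrightarrow> z = hd l2" if "z \<in> set l2" for z
    using att that M(2) D(1,3) h v2 D(15) unfolding v_def by (metis UnCI disjoint_iff)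
  have E3: "E y z \<longleftrightarrow> z = hd l3" if "z \<in> set l3" for z
    using att that M(2) D(1,2) h v2 D(15) unfolding v_def by (metis UnCI disjoint_iff)
  have tl: "trilegs x [y] l2 l3"
    by (rule trilegsI) (use D(5,6,8,9,11,12,15,18) y yM N E2 E3 E_sym in auto)
  have Ev: "E v y" using att v M(2) E_sym unfolding v_def by blast
  have EvL: "E v z \<longleftrightarrow> z = hd l2" if "z \<in> set l2" for z using D(16)[OF v that] by (simp add: v_def)
  have EvL3: "E v z \<longleftrightarrow> z = hd l3" if "z \<in> set l3" for z using D(17)[OF v that] by (simp add: v_def)
  have nx: "\<not> E v x" using N(2) E_sym by (auto simp: v_def)
  have vx: "v \<noteq> x" "v \<noteq> y" using v M y by auto
  have "xAT (insert v ({x} \<union> set [y] \<union> set l2 \<union> set l3)) x"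
  proof (rule trilegs_apex[OF tl])
    show "v \<notin> {x} \<union> set [y] \<union> set l2 \<union> set l3" using vx v2 by auto
    show "\<forall>z\<in>{x} \<union> set [y] \<union> set l2 \<union> set l3. E v z \<longleftrightarrow> z = hd [y] \<or> z = hd l2 \<or> z = hd l3"
    proof
      fix z assume z: "z \<in> {x} \<union> set [y] \<union> set l2 \<union> set l3"
      have "hd l2 \<notin> set l3" "hd l3 \<notin> set l2" "hd l2 \<noteq> x" "hd l3 \<noteq> x" "hd l2 \<noteq> y" "hd l3 \<noteq> y"
        using h D(8,9,15) yM by auto
      then show "E v z \<longleftrightarrow> z = hd [y] \<or> z = hd l2 \<or> z = hd l3"
        using z EvL[of z] EvL3[of z] Ev nx yM D(8,9) by auto
    qed
  qed
  moreover have "insert v ({x} \<union> set [y] \<union> set l2 \<union> set l3) \<subseteq> U" using v M y xU by auto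
  ultimately show False using nX[of "insert v ({x} \<union> set [y] \<union> set l2 \<union> set l3)"] by blast
qed

text \<open>If \<open>y\<close> is not adjacent to \<open>x\<close>, the apex construction applies
  directly. If it is, the exchange of \<open>apex_in_N\<close> needs a triangle vertex not adjacent
  to \<open>x\<close>, which exists since \<open>x\<close> lies in no clique of four
  vertices.\<close>

lemma vertex_heads:
  assumes t: "tripod l1 l2 l3 M" and y: "y \<in> U - {x} - M"
    and att: "E y (hd l1)" "E y (hd l2)" "E y (hd l3)"
    and noK: "\<nexists>a b c. {a, b, c} \<subseteq> U \<and> E x a \<and> E x b \<and> E x c \<and> E a b \<and> E b c \<and> E a c"
  shows False
proof -
  note M = tripodD[OF t]
  note D = trilegsD[OF M(1)]
  note t23 = tripod_swap23[OF t] and t12 = tripod_swap12[OF t]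
  note t31 = tripod_swap12[OF t23] and t13 = tripod_swap23[OF t12]
  have h: "hd l1 \<in> set l1" "hd l2 \<in> set l2" "hd l3 \<in> set l3" using D(1-3) by auto
  have a1: "E y z \<longleftrightarrow> z = hd l1" if "z \<in> set l1" for z
    using vertex_no_extra[OF t y att(1,2) that] att(1) by blast
  have a2: "E y z \<longleftrightarrow> z = hd l2" if "z \<in> set l2" for z
    using vertex_no_extra[OF t12 y att(2,1) that] att(2) by blast
  have a3: "E y z \<longleftrightarrow> z = hd l3" if "z \<in> set l3" for z
    using vertex_no_extra[OF t31 y att(3,1) that] att(3) by blast
  have all: "\<forall>z\<in>M. E y z \<longleftrightarrow> z = hd l1 \<or> z = hd l2 \<or> z = hd l3"
    unfolding M(2) using a1 a2 a3 att by blast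
  show False
  proof (cases "E x y")
    case False
    have "xAT (insert y ({x} \<union> set l1 \<union> set l2 \<union> set l3)) x"
    proof (rule trilegs_apex[OF M(1)])
      show "y \<notin> {x} \<union> set l1 \<union> set l2 \<union> set l3" using y M(2) by auto
      have "\<not> E y x" using False E_sym by blast
      then show "\<forall>z\<in>{x} \<union> set l1 \<union> set l2 \<union> set l3. E y z \<longleftrightarrow> z = hd l1 \<or> z = hd l2 \<or> z = hd l3"
        using all h D(7-9) unfolding M(2) by auto
    qed
    moreover have "insert y ({x} \<union> set l1 \<union> set l2 \<union> set l3) \<subseteq> U" using y M xU by auto
    ultimately show False using nX[of "insert y ({x} \<union> set l1 \<union> set l2 \<union> set l3)"] by blast
  next
    case True
    have e: "E (hd l1) (hd l2)" "E (hd l2) (hd l3)" "E (hd l1) (hd l3)"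
      using D(16)[OF h(1,2)] D(17)[OF h(1,3)] D(18)[OF h(2,3)] by auto
    have "{hd l1, hd l2, hd l3} \<subseteq> U" using h M by auto
    then have "\<not> E x (hd l1) \<or> \<not> E x (hd l2) \<or> \<not> E x (hd l3)" using noK e by blast
    moreover have "\<forall>z\<in>M. E y z \<longleftrightarrow> z = hd l2 \<or> z = hd l1 \<or> z = hd l3"
      "\<forall>z\<in>M. E y z \<longleftrightarrow> z = hd l3 \<or> z = hd l1 \<or> z = hd l2" using all by blast+
    ultimately show False
      using apex_in_N[OF t y all True] apex_in_N[OF t12 y _ True] apex_in_N[OF t31 y _ True] by blast
  qed
qed

text \<open>
  The surviving case is the Moser spindle: \<open>y\<close>, \<open>a\<close>, \<open>b\<close> and \<open>v\<close>, \<open>v\<^sub>2\<close>, \<open>v\<^sub>3\<close> are its two triangles avoiding \<open>x\<close>.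
\<close>

lemma vertex_same_leg:
  assumes t: "tripod l1 l2 l3 M" and y: "y \<in> U - {x} - M"
    and l1: "l1 = pre @ a # mid @ b # post" and att: "\<forall>z\<in>M. E y z \<longleftrightarrow> z = a \<or> z = b" and N: "E x y"
  shows "\<exists>v v2 v3. tripod [v, a, b] [v2] [v3] M"
proof -
  note M = tripodD[OF t]
  note D = trilegsD[OF M(1)]
  have d: "distinct l1" using ipath_distinct[OF D(4)] .
  have aM: "a \<in> M" "b \<in> M" "a \<in> set l1" "b \<in> set l1" using M(2) l1 by auto
  have h: "hd l1 \<in> set l1" "hd l2 \<in> set l2" "hd l3 \<in> set l3" using D(1-3) by auto
  have lst: "last l1 \<in> set l1" "last l2 \<in> set l2" "last l3 \<in> set l3" using D(1-3) by auto
  have ya: "E y a" "E y b" using att aM by auto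
  have yU: "y \<in> U" "y \<noteq> x" "y \<notin> M" "y \<notin> set l1" "y \<notin> set l2" "y \<notin> set l3" using y M(2) by auto
  have yn: "\<not> E y z" if "z \<in> M" "z \<noteq> a" "z \<noteq> b" for z using att that by blast
  have A: "ipath (pre @ [a])" "ipath (mid @ b # post)"
    "\<forall>u\<in>set (pre @ [a]). \<forall>v\<in>set (mid @ b # post). E u v \<longleftrightarrow> u = a \<and> v = hd (mid @ b # post)"
    "set (pre @ [a]) \<inter> set (mid @ b # post) = {}"
    using D(4) ipath_append[of "pre @ [a]" "mid @ b # post"] unfolding l1 by auto
  have B: "ipath (b # post)" using A(2) ipath_appendD by blast
  have hdA: "hd (pre @ [a]) = hd l1" unfolding l1 by (cases pre) auto
  have Ax: "\<not> E u x" if "u \<in> set (pre @ [a])" for u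
  proof -
    have "u \<noteq> last l1" using A(4) that lst(1) unfolding l1 by auto
    then show ?thesis using D(10)[of u] that l1 by auto
  qed
  have hb: "b \<noteq> hd l1" using d hdA A(4) hd_in_set[of "pre @ [a]"] by auto
  have bn: "\<not> E b z" if "z \<in> set l2 \<union> set l3" for z
    using D(16)[OF aM(4), of z] D(17)[OF aM(4), of z] hb that by auto
  have cA: "conn (set (pre @ [a]) \<union> set l2)"
    by (rule conn_Un[OF ipath_conn[OF A(1)] ipath_conn[OF D(5)]])
      (use D(16)[OF h(1,2)] hdA h(2) hd_in_set[of "pre @ [a]"] in \<open>metis snoc_eq_iff_butlast\<close>)
  have xl: "E x (last l1)" "E x (last l2)" "E x (last l3)" using D(10)[OF lst(1)] D(11)[OF lst(2)] D(12)[OF lst(3)] E_sym by auto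
  \<comment> \<open>A gap between \<open>a\<close> and \<open>b\<close> would separate two routes
    from \<open>y\<close> to \<open>x\<close>: outwards from \<open>b\<close>, and from
    \<open>a\<close> back to the triangle and out along leg 2. Together with the edge between
    \<open>x\<close> and \<open>y\<close> they form a theta.\<close>
  have mid: "mid = []"
  proof (rule ccontr)
    assume m: "mid \<noteq> []"
    have lA: "link (set (pre @ [a]) \<union> set l2) x y"
      using linkI[OF cA subset_refl, of "last l2" x a y] lst xl ya by auto
    have "last (b # post) = last l1" by (simp add: l1)
    then have lB: "link (set (b # post)) x y"
      using linkI[OF ipath_conn[OF B] subset_refl, of "last (b # post)" x b y] xl ya last_in_set[of "b # post"] by auto
    have nAB: "\<not> E u v" if "u \<in> set (pre @ [a]) \<union> set l2" "v \<in> set (b # post)" for u v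
    proof (cases "u \<in> set l2")
      case True
      have "v \<in> set l1" "v \<noteq> hd l1" using that(2) A(4) hdA hd_in_set[of "pre @ [a]"] by (auto simp: l1)
      then show ?thesis using D(16)[of v u] True E_comm[of u v] by auto
    next
      case False
      have "hd (mid @ b # post) \<in> set mid" using m by simp
      moreover have "set mid \<inter> set (b # post) = {}" using d unfolding l1 by auto
      ultimately have "v \<noteq> hd (mid @ b # post)" using that(2) by auto
      then show ?thesis using A(3) that False by auto
    qed
    show False
    proof (rule theta_x[OF yU(1,2) lA lB disjI1[OF N], of "{}"])
      show "set (pre @ [a]) \<union> set l2 \<subseteq> U - {x}" "set (b # post) \<subseteq> U - {x}" using M l1 by auto
      show "y \<notin> set (pre @ [a]) \<union> set l2" "y \<notin> set (b # post)" using yU l1 by auto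
      show "(set (pre @ [a]) \<union> set l2) \<inter> set (b # post) = {}" using A(4) D(13) unfolding l1 by auto
      show "\<forall>u\<in>set (pre @ [a]) \<union> set l2. \<forall>v\<in>set (b # post). \<not> E u v" using nAB by blast
    qed auto
  qed
  have ab: "E a b" using A(3) mid by auto
  \<comment> \<open>If the leg continued beyond \<open>b\<close>, it could be replaced by the one
    that ends in \<open>a, y\<close>, as \<open>y\<close> is adjacent to \<open>x\<close>. Then
    \<open>b\<close> would be an ear over the last edge of the new leg.\<close>
  have post: "post = []"
  proof (rule ccontr)
    assume p: "post \<noteq> []"
    have "b \<noteq> last l1" using d p unfolding l1 by auto
    then have bx: "\<not> E b x" using D(10)[OF aM(4)] by simp
    have ip: "ipath (pre @ [a] @ [y])"
    proof -
      have "E u y \<longleftrightarrow> u = a" if "u \<in> set (pre @ [a])" for u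
        using att that E_comm[of u y] M(2) A(4) unfolding l1 by auto
      then show ?thesis using A(1) yU unfolding l1 by (subst append_assoc[symmetric], subst ipath_append) auto
    qed
    have hh: "hd (pre @ [a] @ [y]) = hd l1" using hdA by (cases pre) auto
    have ih: "hd l1 \<noteq> y" "hd l1 \<noteq> b" using yU h hb by auto
    have y23: "\<not> E y z" if "z \<in> set l2 \<union> set l3" for z
      using yn[of z] that M(2) aM D(13,14) by auto
    have sub: "u \<in> set l1" if "u \<in> set (pre @ [a])" for u using that l1 by auto
    have tl: "trilegs x (pre @ [a] @ [y]) l2 l3"
    proof (rule trilegsI)
      show "E u x \<longleftrightarrow> u = last (pre @ [a] @ [y])" if "u \<in> set (pre @ [a] @ [y])" for u
        using Ax[of u] that N E_sym[of x y] yU(4) l1 by auto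
      show "E u v \<longleftrightarrow> u = hd (pre @ [a] @ [y]) \<and> v = hd l2" if "u \<in> set (pre @ [a] @ [y])" "v \<in> set l2" for u v
        using D(16)[of u v] that y23[of v] ih sub[of u] unfolding hh by auto
      show "E u v \<longleftrightarrow> u = hd (pre @ [a] @ [y]) \<and> v = hd l3" if "u \<in> set (pre @ [a] @ [y])" "v \<in> set l3" for u v
        using D(17)[of u v] that y23[of v] ih sub[of u] unfolding hh by auto
      show "x \<notin> set (pre @ [a] @ [y])" using sub D(7) yU by auto
      show "set (pre @ [a] @ [y]) \<inter> set l2 = {}" "set (pre @ [a] @ [y]) \<inter> set l3 = {}"
        using sub D(13,14) yU by auto
    qed (use ip D in auto)
    have bE: "E b z \<longleftrightarrow> z = a \<or> z = y" if "z \<in> {x} \<union> set (pre @ [a] @ [y]) \<union> set l2 \<union> set l3" for z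
    proof -
      consider "z = x" | "z \<in> set (pre @ [a])" | "z = y" | "z \<in> set l2 \<union> set l3" using \<open>z \<in> _\<close> by auto
      then show ?thesis
      proof cases
        case 1 then show ?thesis using bx aM(3) D(7) yU by auto
      next
        case 2
        then have "E z b \<longleftrightarrow> z = a" using A(3) mid by auto
        moreover have "z \<noteq> y" using 2 sub yU by auto
        ultimately show ?thesis using E_comm[of z b] by blast
      next
        case 3 then show ?thesis using ya E_sym by blast
      next
        case 4
        then have "z \<noteq> a" "z \<noteq> y" using aM(3) D(13,14) yU by auto
        then show ?thesis using bn 4 by blast
      qed
    qed
    have xx: "a \<noteq> x" "y \<noteq> x" "b \<notin> {x} \<union> set (pre @ [a] @ [y]) \<union> set l2 \<union> set l3"
      using aM D(7,13,14) yU A(4) by auto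
    have "xAT (set [b] \<union> ({x} \<union> set (pre @ [a] @ [y]) \<union> set l2 \<union> set l3)) x"
      by (rule trilegs_ear[OF tl, of pre a "[]" y "[]"]) (use bE xx in auto)
    moreover have "set [b] \<union> ({x} \<union> set (pre @ [a] @ [y]) \<union> set l2 \<union> set l3) \<subseteq> U" using M l1 yU xU by auto
    ultimately show False using nX[of "set [b] \<union> ({x} \<union> set (pre @ [a] @ [y]) \<union> set l2 \<union> set l3)"] by blast
  qed
  have l1': "l1 = (pre @ [a]) @ [b]" using l1 mid post by simp
  have bx: "E b x" using D(10)[OF aM(4)] l1' by simp
  \<comment> \<open>If another leg were longer than one vertex, take the triangle
    \<open>a, b, y\<close> instead, with \<open>[b]\<close> and \<open>[y]\<close> as legs and a
    third leg running from \<open>a\<close> back to the head \<open>v1\<close> of leg 1 and on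
    through \<open>k3\<close>. The head \<open>v2\<close> of \<open>k2\<close> is not adjacent to
    \<open>x\<close> and is an ear over the edge \<open>v1, v3\<close> of that long leg.\<close>
  have leaf: "tl k2 = []" if k: "tripod l1 k2 k3 M" for k2 k3
  proof (rule ccontr)
    assume ne: "tl k2 \<noteq> []"
    note M' = tripodD[OF k]
    note K = trilegsD[OF M'(1)]
    obtain v2 t2 where k2: "k2 = v2 # t2" "t2 \<noteq> []" using K(2) ne by (cases k2) auto
    have hk: "hd k3 \<in> set k3" using K(3) by auto
    define v1 where "v1 = hd l1"
    define v3 where "v3 = hd k3"
    have v2: "v2 \<in> set k2" "v2 \<noteq> last k2" using k2 ipath_distinct[OF K(5)] by auto
    then have v2x: "\<not> E v2 x" using K(11) by auto
    obtain s where s: "rev (pre @ [a]) = s @ [v1]"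
      using hdA by (metis append_is_Nil_conv hd_rev append_butlast_last_id last_rev not_Cons_self2 rev_is_Nil_conv v1_def)
    obtain t3 where t3: "k3 = v3 # t3" using K(3) by (cases k3) (auto simp: v3_def)
    let ?q = "rev (pre @ [a]) @ k3"
    have sub: "u \<in> set l1" "u \<noteq> b" if "u \<in> set (pre @ [a])" for u using that l1' A(4) by auto
    have E13: "E u v \<longleftrightarrow> u = v1 \<and> v = v3" if "u \<in> set (pre @ [a])" "v \<in> set k3" for u v
      using K(17)[of u v] sub that by (simp add: v1_def v3_def)
    have ip: "ipath ?q"
    proof -
      have "last (rev (pre @ [a])) = v1" using s by simp
      moreover have "set (rev (pre @ [a])) \<inter> set k3 = {}" using K(14) sub by auto
      ultimately show ?thesis using ipath_rev[OF A(1)] K(3,6) E13 by (subst ipath_append) (auto simp: v3_def)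
    qed
    have hq: "hd ?q = a" by simp
    have lq: "last ?q = last k3" using K(3) by simp
    have yk: "\<not> E y u" if "u \<in> set k2 \<union> set k3" for u
      using yn[of u] that M'(2) aM K(13,14) by auto
    have bk: "\<not> E b u" if "u \<in> set k2 \<union> set k3" for u
      using K(16)[OF aM(4), of u] K(17)[OF aM(4), of u] hb that by auto
    have yq: "E y u \<longleftrightarrow> u = a" if "u \<in> set ?q" for u
    proof (cases "u \<in> set k3")
      case True
      then show ?thesis using yk[of u] aM(3) K(14) by auto
    next
      case False
      then have "u \<in> set (pre @ [a])" using that by auto
      then show ?thesis using att sub M(2) by auto
    qed
    have bq: "E b u \<longleftrightarrow> u = a" if "u \<in> set ?q" for u
    proof (cases "u \<in> set k3")
      case True
      then show ?thesis using bk[of u] aM(3) K(14) by auto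
    next
      case False
      then have "u \<in> set (pre @ [a])" using that by auto
      then show ?thesis using A(3) mid E_comm[of b u] by auto
    qed
    have bnq: "b \<notin> set ?q" "y \<notin> set ?q" "b \<noteq> y"
    proof -
      show "b \<noteq> y" using aM yU by auto
      show "b \<notin> set ?q" using sub(2) aM(4) K(14) by auto
      show "y \<notin> set ?q" using yU M'(2) sub(1) by auto
    qed
    have tl: "trilegs x [b] [y] ?q"
    proof (rule trilegsI)
      show "E u x \<longleftrightarrow> u = last ?q" if "u \<in> set ?q" for u
      proof (cases "u \<in> set k3")
        case True
        then show ?thesis using K(12)[OF True] lq by simp
      next
        case False
        then have "u \<in> set (pre @ [a])" "u \<noteq> last k3" using that K(3) by auto
        then show ?thesis using Ax[of u] lq by simp
      qed
      show "E u v \<longleftrightarrow> u = hd [b] \<and> v = hd ?q" if "u \<in> set [b]" "v \<in> set ?q" for u v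
        using bq[OF that(2)] that(1) hq by simp
      show "E u v \<longleftrightarrow> u = hd [y] \<and> v = hd ?q" if "u \<in> set [y]" "v \<in> set ?q" for u v
        using yq[OF that(2)] that(1) hq by simp
      show "x \<notin> set ?q" using K(7,9) sub(1) by auto
      show "set [b] \<inter> set ?q = {}" "set [y] \<inter> set ?q = {}" using bnq by auto
    qed (use ip bnq bx N ya E_sym aM D(7) yU in auto)
    have v2E: "E v2 z \<longleftrightarrow> z = v1 \<or> z = v3" if "z \<in> {x} \<union> set [b] \<union> set [y] \<union> set ?q" for z
    proof -
      have h1: "v1 \<in> set (pre @ [a])" using s by (metis in_set_conv_decomp set_rev)
      have hs: "v1 \<noteq> x" "v3 \<noteq> x" "v1 \<noteq> b" "v3 \<noteq> b" "v1 \<noteq> y" "v3 \<noteq> y" "v1 \<notin> set k3" "v3 \<notin> set (pre @ [a])"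
        using h1 hk sub K(7,9,14) aM(4) yU M'(2) unfolding v3_def[symmetric] by auto
      consider "z = x" | "z = b" | "z = y" | "z \<in> set (pre @ [a])" | "z \<in> set k3" using \<open>z \<in> _\<close> by auto
      then show ?thesis
      proof cases
        case 1 then show ?thesis using v2x hs by auto
      next
        case 2 then show ?thesis using bk[of v2] v2(1) hs E_comm[of b v2] by auto
      next
        case 3 then show ?thesis using yk[of v2] v2(1) hs E_comm[of y v2] by auto
      next
        case 4
        then have "E z v2 \<longleftrightarrow> z = v1" using K(16)[of z v2] sub v2(1) k2 by (simp add: v1_def)
        then show ?thesis using 4 hs E_comm[of z v2] by auto
      next
        case 5
        then have "E v2 z \<longleftrightarrow> z = v3" using K(18)[of v2 z] v2(1) k2 by (simp add: v3_def)
        then show ?thesis using 5 hs by auto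
      qed
    qed
    have v2n: "v2 \<notin> {x} \<union> set [b] \<union> set [y] \<union> set ?q"
      using v2(1) K(8,13,15) sub(1) aM(4) yU M'(2) by auto
    have "xAT (set [v2] \<union> ({x} \<union> set ?q \<union> set [b] \<union> set [y])) x"
    proof (rule trilegs_ear[of x ?q "[b]" "[y]" s v1 "[]" v3 t3])
      show "trilegs x ?q [b] [y]" using tl trilegs_swap12 trilegs_swap23 by blast
      show "?q = s @ v1 # [] @ v3 # t3" using s t3 by simp
      show "\<forall>w\<in>set [v2]. \<forall>z\<in>{x} \<union> set ?q \<union> set [b] \<union> set [y]. E w z \<longleftrightarrow> w = hd [v2] \<and> z = v1 \<or> w = last [v2] \<and> z = v3"
        using v2E by auto
      show "set [v2] \<inter> ({x} \<union> set ?q \<union> set [b] \<union> set [y]) = {}" using v2n by auto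
    qed simp
    moreover have "set [v2] \<union> ({x} \<union> set ?q \<union> set [b] \<union> set [y]) \<subseteq> U"
      using v2(1) M' aM yU xU sub(1) by auto
    ultimately show False using nX[of "set [v2] \<union> ({x} \<union> set ?q \<union> set [b] \<union> set [y])"] by blast
  qed
  obtain v2 v3 where l23: "l2 = [v2]" "l3 = [v3]"
    using leaf[OF t] leaf[OF tripod_swap23[OF t]] D(2,3) by (metis list.collapse)
  have "odd (length l1)" using tripod_parity[OF t] l23 by simp
  then have op: "odd (length pre)" by (simp add: l1')
  \<comment> \<open>By parity \<open>pre\<close> would otherwise have at least three vertices, so
    that \<open>v1\<close> and \<open>a\<close> are distinct and not adjacent. Then
    \<open>{x, a, b, y}\<close> and \<open>{x, v1, v2, v3}\<close> each induce \<open>K_4\<close>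
    minus an edge, which is a theta; they share only \<open>x\<close> and have no edges between
    them.\<close>
  have "length pre = 1"
  proof (rule ccontr)
    assume "length pre \<noteq> 1"
    then have p3: "length pre \<noteq> 0" "length pre \<noteq> 1" "length pre \<noteq> 2" using op by auto
    define v1 where "v1 = hd l1"
    obtain p' where p': "pre = v1 # p'" "p' \<noteq> []" using p3 l1' by (cases pre) (auto simp: v1_def)
    have ne: "\<not> E v1 a" "v1 \<noteq> a"
    proof -
      have "ipath (v1 # (p' @ [a]))" using A(1) p' by simp
      then have "E v1 a \<longleftrightarrow> a = hd (p' @ [a])" "v1 \<noteq> a" by (auto simp: ipath_Cons)
      moreover have "hd (p' @ [a]) \<in> set p'" using p'(2) by simp
      moreover have "a \<notin> set p'" using ipath_distinct[OF A(1)] p' by auto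
      ultimately show "\<not> E v1 a" "v1 \<noteq> a" by auto
    qed
    have v1: "v1 \<in> set l1" "v1 \<in> set (pre @ [a])" using h by (auto simp: v1_def p')
    have v23: "v2 \<in> M" "v3 \<in> M" "E v2 v3" "E v1 v2" "E v1 v3" "E v2 x" "E v3 x"
      using M(2) l23 D(16)[OF v1(1), of v2] D(17)[OF v1(1), of v3] D(18)[of v2 v3] D(11)[of v2] D(12)[of v3] by (auto simp: v1_def)
    have ax: "\<not> E a x" "\<not> E v1 x" using Ax[of a] Ax[OF v1(2)] by auto
    have d1: "dAT ({b, y} \<union> set [x] \<union> set [a] \<union> set [])"
      using theta_core[of "[x]" "[a]" "[]" b y] bx N ya ab ax aM D(7) yU E_comm by auto
    have d2: "dAT ({v2, v3} \<union> set [x] \<union> set [v1] \<union> set [])"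
    proof -
      have "distinct (v2 # v3 # [x] @ [v1] @ [])" using v23 ax v1 D(7,13,14,15) l23 by auto
      then show ?thesis using theta_core[of "[x]" "[v1]" "[]" v2 v3] v23 ax E_comm by auto
    qed
    let ?Z = "({b, y} \<union> set [x] \<union> set [a] \<union> set []) \<union> ({v2, v3} \<union> set [x] \<union> set [v1] \<union> set [])"
    have "xAT ?Z x"
    proof (rule xAT_two_lobes[OF d1 d2])
      have "v1 \<noteq> b" "v2 \<noteq> a" "v2 \<noteq> b" "v3 \<noteq> a" "v3 \<noteq> b" "v1 \<noteq> y" "v2 \<noteq> y" "v3 \<noteq> y"
        using hb aM D(13,14) yU v1 v23 l23 by (auto simp: v1_def)
      then show "({b, y} \<union> set [x] \<union> set [a] \<union> set []) \<inter> ({v2, v3} \<union> set [x] \<union> set [v1] \<union> set []) = {x}"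
        using ne by auto
      have "\<not> E y v2" "\<not> E y v3" "\<not> E y v1" using yn \<open>v1 \<noteq> b\<close> \<open>v2 \<noteq> a\<close> \<open>v2 \<noteq> b\<close> \<open>v3 \<noteq> a\<close> \<open>v3 \<noteq> b\<close> ne v23 v1 M(2) by auto
      moreover have "\<not> E b v2" "\<not> E b v3" using bn l23 by auto
      moreover have "\<not> E b v1"
      proof -
        have "E v1 b \<longleftrightarrow> v1 = a" using A(3) v1(2) mid by auto
        then show ?thesis using ne E_sym by blast
      qed
      moreover have "\<not> E a v2" "\<not> E a v3" using D(16)[OF aM(3), of v2] D(17)[OF aM(3), of v3] l23 ne by (auto simp: v1_def)
      moreover have "\<not> E a v1" using ne E_sym by blast
      ultimately show "\<forall>u\<in>({b, y} \<union> set [x] \<union> set [a] \<union> set []) - {x}. \<forall>v\<in>({v2, v3} \<union> set [x] \<union> set [v1] \<union> set []) - {x}. \<not> E u v"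
        by auto
    qed
    moreover have "?Z \<subseteq> U" using aM yU v23 v1 M xU by auto
    moreover have "x \<in> ?Z" by simp
    ultimately show False using nX[of ?Z] by metis
  qed
  then obtain v where "pre = [v]" by (cases pre) auto
  then have "l1 = [v, a, b]" using l1' by simp
  then show ?thesis using t l23 by blast
qed

text \<open>Neighbours on different legs force adjacency to all three heads, by
  \<open>two_legs\<close> with each leg in turn as the untouched one, and
  \<open>vertex_heads\<close> excludes this. On a single leg a third neighbour would give a fan, and
  a vertex not adjacent to \<open>x\<close> would be an ear; \<open>vertex_same_leg\<close> handles
  the rest.\<close>

lemma vertex:
  assumes t: "tripod l1 l2 l3 M" and y: "y \<in> U - {x} - M" and ef: "e \<in> M" "f \<in> M" "e \<noteq> f" "E y e" "E y f"
    and noK: "\<nexists>a b c. {a, b, c} \<subseteq> U \<and> E x a \<and> E x b \<and> E x c \<and> E a b \<and> E b c \<and> E a c"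
  shows "E x y \<and> (\<exists>v a b v2 v3. tripod [v, a, b] [v2] [v3] M \<and> (\<forall>z\<in>M. E y z \<longleftrightarrow> z = a \<or> z = b))"
proof -
  obtain k1 k2 k3 where k: "tripod k1 k2 k3 M" "e \<in> set k1" using tripod_member[OF t ef(1)] by blast
  note M = tripodD[OF k(1)]
  note D = trilegsD[OF M(1)]
  have *: False if k: "tripod k1 k2 k3 M" "e \<in> set k1" "w \<in> set k2" "E y w" for k1 k2 k3 w
  proof -
    note D = trilegsD[OF tripodD(1)[OF k(1)]]
    have h: "hd k3 \<in> set k3" using D(3) by simp
    have y3: "E y (hd k3)" using two_legs[OF k(1) conn_singleton, of y] y k ef(4) by blast
    have y2: "E y (hd k2)" using two_legs[OF tripod_swap23[OF k(1)] conn_singleton, of y] y k(2) ef(4) h y3 by blast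
    have y1: "E y (hd k1)"
      using two_legs[OF tripod_swap23[OF tripod_swap12[OF k(1)]] conn_singleton, of y] y k(3,4) h y3 by blast
    show False using vertex_heads[OF k(1) y y1 y2 y3 noK] by blast
  qed
  have n2: "\<not> E y w" if "w \<in> set k2" for w using *[OF k that] by blast
  have n3: "\<not> E y w" if "w \<in> set k3" for w using *[OF tripod_swap23[OF k(1)] k(2) that] by blast
  have f: "f \<in> set k1" using ef(2,5) M(2) n2 n3 by auto
  have S: "E y z \<longleftrightarrow> z = e \<or> z = f" if z: "z \<in> M" for z
  proof (rule ccontr)
    assume n: "\<not> ?thesis"
    then have z': "E y z" "z \<noteq> e" "z \<noteq> f" using ef by auto
    then have "z \<in> set k1" using z M(2) n2 n3 by auto
    then have "{e, f, z} \<subseteq> {z \<in> set k1. E y z}" using k(2) f ef z' by auto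
    then have "card {e, f, z} \<le> card {z \<in> set k1. E y z}" by (intro card_mono) auto
    then have "3 \<le> card {z \<in> set k1. E y z}" using ef(3) z' by auto
    moreover have "y \<notin> set k1" using y M(2) by auto
    ultimately obtain W where W: "W \<subseteq> insert y (set k1)" "W \<noteq> {}" "dAT W" using fan[OF D(4)] by blast
    have "W \<subseteq> U - {x}" using W(1) y M by auto
    then show False using nT W by blast
  qed
  have N: "E x y"
  proof (rule ccontr)
    assume "\<not> E x y"
    then have "\<not> E y x" using E_sym by blast
    then show False using same_leg_ear[OF k f ef(3), of "[y]"] y S by auto
  qed
  have "\<exists>v a b v2 v3. tripod [v, a, b] [v2] [v3] M \<and> (\<forall>z\<in>M. E y z \<longleftrightarrow> z = a \<or> z = b)"
  proof (rule in_split_cases[OF k(2) f ef(3)])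
    fix pre mid post assume "k1 = pre @ e # mid @ f # post"
    then show ?thesis using vertex_same_leg[OF k(1) y _ _ N] S by blast
  next
    fix pre mid post assume "k1 = pre @ f # mid @ e # post"
    moreover have "\<forall>z\<in>M. E y z \<longleftrightarrow> z = f \<or> z = e" using S by blast
    ultimately show ?thesis using vertex_same_leg[OF k(1) y _ _ N] by blast
  qed
  then show ?thesis using N by blast
qed

end

context critical_pair
begin

lemma outside:
  assumes M: "M \<subseteq> U - {x}" "M \<noteq> {}" "M \<noteq> U - {x}"
  obtains (vertex) y e f where "y \<in> U - {x} - M" "e \<in> M" "f \<in> M" "e \<noteq> f" "E y e" "E y f"
  | (pendant) Y a where "a \<in> M" "ipath Y" "set Y \<subseteq> U - {x} - M"
      "\<forall>y\<in>set Y. \<forall>z\<in>M. E y z \<longleftrightarrow> y = hd Y \<and> z = a" "\<forall>y\<in>set Y. E y x \<longleftrightarrow> y = last Y"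
  | (path) Y a b where "a \<in> M" "b \<in> M" "a \<noteq> b" "ipath Y" "set Y \<subseteq> U - {x} - M"
      "\<forall>y\<in>set Y. \<forall>z\<in>M. E y z \<longleftrightarrow> y = hd Y \<and> z = a \<or> y = last Y \<and> z = b" "\<forall>y\<in>set Y. \<not> E y x"
proof -
  have "conn (U - {x})" using cut xU by blast
  then obtain a0 y0 where y0: "a0 \<in> M" "y0 \<in> U - {x} - M" "E a0 y0"
    using M unfolding conn_def by meson
  have 1: "\<forall>a\<in>M. conn (U - {a})" "M \<subseteq> U" "{x} \<subseteq> U" "M \<inter> {x} = {}" "(M - {a0}) \<union> {x} \<noteq> {}"
    using cut M(1) xU by auto
  have bx: "(\<exists>c\<in>{x}. P c) \<longleftrightarrow> P x" "(\<forall>c\<in>{x}. P c) \<longleftrightarrow> P x" for P by auto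
  show ?thesis
    using attachment[OF 1(1-4) y0(2,1) E_sym[OF y0(3)] 1(5), unfolded bx]
    by (elim disjE bexE exE conjE) (blast intro: vertex, blast intro: pendant, blast intro: path)
qed

section \<open>Cliques of four vertices through \<open>x\<close>\<close>

text \<open>\<open>M\<close> is a largest clique among the neighbours of \<open>x\<close>. A vertex
  adjacent to all of \<open>M\<close> is not adjacent to \<open>x\<close> by maximality, so it is an
  apex over a \<open>K_4\<close> through \<open>x\<close>. Every other attachment makes a theta that
  uses a further clique vertex.\<close>

lemma clique:
  assumes abc: "E x a" "E x b" "E x c" "E a b" "E b c" "E a c" "a \<in> U" "b \<in> U" "c \<in> U"
  shows "\<forall>u\<in>U. \<forall>v\<in>U. u \<noteq> v \<longrightarrow> E u v"
proof -
  define Q where "Q M \<longleftrightarrow> M \<subseteq> {z \<in> U. E x z} \<and> (\<forall>u\<in>M. \<forall>v\<in>M. u \<noteq> v \<longrightarrow> E u v)" for M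
  have Q3: "Q {a, b, c}" using abc by (auto simp: Q_def E_comm)
  have "card M \<le> card U" if "Q M" for M by (rule card_mono[OF fin]) (use that in \<open>auto simp: Q_def\<close>)
  then have "\<forall>M. Q M \<longrightarrow> card M < Suc (card U)" by (simp add: less_Suc_eq_le)
  then obtain M where M: "Q M" "\<And>M'. Q M' \<Longrightarrow> card M' \<le> card M"
    using ex_has_greatest_nat[of Q "{a, b, c}" card "Suc (card U)"] Q3 by blast
  have "card {a, b, c} = 3" using abc E_irrefl by (auto simp: card_insert_if)
  then have cM: "3 \<le> card M" using M(2)[OF Q3] by simp
  have MU: "M \<subseteq> U - {x}" "finite M" and MN: "\<And>v. v \<in> M \<Longrightarrow> E x v"
    and Mc: "\<And>u v. u \<in> M \<Longrightarrow> v \<in> M \<Longrightarrow> u \<noteq> v \<Longrightarrow> E u v"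
    using M(1) fin E_irrefl by (auto simp: Q_def intro: finite_subset)
  have third: "\<exists>c\<in>M. c \<noteq> a \<and> c \<noteq> b" for a b
  proof (rule ccontr)
    assume "\<not> ?thesis"
    then have "M \<subseteq> {a, b}" by auto
    then have "card M \<le> card {a, b}" by (intro card_mono) auto
    also have "\<dots> \<le> 2" by (simp add: card_insert_if)
    finally show False using cM by simp
  qed
  have th: False if "a \<in> M" "b \<in> M" "c \<in> M" "a \<noteq> b" "c \<noteq> a" "c \<noteq> b" "conn Y" "Y \<subseteq> U - {x} - M"
      "\<exists>y\<in>Y. E y a" "\<exists>y\<in>Y. E y b" "\<forall>y\<in>Y. \<not> E y c" for a b c Y
  proof (rule theta_T[of a b Y "{c}"])
    show "E a b" using Mc that by blast
    show "link Y a b" using linkI[OF that(7) subset_refl] that(9,10) E_sym by blast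
    show "link {c} a b" using linkI[OF conn_singleton subset_refl] Mc that by blast
  qed (use that MU in auto)
  have "M = U - {x}"
  proof (rule ccontr)
    assume ne: "M \<noteq> U - {x}"
    have "M \<noteq> {}" using cM by auto
    show False
    proof (rule outside[OF MU(1) \<open>M \<noteq> {}\<close> ne])
      fix y e f assume y: "y \<in> U - {x} - M" and ef: "e \<in> M" "f \<in> M" "e \<noteq> f" "E y e" "E y f"
      show False
      proof (cases "\<exists>c\<in>M. \<not> E y c")
        case True
        then obtain c where c: "c \<in> M" "\<not> E y c" by blast
        show False by (rule th[of e f c "{y}"]) (use ef y c in auto)
      next
        case False
        then have all: "\<And>c. c \<in> M \<Longrightarrow> E y c" by blast
        have "\<not> E x y"
        proof
          assume "E x y"
          then have "Q (insert y M)" using M(1) y all E_sym by (auto simp: Q_def)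
          then have "card (insert y M) \<le> card M" using M(2) by blast
          then show False using y MU(2) by simp
        qed
        then have nyx: "\<not> E y x" using E_sym by blast
        obtain w where w: "w \<in> M" "w \<noteq> e" "w \<noteq> f" using third by blast
        have "trilegs x [e] [f] [w]"
          by (rule trilegsI) (use ef w MN Mc MU E_sym in auto)
        moreover have "y \<notin> {x} \<union> set [e] \<union> set [f] \<union> set [w]" using y ef w by auto
        moreover have "\<forall>z\<in>{x} \<union> set [e] \<union> set [f] \<union> set [w]. E y z \<longleftrightarrow> z = hd [e] \<or> z = hd [f] \<or> z = hd [w]"
          using all ef w nyx MU by auto
        ultimately have "xAT (insert y ({x} \<union> set [e] \<union> set [f] \<union> set [w])) x" by (rule trilegs_apex)
        moreover have "insert y ({x} \<union> set [e] \<union> set [f] \<union> set [w]) \<subseteq> U" using y ef w MU xU by auto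
        ultimately show False using nX[of "insert y ({x} \<union> set [e] \<union> set [f] \<union> set [w])"] by blast
      qed
    next
      fix Y a assume a: "a \<in> M" and Y: "ipath Y" "set Y \<subseteq> U - {x} - M"
        "\<forall>y\<in>set Y. \<forall>z\<in>M. E y z \<longleftrightarrow> y = hd Y \<and> z = a" "\<forall>y\<in>set Y. E y x \<longleftrightarrow> y = last Y"
      obtain c where c: "c \<in> M" "c \<noteq> a" using third by blast
      have hl: "hd Y \<in> set Y" "last Y \<in> set Y" using ipath_nonempty[OF Y(1)] by auto
      then have lY: "link (set Y) x a"
        using linkI[OF ipath_conn[OF Y(1)] subset_refl, of "last Y" x "hd Y" a] Y(3,4) a E_sym by blast
      have lc: "link {c} x a" using linkI[OF conn_singleton subset_refl] MN[OF c(1)] Mc[OF a c(1)] c(2) by blast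
      show False
        by (rule theta_x[OF _ _ lY lc disjI1[OF MN[OF a]], of "{}"]) (use a c MU Y(2,3) in auto)
    next
      fix Y a b assume ab: "a \<in> M" "b \<in> M" "a \<noteq> b" and Y: "ipath Y" "set Y \<subseteq> U - {x} - M"
        "\<forall>y\<in>set Y. \<forall>z\<in>M. E y z \<longleftrightarrow> y = hd Y \<and> z = a \<or> y = last Y \<and> z = b"
      obtain c where c: "c \<in> M" "c \<noteq> a" "c \<noteq> b" using third by blast
      have hl: "hd Y \<in> set Y" "last Y \<in> set Y" using ipath_nonempty[OF Y(1)] by auto
      show False
        by (rule th[OF ab(1,2) c(1) ab(3) c(2,3) ipath_conn[OF Y(1)] Y(2)]) (use Y(3) ab c hl in blast)+
    qed
  qed
  then show ?thesis using Mc MN E_sym by (metis DiffI singletonD)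
qed

section \<open>The Moser spindle\<close>

text \<open>Two rhombi \<open>x, p, p', a\<close> and \<open>x, q, q', b\<close> share the vertex
  \<open>x\<close>, and their opposite tips \<open>a\<close>, \<open>b\<close> are joined. The ten
  missing edges are listed because the subgraph has to be induced.\<close>

definition moser :: "'a \<Rightarrow> 'a \<Rightarrow> 'a \<Rightarrow> 'a \<Rightarrow> 'a \<Rightarrow> 'a \<Rightarrow> bool" where
  "moser p p' a b q q' \<longleftrightarrow> distinct [p, p', a, b, q, q'] \<and> {p, p', a, b, q, q'} \<subseteq> U - {x} \<and>
     E p p' \<and> E p a \<and> E p' a \<and> E a b \<and> E b q \<and> E b q' \<and> E q q' \<and>
     E x p \<and> E x p' \<and> E x q \<and> E x q' \<and> \<not> E x a \<and> \<not> E x b \<and>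
     \<not> E p b \<and> \<not> E p q \<and> \<not> E p q' \<and> \<not> E p' b \<and> \<not> E p' q \<and> \<not> E p' q' \<and> \<not> E a q \<and> \<not> E a q'"

lemma moser_swap: "moser p p' a b q q' \<Longrightarrow> moser p' p a b q q'"
  unfolding moser_def using E_comm[of p p'] by auto

lemma moser_flip: "moser p p' a b q q' \<Longrightarrow> moser q q' b a p p'"
  unfolding moser_def
  using E_comm[of p b] E_comm[of p q] E_comm[of p q'] E_comm[of p' b] E_comm[of p' q] E_comm[of p' q'] E_comm[of a q]
    E_comm[of a q'] E_comm[of p a] E_comm[of p' a] E_comm[of a b] E_comm[of b q] E_comm[of b q'] by auto

text \<open>Without \<open>p'\<close> there remain the triangle \<open>b, q, q'\<close>, a leg of
  three vertices and two single vertices. Under the symmetries of the spindle, any two of its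
  vertices other than \<open>x\<close> lie in one of four such tripods.\<close>

lemma moser_tripod:
  assumes "moser p p' a b q q'"
  shows "tripod [b, a, p] [q] [q'] {b, a, p, q, q'}"
proof -
  have "trilegs x [b, a, p] [q] [q']"
    by (rule trilegsI) (use assms E_comm in \<open>auto simp: moser_def\<close>)
  then show ?thesis using assms by (auto simp: tripod_def moser_def)
qed

context
  assumes noK: "\<nexists>a b c. {a, b, c} \<subseteq> U \<and> E x a \<and> E x b \<and> E x c \<and> E a b \<and> E b c \<and> E a c"
begin

text \<open>
  Deleting any of \<open>p, p', q, q'\<close> leaves a tripod, so a further vertex would have to complete each of
  these to a Moser spindle, which is impossible simultaneously.
\<close>

lemma moser_vertex:
  assumes m: "moser p p' a b q q'" and y: "y \<in> U - {x} - {p, p', a, b, q, q'}"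
    and ef: "e \<in> {b, a, p, q, q'}" "f \<in> {b, a, p, q, q'}" "e \<noteq> f" "E y e" "E y f"
  shows "E y a \<and> E y p \<and> \<not> E y b"
proof -
  let ?M = "{b, a, p, q, q'}"
  have "y \<in> U - {x} - ?M" using y by auto
  from vertex[OF moser_tripod[OF m] this ef noK] obtain v \<alpha> \<beta> v2 v3 where
    t: "tripod [v, \<alpha>, \<beta>] [v2] [v3] ?M" and S: "\<forall>z\<in>?M. E y z \<longleftrightarrow> z = \<alpha> \<or> z = \<beta>" by blast
  note T = tripodD[OF t]
  note D = trilegsD[OF T(1)]
  have ab: "\<alpha> \<in> ?M" "\<beta> \<in> ?M" using T(2) by auto
  have "distinct [v, \<alpha>, \<beta>]" using ipath_distinct[OF D(4)] .
  then have nx: "\<not> E x \<alpha>" using D(10)[of \<alpha>] E_comm[of x \<alpha>] by auto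
  \<comment> \<open>Among the tripod vertices adjacent to \<open>x\<close>, only
    \<open>\<beta>\<close> is a neighbour of \<open>\<alpha>\<close>. This rules out
    \<open>\<alpha> = b\<close>, which has both \<open>q\<close> and \<open>q'\<close>.\<close>
  have un: "z = \<beta>" if "z \<in> ?M" "E x z" "E \<alpha> z" for z
  proof -
    have "z \<noteq> v" using D(10)[of v] that(2) E_comm[of x v] \<open>distinct [v, \<alpha>, \<beta>]\<close> by auto
    moreover have "z \<noteq> \<alpha>" using that(3) E_irrefl by blast
    moreover have "z \<noteq> v2" using D(16)[of \<alpha> v2] that(3) \<open>distinct [v, \<alpha>, \<beta>]\<close> by auto
    moreover have "z \<noteq> v3" using D(17)[of \<alpha> v3] that(3) \<open>distinct [v, \<alpha>, \<beta>]\<close> by auto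
    ultimately show ?thesis using that(1) unfolding T(2) by auto
  qed
  have mo: "E x p" "E x q" "E x q'" "E b q" "E b q'" "E a p" "q \<noteq> q'" "b \<noteq> a" "b \<noteq> p"
    using m E_sym by (auto simp: moser_def)
  have "\<alpha> \<in> {a, b}" using ab(1) nx mo by auto
  moreover have "\<alpha> \<noteq> b" using un[of q] un[of q'] mo by auto
  ultimately have "\<alpha> = a" by auto
  then have "\<beta> = p" using un[of p] mo by auto
  then show ?thesis using S \<open>\<alpha> = a\<close> mo by auto
qed

lemma moser_no_vertex:
  assumes m: "moser p p' a b q q'" and y: "y \<in> U - {x} - {p, p', a, b, q, q'}"
    and ef: "e \<in> {b, a, p, q, q'}" "f \<in> {b, a, p, q, q'}" "e \<noteq> f" "E y e" "E y f"
  shows False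
proof -
  have 1: "E y a" "E y p" using moser_vertex[OF assms] by auto
  have "y \<in> U - {x} - {q, q', b, a, p, p'}" using y by auto
  from moser_vertex[OF moser_flip[OF m] this, of a p] 1 m have "\<not> E y a" by (auto simp: moser_def)
  then show False using 1 by blast
qed

lemma moser_spans:
  assumes m: "moser p p' a b q q'"
  shows "{p, p', a, b, q, q'} = U - {x}"
proof (rule ccontr)
  let ?M = "{p, p', a, b, q, q'}"
  assume ne: "?M \<noteq> U - {x}"
  note m2 = moser_swap[OF m]
  note m3 = moser_flip[OF m]
  note m4 = moser_swap[OF m3]
  have sub: "?M \<subseteq> U - {x}" using m by (auto simp: moser_def)
  have d: "distinct [p, p', a, b, q, q']" using m by (simp add: moser_def)
  have pick: "(e \<in> {b, a, p, q, q'} \<and> f \<in> {b, a, p, q, q'}) \<or> (e \<in> {b, a, p', q, q'} \<and> f \<in> {b, a, p', q, q'}) \<or>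
      (e \<in> {a, b, q, p, p'} \<and> f \<in> {a, b, q, p, p'}) \<or> (e \<in> {a, b, q', p, p'} \<and> f \<in> {a, b, q', p, p'})"
    if "e \<in> ?M" "f \<in> ?M" for e f using that by blast
  show False
  proof (rule outside[OF sub _ ne])
    fix y e f assume y: "y \<in> U - {x} - ?M" and ef: "e \<in> ?M" "f \<in> ?M" "e \<noteq> f" "E y e" "E y f"
    have y': "y \<in> U - {x} - {p', p, a, b, q, q'}" "y \<in> U - {x} - {q, q', b, a, p, p'}" "y \<in> U - {x} - {q', q, b, a, p, p'}"
      using y by auto
    show False
      using pick[OF ef(1,2)] moser_no_vertex[OF m y _ _ ef(3-5)] moser_no_vertex[OF m2 y'(1) _ _ ef(3-5)]
        moser_no_vertex[OF m3 y'(2) _ _ ef(3-5)] moser_no_vertex[OF m4 y'(3) _ _ ef(3-5)] by blast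
  next
    fix Y e assume e: "e \<in> ?M" and Y: "ipath Y" "set Y \<subseteq> U - {x} - ?M"
      "\<forall>y\<in>set Y. \<forall>z\<in>?M. E y z \<longleftrightarrow> y = hd Y \<and> z = e" "\<forall>y\<in>set Y. E y x \<longleftrightarrow> y = last Y"
    have *: False if "tripod l1 l2 l3 M'" "M' \<subseteq> ?M" "e \<in> M'" for l1 l2 l3 M'
      by (rule spider[OF that(1,3) Y(1) _ _ Y(4)]) (use Y(2,3) that(2) in blast)+
    show False using pick[OF e e] *[OF moser_tripod[OF m]] *[OF moser_tripod[OF m2]] *[OF moser_tripod[OF m3]]
        *[OF moser_tripod[OF m4]] by blast
  next
    fix Y e f assume ef: "e \<in> ?M" "f \<in> ?M" "e \<noteq> f" and Y: "ipath Y" "set Y \<subseteq> U - {x} - ?M"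
      "\<forall>y\<in>set Y. \<forall>z\<in>?M. E y z \<longleftrightarrow> y = hd Y \<and> z = e \<or> y = last Y \<and> z = f" "\<forall>y\<in>set Y. \<not> E y x"
    have *: False if "tripod l1 l2 l3 M'" "M' \<subseteq> ?M" "e \<in> M'" "f \<in> M'" for l1 l2 l3 M'
      by (rule ear[OF that(1,3,4) ef(3) Y(1) _ _ Y(4)]) (use Y(2,3) that(2) in blast)+
    show False using pick[OF ef(1,2)] *[OF moser_tripod[OF m]] *[OF moser_tripod[OF m2]] *[OF moser_tripod[OF m3]]
        *[OF moser_tripod[OF m4]] by blast
  qed blast
qed

end

section \<open>Bad lists for the spindle and for the bare tripod\<close>

text \<open>The spindle has no 3-colouring: each rhombus repeats the colour of \<open>x\<close> at
  its other tip, yet \<open>a\<close> and \<open>b\<close> are adjacent. Its degrees are at most 3,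
  and 4 at \<open>x\<close>, so three common colours suffice.\<close>

lemma bad_moser:
  assumes m: "moser p p' a b q q'" and U: "{p, p', a, b, q, q'} = U - {x}"
  shows "bad U (\<lambda>v. if v = x then dg U x - 1 else dg U v)"
proof -
  have UU: "U = {x, p, p', a, b, q, q'}" using U xU by blast
  have "bad U (\<lambda>_. 3)"
    unfolding bad_def
  proof (intro exI[of _ "\<lambda>_. {0, 1, 2}"] conjI notI)
    assume "\<exists>\<phi>. (\<forall>v\<in>U. \<phi> v \<in> {0, 1, 2::nat}) \<and> (\<forall>u\<in>U. \<forall>v\<in>U. E u v \<longrightarrow> \<phi> u \<noteq> \<phi> v)"
    then obtain \<phi> where \<phi>: "\<forall>v\<in>U. \<phi> v \<in> {0, 1, 2::nat}" "\<forall>u\<in>U. \<forall>v\<in>U. E u v \<longrightarrow> \<phi> u \<noteq> \<phi> v" by blast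
    have key: "c4 = c1" if "c1 \<in> {0, 1, 2}" "c2 \<in> {0, 1, 2}" "c3 \<in> {0, 1, 2}" "c4 \<in> {0, 1, 2}"
      "c1 \<noteq> c2" "c1 \<noteq> c3" "c2 \<noteq> c3" "c2 \<noteq> c4" "c3 \<noteq> c4" for c1 c2 c3 c4 :: nat
      using that by auto
    have e: "E x p" "E x p'" "E p p'" "E p a" "E p' a" "E x q" "E x q'" "E q q'" "E b q" "E b q'" "E a b"
      using m by (auto simp: moser_def)
    have pr: "\<phi> u \<noteq> \<phi> v" if "E u v" "u \<in> U" "v \<in> U" for u v using \<phi>(2) that by blast
    have "\<phi> a = \<phi> x" by (rule key[of _ "\<phi> p" "\<phi> p'"]) (use \<phi>(1) pr e UU in auto)
    moreover have "\<phi> b = \<phi> x" by (rule key[of _ "\<phi> q" "\<phi> q'"]) (use \<phi>(1) pr e e(9,10)[THEN E_sym] UU in auto)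
    ultimately show False using pr[OF e(11)] UU by auto
  qed auto
  then show ?thesis
  proof (rule bad_mono, intro ballI)
    fix v assume v: "v \<in> U"
    have bnd: "dg U v \<le> card S" if "finite S" "{u \<in> U. E v u} \<subseteq> S" for v S
      unfolding dg_def using that by (rule card_mono)
    have c3: "card {s, t, r} \<le> 3" "card {s, t, r, w} \<le> 4" for s t r w :: 'a by (auto simp: card_insert_if)
    note M = m[unfolded moser_def]
    note sy = E_comm[of p' p] E_comm[of a p] E_comm[of a p'] E_comm[of b a] E_comm[of q b] E_comm[of q' b] E_comm[of q' q]
      E_comm[of p x] E_comm[of p' x] E_comm[of q x] E_comm[of q' x] E_comm[of a x] E_comm[of b x]
      E_comm[of b p] E_comm[of q p] E_comm[of q' p] E_comm[of b p'] E_comm[of q p'] E_comm[of q' p'] E_comm[of q a] E_comm[of q' a]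
    have "dg U x \<le> card {p, p', q, q'}" by (rule bnd) (use M E_irrefl in \<open>auto simp: UU\<close>)
    moreover have "dg U p \<le> card {x, p', a}" by (rule bnd) (use M sy E_irrefl in \<open>auto simp: UU\<close>)
    moreover have "dg U p' \<le> card {x, p, a}" by (rule bnd) (use M sy E_irrefl in \<open>auto simp: UU\<close>)
    moreover have "dg U a \<le> card {p, p', b}" by (rule bnd) (use M sy E_irrefl in \<open>auto simp: UU\<close>)
    moreover have "dg U b \<le> card {a, q, q'}" by (rule bnd) (use M sy E_irrefl in \<open>auto simp: UU\<close>)
    moreover have "dg U q \<le> card {x, b, q'}" by (rule bnd) (use M sy E_irrefl in \<open>auto simp: UU\<close>)
    moreover have "dg U q' \<le> card {x, b, q}" by (rule bnd) (use M sy E_irrefl in \<open>auto simp: UU\<close>)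
    ultimately have "dg U x \<le> 4" "\<forall>v\<in>{p, p', a, b, q, q'}. dg U v \<le> 3"
      using c3 by (auto intro: order_trans)
    then show "(if v = x then dg U x - 1 else dg U v) \<le> 3" using v UU by auto
  qed
qed

text \<open>Starting from \<open>x\<close>, the colours 0 and 1 alternate along each leg. As the
  legs have the same parity, one colour \<open>c\<close> stands next to every triangle vertex, and
  the two remaining colours of \<open>{0, 1, 2}\<close> cannot colour a triangle.\<close>

lemma bad_tripod:
  assumes t: "tripod l1 l2 l3 M" and U: "M = U - {x}"
  shows "bad U (\<lambda>v. if v = x then dg U x - 1 else dg U v)"
proof -
  note M = tripodD[OF t]
  note D = trilegsD[OF M(1)]
  let ?H = "{hd l1, hd l2, hd l3}"
  let ?k = "\<lambda>v. if v \<in> ?H then 3 else (2::nat)"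
  have UU: "U = insert x M" using U xU by blast
  have h: "hd l1 \<in> set l1" "hd l2 \<in> set l2" "hd l3 \<in> set l3" using D(1-3) by auto
  have xH: "x \<notin> ?H" using h D(7-9) by auto
  have "bad U ?k"
    unfolding bad_def
  proof (intro exI[of _ "\<lambda>v. if v \<in> ?H then {0, 1, 2} else {0, 1}"] conjI notI)
    assume "\<exists>\<phi>. (\<forall>v\<in>U. \<phi> v \<in> (if v \<in> ?H then {0, 1, 2} else {0, 1::nat})) \<and> (\<forall>u\<in>U. \<forall>v\<in>U. E u v \<longrightarrow> \<phi> u \<noteq> \<phi> v)"
    then obtain \<phi> where \<phi>: "\<forall>v\<in>U. \<phi> v \<in> (if v \<in> ?H then {0, 1, 2} else {0, 1::nat})"
      "\<forall>u\<in>U. \<forall>v\<in>U. E u v \<longrightarrow> \<phi> u \<noteq> \<phi> v" by blast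
    \<comment> \<open>The walk from the outer neighbour of a triangle vertex to \<open>x\<close> has
      as many vertices as the leg, so its ends agree for odd length. On a leg with one vertex that
      neighbour is \<open>x\<close> itself.\<close>
    define c where "c = (if odd (length l1) then \<phi> x else 1 - \<phi> x)"
    have px: "\<phi> x \<in> {0, 1}" using \<phi>(1) xH xU by auto
    have leg: "\<phi> (hd l) \<noteq> c" if l: "ipath (l @ [x])" "l \<noteq> []" "odd (length l) = odd (length l1)" "set l \<subseteq> M"
      "set (tl l) \<inter> ?H = {}" for l
    proof -
      obtain v r where lv: "l = v # r" using l(2) by (cases l) auto
      have s: "successively E (v # r @ [x])" using ipath_successively[OF l(1)] lv by simp
      have sub: "set (r @ [x]) \<subseteq> U" using l(4) lv UU by auto
      have "\<phi> (last (r @ [x])) = (if odd (length (r @ [x])) then \<phi> (hd (r @ [x])) else 1 - \<phi> (hd (r @ [x])))"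
      proof (rule alternate)
        show "successively E (r @ [x])" using s by (cases "r @ [x]") auto
        have "z \<notin> ?H" if "z \<in> set (r @ [x])" for z using that l(5) xH lv by auto
        then show "\<forall>z\<in>set (r @ [x]). \<phi> z \<in> {0, 1}" using \<phi>(1) sub by (meson subsetD)
        show "\<forall>u\<in>set (r @ [x]). \<forall>v\<in>set (r @ [x]). E u v \<longrightarrow> \<phi> u \<noteq> \<phi> v" using \<phi>(2) sub by (meson subsetD)
      qed simp
      moreover have "\<phi> (hd (r @ [x])) \<in> {0, 1}"
      proof -
        have "hd (r @ [x]) \<in> set (r @ [x])" by (rule hd_in_set) simp
        moreover from this have "hd (r @ [x]) \<notin> ?H" using l(5) xH lv by auto
        ultimately show ?thesis using \<phi>(1) sub by (meson subsetD)
      qed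
      ultimately have "\<phi> (hd (r @ [x])) = c" using l(3) px unfolding lv c_def by (auto split: if_splits)
      moreover have "E v (hd (r @ [x]))" using s by (cases "r @ [x]") auto
      moreover have "v \<in> U" "hd (r @ [x]) \<in> U" using l(4) lv UU sub hd_in_set[of "r @ [x]"] by auto
      ultimately show ?thesis using \<phi>(2) lv by force
    qed
    have par: "odd (length l2) = odd (length l1)" "odd (length l3) = odd (length l1)" using tripod_parity[OF t] by auto
    have tls: "set (tl l1) \<inter> ?H = {}" "set (tl l2) \<inter> ?H = {}" "set (tl l3) \<inter> ?H = {}"
    proof -
      have "hd l \<notin> set (tl l)" "set (tl l) \<subseteq> set l" if "ipath l" for l
        using ipath_distinct[OF that] that by (cases l; auto)+
      then show "set (tl l1) \<inter> ?H = {}" "set (tl l2) \<inter> ?H = {}" "set (tl l3) \<inter> ?H = {}"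
        using D(4-6,13-15) h by blast+
    qed
    have ips: "ipath (l1 @ [x])" "ipath (l2 @ [x])" "ipath (l3 @ [x])" using M(1) by (auto simp: trilegs_def)
    have n: "\<phi> (hd l1) \<noteq> c" "\<phi> (hd l2) \<noteq> c" "\<phi> (hd l3) \<noteq> c"
      using leg[OF ips(1) D(1) _ _ tls(1)] leg[OF ips(2) D(2) par(1) _ tls(2)] leg[OF ips(3) D(3) par(2) _ tls(3)] M(2)
      by auto
    have hU: "hd l1 \<in> U" "hd l2 \<in> U" "hd l3 \<in> U" using h M(2) UU by auto
    have r: "\<phi> (hd l1) \<in> {0, 1, 2}" "\<phi> (hd l2) \<in> {0, 1, 2}" "\<phi> (hd l3) \<in> {0, 1, 2}"
      using \<phi>(1)[rule_format, OF hU(1)] \<phi>(1)[rule_format, OF hU(2)] \<phi>(1)[rule_format, OF hU(3)] by simp_all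
    have dd: "\<phi> (hd l1) \<noteq> \<phi> (hd l2)" "\<phi> (hd l1) \<noteq> \<phi> (hd l3)" "\<phi> (hd l2) \<noteq> \<phi> (hd l3)"
      using \<phi>(2) hU D(16)[OF h(1,2)] D(17)[OF h(1,3)] D(18)[OF h(2,3)] by blast+
    have "c \<in> {0, 1}" using px by (auto simp: c_def)
    then show False using n r dd by auto
  qed auto
  then show ?thesis
  proof (rule bad_mono, intro ballI)
    fix v assume v: "v \<in> U"
    have bnd: "dg U v \<le> card S" if "finite S" "{u \<in> U. E v u} \<subseteq> S" for v S
      unfolding dg_def using that by (rule card_mono)
    have c3: "card {s, t} \<le> 2" "card {s, t, r} \<le> 3" for s t r :: 'a by (auto simp: card_insert_if)
    have dx: "dg U x \<le> 3"
    proof -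
      have "{u \<in> U. E x u} \<subseteq> {last l1, last l2, last l3}"
        using D(10-12) E_comm[of x] E_irrefl unfolding UU M(2) by auto
      then show ?thesis using bnd[of "{last l1, last l2, last l3}" x] c3(2)[of "last l1" "last l2" "last l3"] by simp
    qed
    have leg: "dg U v \<le> ?k v" if k: "tripod k1 k2 k3 M" "v \<in> set k1" "{hd k1, hd k2, hd k3} = ?H" for k1 k2 k3
    proof -
      note M' = tripodD[OF k(1)]
      note K = trilegsD[OF M'(1)]
      obtain s r where sr: "k1 = s @ v # r" using split_list[OF k(2)] by blast
      have ip: "ipath (s @ v # r @ [x])" using M'(1) by (simp add: trilegs_def sr)
      then have "ipath (v # r @ [x])" using ipath_appendD by blast
      then have R: "\<forall>u\<in>set (r @ [x]). E v u \<longleftrightarrow> u = hd (r @ [x])" using ipath_Cons[of "r @ [x]" v] by simp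
      have k23: "u = hd k2 \<and> v = hd k1" if "u \<in> set k2" "E v u" for u using K(16)[OF k(2) that(1)] that(2) by simp
      have k33: "u = hd k3 \<and> v = hd k1" if "u \<in> set k3" "E v u" for u using K(17)[OF k(2) that(1)] that(2) by simp
      have Ueq: "U = set s \<union> {v} \<union> set (r @ [x]) \<union> set k2 \<union> set k3" using UU M'(2) sr by auto
      show ?thesis
      proof (cases "s = []")
        case True
        then have "v = hd k1" using sr by simp
        then have "v \<in> ?H" using k(3) by blast
        have "{u \<in> U. E v u} \<subseteq> {hd (r @ [x]), hd k2, hd k3}"
          unfolding Ueq using R True k23 k33 E_irrefl by auto
        then have "dg U v \<le> 3"
          using bnd[of "{hd (r @ [x]), hd k2, hd k3}" v] c3(2)[of "hd (r @ [x])" "hd k2" "hd k3"] by simp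
        then show ?thesis using \<open>v \<in> ?H\<close> by simp
      next
        case False
        have "v \<noteq> hd k1" using ipath_distinct[OF K(4)] False unfolding sr by (cases s) auto
        have L: "\<forall>u\<in>set s. E u v \<longleftrightarrow> u = last s" using ip False by (auto simp: ipath_append)
        have "{u \<in> U. E v u} \<subseteq> {last s, hd (r @ [x])}"
          unfolding Ueq using R L k23 k33 E_irrefl E_sym[of v] \<open>v \<noteq> hd k1\<close> by auto
        then have "dg U v \<le> 2" using bnd[of "{last s, hd (r @ [x])}" v] c3(1)[of "last s" "hd (r @ [x])"] by simp
        then show ?thesis by simp
      qed
    qed
    consider "v = x" | "v \<in> set l1" | "v \<in> set l2" | "v \<in> set l3" using v UU M(2) by auto
    then show "(if v = x then dg U x - 1 else dg U v) \<le> ?k v"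
    proof cases
      case 1 then show ?thesis using dx xH by auto
    next
      case 2
      then have "v \<noteq> x" using D(7) by auto
      then show ?thesis using leg[OF t 2 refl] by simp
    next
      case 3
      have "{hd l2, hd l1, hd l3} = ?H" by auto
      moreover have "v \<noteq> x" using D(8) 3 by auto
      ultimately show ?thesis using leg[OF tripod_swap12[OF t] 3] by simp
    next
      case 4
      have "{hd l3, hd l1, hd l2} = ?H" by auto
      moreover have "v \<noteq> x" using D(9) 4 by auto
      ultimately show ?thesis using leg[OF tripod_swap12[OF tripod_swap23[OF t]] 4] by simp
    qed
  qed
qed

lemma critical_bad: "bad U (\<lambda>v. if v = x then dg U x - 1 else dg U v)"
proof (cases "\<exists>a b c. {a, b, c} \<subseteq> U \<and> E x a \<and> E x b \<and> E x c \<and> E a b \<and> E b c \<and> E a c")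
  case True
  then have "\<forall>u\<in>U. \<forall>v\<in>U. u \<noteq> v \<longrightarrow> E u v" using clique by blast
  then have "bad U (\<lambda>_. card U - 1)" using bad_complete[OF fin] xU by blast
  then show ?thesis
    by (rule bad_mono) (use dg_le[OF fin] in \<open>auto intro: order_trans[OF diff_le_self]\<close>)
next
  case noK: False
  obtain l1 l2 l3 where "trilegs x l1 l2 l3" "set l1 \<union> set l2 \<union> set l3 \<subseteq> U - {x}"
    using exists_trilegs by blast
  then have t: "tripod l1 l2 l3 (set l1 \<union> set l2 \<union> set l3)" (is "tripod _ _ _ ?M") by (simp add: tripod_def)
  show ?thesis
  proof (cases "?M = U - {x}")
    case True
    then show ?thesis by (rule bad_tripod[OF t])
  next
    case False
    note T = tripodD[OF t]
    have ne: "?M \<noteq> {}" using trilegsD(1)[OF T(1)] by simp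
    show ?thesis
    proof (rule outside[OF T(3) ne False])
      fix y e f assume y: "y \<in> U - {x} - ?M" "e \<in> ?M" "f \<in> ?M" "e \<noteq> f" "E y e" "E y f"
      from vertex[OF t y noK] obtain v a b v2 v3 where Exy: "E x y" and t': "tripod [v, a, b] [v2] [v3] ?M"
        and S: "\<forall>z\<in>?M. E y z \<longleftrightarrow> z = a \<or> z = b" by blast
      note T' = tripodD[OF t']
      note D = trilegsD[OF T'(1)]
      have dv: "distinct [v, a, b]" using ipath_distinct[OF D(4)] .
      have M: "?M = {v, a, b, v2, v3}" using T'(2) by auto
      have d: "distinct [v, a, b, v2, v3, y]" using dv D(13-15) y(1) M by auto
      have yE: "E y a" "E y b" "\<not> E y v" "\<not> E y v2" "\<not> E y v3" using S d unfolding M by auto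
      have ip: "E v a" "E a b" "\<not> E v b" using D(4) by auto
      have "E b y" "E b a" "E a v" "\<not> E b v" using yE(2) ip E_sym by blast+
      moreover have "E v v2" "\<not> E a v2" "\<not> E b v2" using D(16)[of v v2] D(16)[of a v2] D(16)[of b v2] dv by auto
      moreover have "E v v3" "\<not> E a v3" "\<not> E b v3" using D(17)[of v v3] D(17)[of a v3] D(17)[of b v3] dv by auto
      moreover have "E v2 v3" using D(18)[of v2 v3] by auto
      moreover have "E b x" "\<not> E a x" "\<not> E v x" "E v2 x" "E v3 x"
        using D(10)[of b] D(10)[of a] D(10)[of v] D(11)[of v2] D(12)[of v3] dv by auto
      then have "E x b" "\<not> E x a" "\<not> E x v" "E x v2" "E x v3" using E_sym by blast+
      moreover have "{b, y, a, v, v2, v3} \<subseteq> U - {x}" using T'(3) y(1) unfolding M by auto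
      moreover have "distinct [b, y, a, v, v2, v3]" using d by auto
      ultimately have "moser b y a v v2 v3" unfolding moser_def using yE Exy by blast
      then show ?thesis using bad_moser moser_spans[OF noK] by blast
    next
      fix Y a assume "a \<in> ?M" "ipath Y" "set Y \<subseteq> U - {x} - ?M"
        "\<forall>y\<in>set Y. \<forall>z\<in>?M. E y z \<longleftrightarrow> y = hd Y \<and> z = a" "\<forall>y\<in>set Y. E y x \<longleftrightarrow> y = last Y"
      then show ?thesis using spider[OF t] by blast
    next
      fix Y a b assume "a \<in> ?M" "b \<in> ?M" "a \<noteq> b" "ipath Y" "set Y \<subseteq> U - {x} - ?M"
        "\<forall>y\<in>set Y. \<forall>z\<in>?M. E y z \<longleftrightarrow> y = hd Y \<and> z = a \<or> y = last Y \<and> z = b" "\<forall>y\<in>set Y. \<not> E y x"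
      then show ?thesis using ear[OF t] by blast
    qed
  qed
qed

end

section \<open>Cut vertices and the theorem\<close>

context sgraph
begin

lemma bad_zero:
  assumes "x \<in> U" "k x = 0"
  shows "bad U k"
  unfolding bad_def
proof (intro exI[of _ "\<lambda>v. {..<k v}"] conjI notI)
  assume "\<exists>\<phi>. (\<forall>v\<in>U. \<phi> v \<in> {..<k v}) \<and> (\<forall>u\<in>U. \<forall>v\<in>U. E u v \<longrightarrow> \<phi> u \<noteq> \<phi> v)"
  then show False using assms by fastforce
qed auto

text \<open>\<open>x\<close> gets a single new colour, which is added to the lists of its neighbours
  and lost to all of them, so the bad lists on \<open>U - {x}\<close> are restored. A single colour
  is the size required when \<open>x\<close> has degree 2.\<close>

lemma bad_add_vertex:
  assumes "finite U" "x \<in> U" "bad (U - {x}) (dg (U - {x}))"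
  shows "bad U (\<lambda>v. if v = x then 1 else dg U v)"
proof -
  obtain L :: "'a \<Rightarrow> nat set" where L: "\<forall>v\<in>U - {x}. finite (L v) \<and> card (L v) = dg (U - {x}) v"
    "\<not> (\<exists>\<phi>. (\<forall>v\<in>U - {x}. \<phi> v \<in> L v) \<and> (\<forall>u\<in>U - {x}. \<forall>v\<in>U - {x}. E u v \<longrightarrow> \<phi> u \<noteq> \<phi> v))"
    using assms(3) unfolding bad_def by blast
  define L' where "L' v = (if v = x then {0} else Suc ` L v \<union> (if E v x then {0} else {}))" for v
  have dgU: "dg U v = dg (U - {x}) v + (if E v x then 1 else 0)" for v
  proof -
    have "{u \<in> U. E v u} = {u \<in> U - {x}. E v u} \<union> (if E v x then {x} else {})" using assms(2) by auto
    then show ?thesis using assms(1) by (auto simp: dg_def)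
  qed
  have 1: "\<forall>v\<in>U. finite (L' v) \<and> card (L' v) = (if v = x then 1 else dg U v)"
  proof
    fix v assume "v \<in> U"
    then show "finite (L' v) \<and> card (L' v) = (if v = x then 1 else dg U v)"
      using L(1) by (cases "v = x") (auto simp: L'_def dgU card_image card_insert_if)
  qed
  have False if \<phi>: "\<forall>v\<in>U. \<phi> v \<in> L' v" "\<forall>u\<in>U. \<forall>v\<in>U. E u v \<longrightarrow> \<phi> u \<noteq> \<phi> v" for \<phi>
  proof -
    have x0: "\<phi> x = 0" using \<phi>(1) assms(2) by (auto simp: L'_def)
    have S: "\<exists>c\<in>L v. \<phi> v = Suc c" if v: "v \<in> U - {x}" for v
    proof -
      have "E v x \<Longrightarrow> \<phi> v \<noteq> 0" using \<phi>(2) v assms(2) x0 by force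
      then show ?thesis using \<phi>(1) v by (auto simp: L'_def split: if_splits)
    qed
    let ?\<psi> = "\<lambda>v. \<phi> v - 1"
    have "\<forall>v\<in>U - {x}. ?\<psi> v \<in> L v" using S by fastforce
    moreover have "\<forall>u\<in>U - {x}. \<forall>v\<in>U - {x}. E u v \<longrightarrow> ?\<psi> u \<noteq> ?\<psi> v"
    proof (intro ballI impI)
      fix u v assume uv: "u \<in> U - {x}" "v \<in> U - {x}" "E u v"
      then have "\<phi> u \<noteq> \<phi> v" using \<phi>(2) by blast
      then show "?\<psi> u \<noteq> ?\<psi> v" using S[OF uv(1)] S[OF uv(2)] by auto
    qed
    ultimately show False using L(2) by (meson exI[of _ ?\<psi>])
  qed
  then show ?thesis unfolding bad_def using 1 by blast
qed

abbreviation "dgx U x \<equiv> (\<lambda>v. if v = x then dg U x - 1 else dg U v)"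

text \<open>The lobe \<open>U1\<close> carries the deficit of one at \<open>x\<close>, the other
  lobe has full degree sizes, and the merged lists are at least as large as required. The cut vertex
  \<open>v\<close> may be \<open>x\<close> itself.\<close>

lemma bad_merge_x:
  assumes "finite U" "U1 \<union> U2 = U" "U1 \<inter> U2 = {v}" "\<forall>u\<in>U1 - {v}. \<forall>w\<in>U2 - {v}. \<not> E u w"
    and "x \<in> U1" "bad U1 (dgx U1 x)" "bad U2 (dg U2)"
  shows "bad U (dgx U x)"
proof -
  note d = dg_split[OF assms(1-4)]
  have "bad U (\<lambda>u. if u = v then dgx U1 x v + dg U2 v else if u \<in> U1 then dgx U1 x u else dg U2 u)"
    using bad_merge[OF assms(6,7,3)] unfolding assms(2) .
  then show ?thesis
  proof (rule bad_mono, intro ballI)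
    fix u assume u: "u \<in> U"
    have x2: "x \<notin> U2" if "v \<noteq> x" using assms(3,5) that by auto
    show "dgx U x u \<le> (if u = v then dgx U1 x v + dg U2 v else if u \<in> U1 then dgx U1 x u else dg U2 u)"
      using d(1) d(2)[of u] d(3)[of u] u assms(2,5) x2 by auto
  qed
qed

text \<open>Induction down to a \<open>critical_pair\<close>. Degree at most 1 at \<open>x\<close>
  means an empty list, and degree 2 is settled by \<open>bad_add_vertex\<close>. If \<open>x\<close>
  is a cut vertex, not both lobes are degree-AT, so one supplies full lists and the other lists with
  the deficit. At any other cut vertex the lobe without \<open>x\<close> is not degree-AT, since
  otherwise \<open>U - {x}\<close> would be and \<open>x\<close> could be added as a sink.\<close>

theorem AT_dichotomy:
  assumes "finite U" "conn U" "x \<in> U"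
  shows "xAT U x \<or> bad U (dgx U x)"
  using assms
proof (induction "card U" arbitrary: U rule: less_induct)
  case less
  note fin = less.prems(1) and con = less.prems(2) and xU = less.prems(3)
  show ?case
  proof (rule ccontr)
    assume n: "\<not> ?thesis"
    then have nAT: "\<not> xAT U x" and nb: "\<not> bad U (dgx U x)" by auto
    have d2: "2 \<le> dg U x"
    proof (rule ccontr)
      assume "\<not> 2 \<le> dg U x"
      then have "bad U (dgx U x)" by (intro bad_zero[OF xU]) simp
      then show False using nb by blast
    qed
    have Ux: "U \<noteq> {x}"
    proof
      assume "U = {x}"
      then have "dg U x = 0" using E_irrefl by (simp add: dg_def)
      then show False using d2 by simp
    qed
    have part: "card U1 < card U" "finite U1" if "U1 \<union> U2 = U" "U1 \<noteq> U" for U1 U2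
      using that fin by (auto intro!: psubset_card_mono)
    have nc: "conn (U - {x})"
    proof (rule ccontr)
      assume "\<not> conn (U - {x})"
      from cut_split[OF con xU Ux this] obtain U1 U2 where U: "U1 \<union> U2 = U" "U1 \<inter> U2 = {x}" "conn U1" "conn U2"
        "U1 \<noteq> U" "U2 \<noteq> U" "\<forall>u\<in>U1 - {x}. \<forall>w\<in>U2 - {x}. \<not> E u w" by blast
      have U': "U2 \<union> U1 = U" "U2 \<inter> U1 = {x}" "\<forall>u\<in>U2 - {x}. \<forall>w\<in>U1 - {x}. \<not> E u w" using U E_sym by blast+
      have x12: "x \<in> U1" "x \<in> U2" using U(2) by auto
      have na: "\<not> xAT U1 x" "\<not> xAT U2 x" using xAT_extend[OF fin con] U(1) x12 nAT by blast+
      have b: "bad U1 (dgx U1 x)" "bad U2 (dgx U2 x)"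
        using less.hyps[OF part(1)[OF U(1,5)] part(2)[OF U(1,5)] U(3) x12(1)]
          less.hyps[OF part(1)[OF U'(1) U(6)] part(2)[OF U'(1) U(6)] U(4) x12(2)] na by blast+
      have "\<not> (dAT U1 \<and> dAT U2)" using xAT_two_lobes[OF _ _ U(2,7)] U(1) nAT by auto
      then have "bad U1 (dg U1) \<or> bad U2 (dg U2)"
        using degree_dichotomy[OF part(2)[OF U(1,5)] U(3)] degree_dichotomy[OF part(2)[OF U'(1) U(6)] U(4)] by blast
      then show False
        using bad_merge_x[OF fin U(1,2,7) x12(1) b(1)] bad_merge_x[OF fin U' x12(2) b(2)] nb by blast
    qed
    have nd: "\<not> dAT (U - {x})" using xAT_sink[OF _ d2 xU] nAT by blast
    have "dg U x \<noteq> 2"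
    proof
      assume "dg U x = 2"
      have "bad (U - {x}) (dg (U - {x}))" using degree_dichotomy[OF _ nc] fin nd by auto
      from bad_add_vertex[OF fin xU this] have "bad U (dgx U x)"
        by (rule bad_mono) (use \<open>dg U x = 2\<close> in auto)
      then show False using nb by blast
    qed
    then have d3: "3 \<le> dg U x" using d2 by simp
    have cut: "conn (U - {v})" if v: "v \<in> U" for v
    proof (rule ccontr)
      assume nv: "\<not> conn (U - {v})"
      then have vx: "v \<noteq> x" using nc by blast
      then have "U \<noteq> {v}" using xU by auto
      from cut_split[OF con v this nv] obtain U1 U2 where U: "U1 \<union> U2 = U" "U1 \<inter> U2 = {v}" "conn U1" "conn U2"
        "U1 \<noteq> U" "U2 \<noteq> U" "\<forall>u\<in>U1 - {v}. \<forall>w\<in>U2 - {v}. \<not> E u w" by blast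
      have *: False if U: "U1 \<union> U2 = U" "U1 \<inter> U2 = {v}" "conn U1" "conn U2"
        "U1 \<noteq> U" "U2 \<noteq> U" "\<forall>u\<in>U1 - {v}. \<forall>w\<in>U2 - {v}. \<not> E u w" and x1: "x \<in> U1" for U1 U2
      proof -
        have U': "U2 \<union> U1 = U" using U(1) by blast
        have "x \<notin> U2" using x1 vx U(2) by auto
        then have "U2 \<subseteq> U - {x}" using U(1) by blast
        then have "\<not> dAT U2" using dAT_extend[OF _ nc] nd fin conn_nonempty[OF U(4)] by auto
        then have "bad U2 (dg U2)" using degree_dichotomy[OF part(2)[OF U' U(6)] U(4)] by blast
        moreover have "\<not> xAT U1 x" using xAT_extend[OF fin con _ x1] U(1) nAT by blast
        then have "bad U1 (dgx U1 x)" using less.hyps[OF part(1)[OF U(1,5)] part(2)[OF U(1,5)] U(3) x1] by blast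
        ultimately show False using bad_merge_x[OF fin U(1,2,7) x1] nb by blast
      qed
      have "x \<in> U1 \<or> x \<in> U2" using U(1) xU by blast
      moreover have "U2 \<union> U1 = U" "U2 \<inter> U1 = {v}" "\<forall>u\<in>U2 - {v}. \<forall>w\<in>U1 - {v}. \<not> E u w" using U E_sym by blast+
      ultimately show False using *[OF U] *[OF _ _ U(4,3,6,5)] by blast
    qed
    interpret critical_pair E U x
      by unfold_locales (use fin con xU cut d3 nAT in auto)
    show False using critical_bad nb by blast
  qed
qed

end

section \<open>Translation to digraphs, and the theorem\<close>

lemma bal_eq_card_diff:
  assumes "finite F"
  shows "bal F v = int (card {e \<in> F. fst e = v}) - int (card {e \<in> F. snd e = v})"
proof -
  have "(\<Sum>e\<in>F. of_bool (P e) :: int) = int (card {e \<in> F. P e})" for P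
    using assms by (simp add: Int_def)
  then show ?thesis by (simp add: bal_def sum_subtractf)
qed

text \<open>A spanning subgraph is determined by its arcs, and equal indegrees and outdegrees mean
  balance zero, so the signed count at zero is \<open>EE D - EO D\<close>.\<close>

lemma AT_digraph_iff:
  assumes "finite (pverts D)" "parcs D \<subseteq> pverts D \<times> pverts D"
  shows "AT_digraph D \<longleftrightarrow> signed_count (parcs D) (\<lambda>_. 0) \<noteq> 0"
proof -
  let ?S = "{F. F \<subseteq> parcs D \<and> bal F = (\<lambda>_. 0)}"
  have finD: "finite (parcs D)" using assms by (meson finite_SigmaI finite_subset)
  have wfD: "wf_digraph (with_proj D)" using assms(2) by unfold_locales auto
  define mk where "mk F = \<lparr>pverts = pverts D, parcs = F\<rparr>" for F :: "('a \<times> 'a) set"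
  have eul: "spanning_eulerian (mk F) D" if F: "F \<in> ?S" for F
  proof -
    have wfF: "wf_digraph (with_proj (mk F))" using F assms(2) by unfold_locales (auto simp: mk_def)
    have fF: "finite F" using F finD by (auto intro: finite_subset)
    have "in_degree (with_proj (mk F)) v = out_degree (with_proj (mk F)) v" for v
    proof -
      have "bal F v = 0" using F by simp
      then have "card {e \<in> F. fst e = v} = card {e \<in> F. snd e = v}" using bal_eq_card_diff[OF fF, of v] by simp
      then show ?thesis by (simp add: in_degree_def out_degree_def in_arcs_def out_arcs_def mk_def)
    qed
    then show ?thesis
      using F wfF wfD by (auto simp: spanning_eulerian_def spanning_def subgraph_def compatible_def mk_def)
  qed
  have conv: "parcs H \<in> ?S \<and> H = mk (parcs H)" if H: "spanning_eulerian H D" for H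
  proof -
    have sub: "parcs H \<subseteq> parcs D" "pverts H = pverts D"
      using H by (auto simp: spanning_eulerian_def spanning_def subgraph_def)
    have fH: "finite (parcs H)" using sub finD by (auto intro: finite_subset)
    have "bal (parcs H) v = 0" for v
    proof (cases "v \<in> pverts H")
      case True
      then have "in_degree (with_proj H) v = out_degree (with_proj H) v"
        using H by (simp add: spanning_eulerian_def)
      then show ?thesis using bal_eq_card_diff[OF fH, of v]
        by (simp add: in_degree_def out_degree_def in_arcs_def out_arcs_def)
    next
      case False
      then show ?thesis using bal_outside[of "parcs H" "pverts D" v] sub assms(2) by auto
    qed
    then show ?thesis using sub by (auto simp: mk_def)
  qed
  have cnt: "card {H. spanning_eulerian H D \<and> P (card (parcs H))} = card {F \<in> ?S. P (card F)}" for P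
  proof (rule bij_betw_same_card[of parcs], rule bij_betwI[of _ _ _ mk])
    show "parcs \<in> {H. spanning_eulerian H D \<and> P (card (parcs H))} \<rightarrow> {F \<in> ?S. P (card F)}" using conv by auto
    show "mk \<in> {F \<in> ?S. P (card F)} \<rightarrow> {H. spanning_eulerian H D \<and> P (card (parcs H))}"
      using eul by (auto simp: mk_def)
  qed (use conv in \<open>auto simp: mk_def\<close>)
  have "signed_count (parcs D) (\<lambda>_. 0) = (\<Sum>F\<in>{F \<in> ?S. even (card F)}. 1) + (\<Sum>F\<in>{F \<in> ?S. odd (card F)}. -1)"
  proof -
    have "signed_count (parcs D) (\<lambda>_. 0) =
        (\<Sum>F\<in>{F \<in> ?S. even (card F)} \<union> {F \<in> ?S. odd (card F)}. (-1) ^ card F)"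
      unfolding signed_count_def by (rule sum.cong) auto
    also have "\<dots> = (\<Sum>F\<in>{F \<in> ?S. even (card F)}. (-1) ^ card F) + (\<Sum>F\<in>{F \<in> ?S. odd (card F)}. (-1) ^ card F)"
      by (rule sum.union_disjoint) (use finD in auto)
    finally show ?thesis by simp
  qed
  then have "signed_count (parcs D) (\<lambda>_. 0) = int (EE D) - int (EO D)"
    unfolding EE_def EO_def cnt[of even] cnt[of odd] by simp
  then show ?thesis by (auto simp: AT_digraph_def)
qed

context pair_graph
begin

definition adj :: "'a \<Rightarrow> 'a \<Rightarrow> bool" where
  "adj u v \<longleftrightarrow> (u, v) \<in> parcs G"

lemma adj_sym: "adj u v \<Longrightarrow> adj v u"
  using pair_sym_arcs by (auto simp: adj_def symmetric_def sym_def)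

sublocale sgraph adj
  by unfold_locales (auto simp: adj_def intro: adj_sym[unfolded adj_def] dest: pair_no_loops)

lemma adj_verts: "adj u v \<Longrightarrow> u \<in> pverts G \<and> v \<in> pverts G"
  using arc_fst_in_verts arc_snd_in_verts by (force simp: adj_def)

lemma deg_eq: "deg G v = dg (pverts G) v"
proof -
  have "{e \<in> parcs G. fst e = v} = Pair v ` {u \<in> pverts G. adj v u}"
    using adj_verts by (force simp: adj_def)
  then show ?thesis by (simp add: out_degree_def out_arcs_def dg_def card_image inj_on_def)
qed

text \<open>A vertex set that no edge leaves would contain everything reachable from it.\<close>

lemma conn_verts:
  assumes "Digraph_Component.connected (with_proj G)"
  shows "conn (pverts G)"
  unfolding conn_def
proof (intro conjI allI impI)
  have sc: "pverts G \<noteq> {}" "\<And>u v. u \<in> pverts G \<Longrightarrow> v \<in> pverts G \<Longrightarrow>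
      (u, v) \<in> rtrancl_on (pverts G) (parcs (mk_symmetric (with_proj G)))"
    using assms by (auto simp: connected_def strongly_connected_def reachable_def)
  have arc: "adj u v" if "(u, v) \<in> parcs (mk_symmetric (with_proj G))" for u v
    using that adj_sym by (auto simp: parcs_mk_symmetric adj_def)
  show "pverts G \<noteq> {}" by (rule sc)
  fix A assume A: "A \<subseteq> pverts G" "A \<noteq> {}" "A \<noteq> pverts G"
  show "\<exists>a\<in>A. \<exists>b\<in>pverts G - A. adj a b"
  proof (rule ccontr)
    assume n: "\<not> ?thesis"
    obtain u v where uv: "u \<in> A" "v \<in> pverts G" "v \<notin> A" using A by blast
    have "(u, v) \<in> rtrancl_on (pverts G) (parcs (mk_symmetric (with_proj G)))" using sc(2) uv A by blast
    then have "v \<in> A"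
    proof (induction rule: rtrancl_on_induct)
      case base
      then show ?case using uv by blast
    next
      case (step b c)
      then show ?case using n arc by blast
    qed
    then show False using uv by blast
  qed
qed

lemma xAT_imp_AT:
  assumes "xAT (pverts G) x" "x \<in> pverts G"
  shows "AT G (h x)"
proof -
  let ?U = "pverts G"
  obtain A where A: "orients ?U A" "signed_count A (\<lambda>_. 0) \<noteq> 0" "\<forall>v\<in>?U. (if v = x then 2 else 1) \<le> ind A v"
    and fU: "finite ?U" using assms(1) unfolding ATg_def by blast
  have AE: "(u, v) \<in> A \<Longrightarrow> u \<in> ?U \<and> v \<in> ?U \<and> adj u v" for u v using A(1) by (auto simp: orients_def)
  have tot: "((u, v) \<in> A) \<noteq> ((v, u) \<in> A)" if "adj u v" for u v
    using A(1) that adj_verts[OF that] by (auto simp: orients_def)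
  have fA: "finite A" by (rule orients_finite[OF fU A(1)])
  define D where "D = \<lparr>pverts = ?U, parcs = A\<rparr>"
  have "(u, v) \<in> parcs G \<longleftrightarrow> (u, v) \<in> A \<or> (v, u) \<in> A" for u v
    using AE[of u v] AE[of v u] tot[of u v] adj_sym[of v u] unfolding adj_def by blast
  moreover have "(v, u) \<notin> A" if "(u, v) \<in> A" for u v using AE[OF that] tot[of u v] that by blast
  ultimately have or: "orientation D G" unfolding orientation_def D_def by auto
  have "AT_digraph D"
    by (subst AT_digraph_iff) (use fU AE A(2) in \<open>auto simp: D_def\<close>)
  moreover have "int (out_degree (with_proj D) v) \<le> int (deg G v) - h x v - 1" if v: "v \<in> ?U" for v
  proof -
    have "{e \<in> A. fst e = v} = Pair v ` {u. (v, u) \<in> A}" by force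
    then have o: "out_degree (with_proj D) v = card {u. (v, u) \<in> A}"
      by (simp add: out_degree_def out_arcs_def D_def card_image inj_on_def)
    have "{u \<in> ?U. adj v u} = {u. (v, u) \<in> A} \<union> {u. (u, v) \<in> A}" using AE tot adj_sym by blast
    moreover have "{u. (v, u) \<in> A} \<inter> {u. (u, v) \<in> A} = {}" using AE tot by blast
    moreover have "finite {u. (v, u) \<in> A}" "finite {u. (u, v) \<in> A}"
      using AE fU by (auto intro: finite_subset[of _ ?U])
    ultimately have "dg ?U v = card {u. (v, u) \<in> A} + ind A v" by (simp add: dg_def ind_def card_Un_disjoint)
    then show ?thesis using A(3) v unfolding deg_eq o h_def by fastforce
  qed
  ultimately show ?thesis unfolding AT_def using or by blast
qed

lemma AT_imp_paintable:
  assumes "AT G g"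
  shows "paintable G (\<lambda>v. int (deg G v) - g v)"
proof -
  obtain D where D: "orientation D G" "AT_digraph D"
    "\<forall>v\<in>pverts G. int (out_degree (with_proj D) v) \<le> int (deg G v) - g v - 1"
    using assms unfolding AT_def by blast
  have U: "pverts D = pverts G" "parcs D \<union> (parcs D)\<inverse> = parcs G" using D(1) by (auto simp: orientation_def)
  have PG: "parcs G \<subseteq> pverts G \<times> pverts G" using adj_verts by (auto simp: adj_def)
  have PD: "parcs D \<subseteq> pverts G \<times> pverts G" using U(2) PG by blast
  then have fD: "finite (parcs D)" using pair_finite_verts by (meson finite_SigmaI finite_subset)
  have nz: "signed_count (parcs D) (\<lambda>_. 0) \<noteq> 0"
    using AT_digraph_iff[of D] D(2) PD pair_finite_verts U(1) by simp
  have "outd (parcs D) v = int (out_degree (with_proj D) v)" for v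
    using outd_card[OF fD] by (simp add: out_degree_def out_arcs_def)
  then have "\<forall>v\<in>pverts G. outd (parcs D) v - 0 < int (deg G v) - g v" using D(3) by force
  then show ?thesis by (rule orientation_paintable[OF pair_finite_verts PG U(2) nz])
qed

lemma paintable_imp_h_choosable:
  assumes "paintable G (\<lambda>v. int (deg G v) - h x v)"
  shows "h_choosable G x"
  unfolding h_choosable_def
proof (intro allI impI)
  fix L :: "'a \<Rightarrow> nat set"
  assume L: "(\<forall>v\<in>pverts G. finite (L v)) \<and> card (L x) = deg G x - 1 \<and>
    (\<forall>v\<in>pverts G. v \<noteq> x \<longrightarrow> card (L v) = deg G v)"
  \<comment> \<open>The truncated difference \<open>deg G x - 1\<close> is never below the integer
    one, so the list sizes dominate the tokens.\<close>
  show "\<exists>\<phi>. proper_coloring G \<phi> \<and> (\<forall>v\<in>pverts G. \<phi> v \<in> L v)"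
    by (rule paintable_colorable[OF assms]) (use L adj_verts in \<open>auto simp: h_def adj_def\<close>)
qed

lemma bad_imp_not_h_choosable:
  assumes "bad (pverts G) (dgx (pverts G) x)" "x \<in> pverts G"
  shows "\<not> h_choosable G x"
proof
  assume ch: "h_choosable G x"
  obtain L :: "'a \<Rightarrow> nat set" where L: "\<forall>v\<in>pverts G. finite (L v) \<and> card (L v) = dgx (pverts G) x v"
    "\<not> (\<exists>\<phi>. (\<forall>v\<in>pverts G. \<phi> v \<in> L v) \<and> (\<forall>u\<in>pverts G. \<forall>v\<in>pverts G. adj u v \<longrightarrow> \<phi> u \<noteq> \<phi> v))"
    using assms(1) unfolding bad_def by blast
  have "(\<forall>v\<in>pverts G. finite (L v)) \<and> card (L x) = deg G x - 1 \<and>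
    (\<forall>v\<in>pverts G. v \<noteq> x \<longrightarrow> card (L v) = deg G v)"
    using L(1) assms(2) unfolding deg_eq by simp
  then obtain \<phi> where "proper_coloring G \<phi>" "\<forall>v\<in>pverts G. \<phi> v \<in> L v"
    using ch unfolding h_choosable_def by blast
  then show False using L(2) by (auto simp: proper_coloring_def adj_def)
qed

end

theorem theorem11:
  fixes G :: "'a pair_pre_digraph" and x :: 'a
  assumes "pair_graph G"
    and "Digraph_Component.connected (with_proj G)"
    and "x \<in> pverts G"
  shows "(\<not> h_choosable G x \<longleftrightarrow> \<not> AT G (h x)) \<and>
         (\<not> paintable G (\<lambda>v. int (deg G v) - h x v) \<longleftrightarrow> \<not> AT G (h x))"
proof -
  interpret pair_graph G by (rule assms(1))
  \<comment> \<open>The implications form a cycle: AT gives paintable, paintable gives choosable,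
    and this fact leads from choosable back to AT.\<close>
  have "AT G (h x) \<or> \<not> h_choosable G x"
    using AT_dichotomy[OF pair_finite_verts conn_verts[OF assms(2)] assms(3)]
      xAT_imp_AT[OF _ assms(3)] bad_imp_not_h_choosable[OF _ assms(3)] by blast
  then show ?thesis using AT_imp_paintable[of "h x"] paintable_imp_h_choosable[of x] by blast
qed

end
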